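(* The multiplicity of every point in $\mathcal{T}\mathrm{Gr}(2,n)$, viewed in its ambient torus, is $1$. That is: for every $x\in\mathcal{T}\mathrm{Gr}(2,n)$ with vanishing set $J=J(x)$ and every $ij\notin J$, the point $y=(x_{kl}-x_{ij})_{kl\notin J\cup\{ij\}}$ of the tropicalization of $\mathrm{Gr}_J(2,n)\subset\operatorname{Spec}K[u_{kl}^{\pm}:kl\notin J\cup\{ij\}]$ has tropical multiplicity $1$.
   Context: $K$ is a field complete with respect to a non-Archimedean valuation $\nu$, $|\cdot|=\exp(-\nu(\cdot))$ (possibly trivial). $L|K$ is an algebraically closed complete extension field whose valuation $\nu\colon L^\ast\to\mathbb R$ extends that of $K$ and is surjective; $\widetilde L$ is its residue field. Pairs $kl\in\binom{[n]}2$ are unordered. $\mathrm{Gr}(2,n)\subset\mathbb{P}_K^{\binom n2-1}$ is embedded by Plücker coordinates $p_{kl}$ ($p_{lk}=-p_{kl}$); $^{\mathrm{an}}$ is Berkovich analytification. $\overline{\mathbb R}=\mathbb R\cup\{-\infty\}$, $\log0=-\infty$; $\mathrm{trop}\colon\mathrm{Gr}(2,n)^{\mathrm{an}}\to(\overline{\mathbb R}^{\binom n2}\smallsetminus\{(-\infty,\dots,-\infty)\})/\mathbb R\cdot(1,\dots,1)$ sends $\gamma$ over $\{p_{ij}\ne0\}$ to the class of $x$ with $x_{kl}-x_{ij}=\log\gamma(p_{kl}/p_{ij})$; $\mathcal{T}\mathrm{Gr}(2,n)$ is its image; $J(x)=\{kl:x_{kl}=-\infty\}$. $\mathrm{Gr}_J(2,n)$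 is the reduced locally closed subscheme of $\mathrm{Gr}(2,n)$ where exactly the Plücker coordinates in $J$ vanish; via $u_{kl}=p_{kl}/p_{ij}$ it is a closed subscheme of $\operatorname{Spec}K[u_{kl}^{\pm}:kl\notin J\cup\{ij\}]$, with ideal $\mathfrak I$. Initial degeneration and multiplicity: fix an $L$-point $\tau$ of the torus with $\log|\tau_{kl}|=y_{kl}$. For a nonzero Laurent polynomial $f=\sum_\alpha c_\alpha u^\alpha$ over $L$, $\mathrm{in}_y(f)=\sum_\alpha\overline{\lambda c_\alpha\tau^\alpha}\,u^\alpha\in\widetilde L[u_{kl}^\pm]$, where $\nu(\lambda)=\max_\alpha\{-\nu(c_\alpha)+\langle\alpha,y\rangle\}$ and the bar is the residue class. $\mathrm{in}_y\mathfrak I$ is the ideal generated by all $\mathrm{in}_y(f)$ with $f\in\mathfrak I\otimes_KL$, and $\mathrm{in}_y\mathrm{Gr}_J(2,n)=\operatorname{Spec}\bigl(\widetilde L[u_{kl}^{\pm}:kl\notin J\cup\{ij\}]/\mathrm{in}_y\mathfrak I\bigr)$. The multiplicity of $y$ is the number of irreducible components of $\mathrm{in}_y\mathrm{Gr}_J(2,n)$, counted with multiplicities (lengths of the local rings at generic points). *)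

theory Defs
  imports
    "HOL-Analysis.Analysis"
    "HOL-Algebra.QuotRing"
    "HOL-Library.Poly_Mapping"
    "HOL-Library.Ramsey"
    "HOL-Computational_Algebra.Polynomial"
begin

section \<open>Valued fields\<close>

text \<open>A valuation takes real values on the nonzero elements; its value at 0 is never used
  (it stands for infinity). The trivial valuation is allowed.\<close>

definition valuation :: "('a::field \<Rightarrow> real) \<Rightarrow> bool" where
  "valuation \<nu> \<longleftrightarrow>
     (\<forall>a b. a \<noteq> 0 \<longrightarrow> b \<noteq> 0 \<longrightarrow> \<nu> (a * b) = \<nu> a + \<nu> b) \<and>
     (\<forall>a b. a \<noteq> 0 \<longrightarrow> b \<noteq> 0 \<longrightarrow> a + b \<noteq> 0 \<longrightarrow> min (\<nu> a) (\<nu> b) \<le> \<nu> (a + b))"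

definition absv :: "('a::field \<Rightarrow> real) \<Rightarrow> 'a \<Rightarrow> real" where
  "absv \<nu> a = (if a = 0 then 0 else exp (- \<nu> a))"

definition complete_valuation :: "('a::field \<Rightarrow> real) \<Rightarrow> bool" where
  "complete_valuation \<nu> \<longleftrightarrow>
     valuation \<nu> \<and> Metric_space.mcomplete UNIV (\<lambda>a b. absv \<nu> (a - b))"

definition valued_extension ::
  "('k::field \<Rightarrow> real) \<Rightarrow> ('l::field \<Rightarrow> real) \<Rightarrow> ('k \<Rightarrow> 'l) \<Rightarrow> bool" where
  "valued_extension \<nu>K \<nu>L \<iota> \<longleftrightarrow>
     \<iota> 1 = 1 \<and> (\<forall>a b. \<iota> (a + b) = \<iota> a + \<iota> b) \<and> (\<forall>a b. \<iota> (a * b) = \<iota> a * \<iota> b) \<and>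
     (\<forall>a. a \<noteq> 0 \<longrightarrow> \<nu>L (\<iota> a) = \<nu>K a)"

text \<open>The field \<open>'r\<close> is the residue field via \<open>res\<close>: on the valuation ring, \<open>res\<close> is a
  surjective ring homomorphism whose kernel is the maximal ideal. Its values outside the
  valuation ring are arbitrary.\<close>

definition residue_map :: "('l::field \<Rightarrow> real) \<Rightarrow> ('l \<Rightarrow> 'r::field) \<Rightarrow> bool" where
  "residue_map \<nu> res \<longleftrightarrow>
     res 1 = 1 \<and>
     (\<forall>a b. absv \<nu> a \<le> 1 \<longrightarrow> absv \<nu> b \<le> 1 \<longrightarrow>
        res (a + b) = res a + res b \<and> res (a * b) = res a * res b) \<and>
     (\<forall>a. absv \<nu> a \<le> 1 \<longrightarrow> (res a = 0 \<longleftrightarrow> absv \<nu> a < 1)) \<and>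
     (\<forall>c. \<exists>a. absv \<nu> a \<le> 1 \<and> res a = c)"


section \<open>Polynomial and Laurent polynomial rings\<close>

text \<open>The ring of (Laurent) polynomials in the variables \<open>V\<close>: finitely supported functions
  on exponent vectors. With exponents in \<^typ>\<open>nat\<close> this is the polynomial ring, with
  exponents in \<^typ>\<open>int\<close> the Laurent polynomial ring.\<close>

definition mon_ring ::
  "'v set \<Rightarrow> (('v \<Rightarrow>\<^sub>0 'e::comm_monoid_add) \<Rightarrow>\<^sub>0 'a::comm_ring_1) ring" where
  "mon_ring V =
     \<lparr>carrier = {f. \<forall>\<alpha>\<in>Poly_Mapping.keys f. Poly_Mapping.keys \<alpha> \<subseteq> V},
      mult = (*), one = 1, zero = 0, add = (+)\<rparr>"

definition cst :: "'a \<Rightarrow> (('v \<Rightarrow>\<^sub>0 'e::comm_monoid_add) \<Rightarrow>\<^sub>0 'a::comm_ring_1)" where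
  "cst c = Poly_Mapping.single 0 c"

definition var :: "'v \<Rightarrow> (('v \<Rightarrow>\<^sub>0 'e::comm_semiring_1) \<Rightarrow>\<^sub>0 'a::comm_ring_1)" where
  "var v = Poly_Mapping.single (Poly_Mapping.single v 1) 1"

definition subst ::
  "('a \<Rightarrow> 'b) \<Rightarrow> ('v \<Rightarrow> 'b) \<Rightarrow> (('v \<Rightarrow>\<^sub>0 nat) \<Rightarrow>\<^sub>0 'a::comm_ring_1) \<Rightarrow> 'b::comm_ring_1" where
  "subst h s f =
     (\<Sum>\<alpha>\<in>Poly_Mapping.keys f. h (Poly_Mapping.lookup f \<alpha>) *
        (\<Prod>v\<in>Poly_Mapping.keys \<alpha>. s v ^ Poly_Mapping.lookup \<alpha> v))"

definition radical :: "('a, 'b) ring_scheme \<Rightarrow> 'a set \<Rightarrow> 'a set" where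
  "radical R I = {a \<in> carrier R. \<exists>m::nat. a [^]\<^bsub>R\<^esub> m \<in> I}"


section \<open>The Grassmannian of lines and its Berkovich analytification\<close>

text \<open>An unordered pair \<open>kl\<close> is the set \<open>{k, l}\<close>; the variable \<open>p\<^sub>k\<^sub>l\<close> of a pair
  is the one with \<open>k < l\<close>.\<close>

definition pairs :: "nat \<Rightarrow> nat set set" where
  "pairs n = nsets {1..n} 2"

definition minor :: "nat set \<Rightarrow> ((nat \<times> nat \<Rightarrow>\<^sub>0 nat) \<Rightarrow>\<^sub>0 'k::field)" where
  "minor e = var (1, Min e) * var (2, Max e) - var (1, Max e) * var (2, Min e)"

text \<open>The homogeneous ideal of the Grassmannian in its Pluecker embedding: all polynomial
  relations between the maximal minors of the generic 2 by n matrix.\<close>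

definition plucker_ideal :: "nat \<Rightarrow> ((nat set \<Rightarrow>\<^sub>0 nat) \<Rightarrow>\<^sub>0 'k::field) set" where
  "plucker_ideal n = {f \<in> carrier (mon_ring (pairs n)). subst cst minor f = 0}"

text \<open>\<open>affine_coord ij J kl\<close> is \<open>p\<^sub>k\<^sub>l / p\<^sub>i\<^sub>j\<close> restricted to the locus where
  the coordinates in \<open>J\<close> vanish.\<close>

definition affine_coord ::
  "nat set \<Rightarrow> nat set set \<Rightarrow> nat set \<Rightarrow> ((nat set \<Rightarrow>\<^sub>0 'e::comm_semiring_1) \<Rightarrow>\<^sub>0 'k::field)" where
  "affine_coord ij J kl = (if kl \<in> J then 0 else if kl = ij then 1 else var kl)"

definition chart_poly_ring ::
  "nat \<Rightarrow> nat set \<Rightarrow> ((nat set \<Rightarrow>\<^sub>0 nat) \<Rightarrow>\<^sub>0 'k::field) ring" where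
  "chart_poly_ring n ij = mon_ring (pairs n - {ij})"

definition chart_ideal ::
  "nat \<Rightarrow> nat set \<Rightarrow> ((nat set \<Rightarrow>\<^sub>0 nat) \<Rightarrow>\<^sub>0 'k::field) set" where
  "chart_ideal n ij =
     Idl\<^bsub>chart_poly_ring n ij\<^esub> (subst cst (affine_coord ij {}) ` plucker_ideal n)"

text \<open>The coordinate ring of the affine open subset \<open>{p\<^sub>i\<^sub>j \<noteq> 0}\<close> of Gr(2,n).\<close>

definition chart_ring ::
  "nat \<Rightarrow> nat set \<Rightarrow> ((nat set \<Rightarrow>\<^sub>0 nat) \<Rightarrow>\<^sub>0 'k::field) set ring" where
  "chart_ring n ij = chart_poly_ring n ij Quot chart_ideal n ij"

definition chart_proj ::
  "nat \<Rightarrow> nat set \<Rightarrow> ((nat set \<Rightarrow>\<^sub>0 nat) \<Rightarrow>\<^sub>0 'k::field) \<Rightarrow> ((nat set \<Rightarrow>\<^sub>0 nat) \<Rightarrow>\<^sub>0 'k) set" where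
  "chart_proj n ij f = chart_ideal n ij +>\<^bsub>chart_poly_ring n ij\<^esub> f"

text \<open>The Berkovich analytification of \<open>Spec R\<close>, where \<open>s\<close> is the structure map of the
  algebra \<open>R\<close>: multiplicative seminorms on \<open>R\<close> that extend the absolute value of the base
  field.\<close>

definition berkovich ::
  "('k::field \<Rightarrow> real) \<Rightarrow> ('k \<Rightarrow> 'a) \<Rightarrow> ('a, 'b) ring_scheme \<Rightarrow> ('a \<Rightarrow> real) set" where
  "berkovich \<nu> s R = {\<gamma> \<in> carrier R \<rightarrow>\<^sub>E {0..}.
     (\<forall>f\<in>carrier R. \<forall>g\<in>carrier R. \<gamma> (f \<otimes>\<^bsub>R\<^esub> g) = \<gamma> f * \<gamma> g) \<and>
     (\<forall>f\<in>carrier R. \<forall>g\<in>carrier R. \<gamma> (f \<oplus>\<^bsub>R\<^esub> g) \<le> \<gamma> f + \<gamma> g) \<and>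
     (\<forall>c. \<gamma> (s c) = absv \<nu> c)}"

definition chart_an ::
  "('k::field \<Rightarrow> real) \<Rightarrow> nat \<Rightarrow> nat set \<Rightarrow> (((nat set \<Rightarrow>\<^sub>0 nat) \<Rightarrow>\<^sub>0 'k) set \<Rightarrow> real) set" where
  "chart_an \<nu> n ij = berkovich \<nu> (\<lambda>c. chart_proj n ij (cst c)) (chart_ring n ij)"

definition elog :: "real \<Rightarrow> ereal" where
  "elog r = (if r = 0 then -\<infinity> else ereal (ln r))"

text \<open>The value of the tropicalization map at a point of the chart \<open>{p\<^sub>i\<^sub>j \<noteq> 0}\<close>. A point of
  tropical projective space is a class of vectors modulo adding real multiples of
  (1,...,1), represented as the set of all its representatives.\<close>

definition trop ::
  "nat \<Rightarrow> nat set \<Rightarrow> (((nat set \<Rightarrow>\<^sub>0 nat) \<Rightarrow>\<^sub>0 'k::field) set \<Rightarrow> real) \<Rightarrow> (nat set \<Rightarrow> ereal) set" where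
  "trop n ij \<gamma> = {x \<in> pairs n \<rightarrow>\<^sub>E (UNIV - {\<infinity>}). x ij \<noteq> -\<infinity> \<and>
     (\<forall>kl\<in>pairs n. x kl - x ij = elog (\<gamma> (chart_proj n ij (affine_coord ij {} kl))))}"

text \<open>Gr(2,n) is covered by the charts, hence so is its analytification, and the image of the
  tropicalization map is the union of the images of the charts.\<close>

definition TGr :: "('k::field \<Rightarrow> real) \<Rightarrow> nat \<Rightarrow> (nat set \<Rightarrow> ereal) set set" where
  "TGr \<nu> n = (\<Union>ij\<in>pairs n. trop n ij ` chart_an \<nu> n ij)"

definition vanishing :: "nat \<Rightarrow> (nat set \<Rightarrow> ereal) \<Rightarrow> nat set set" where
  "vanishing n x = {kl \<in> pairs n. x kl = -\<infinity>}"

text \<open>The ideal of \<open>Gr\<^sub>J(2,n)\<close> in the Laurent polynomial ring in the \<open>u\<^sub>k\<^sub>l\<close>; the radical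
  expresses the reduced scheme structure.\<close>

definition torus_indices :: "nat \<Rightarrow> nat set \<Rightarrow> nat set set \<Rightarrow> nat set set" where
  "torus_indices n ij J = pairs n - (J \<union> {ij})"

definition GrJ_ideal ::
  "nat \<Rightarrow> nat set \<Rightarrow> nat set set \<Rightarrow> ((nat set \<Rightarrow>\<^sub>0 int) \<Rightarrow>\<^sub>0 'k::field) set" where
  "GrJ_ideal n ij J =
     (let R = mon_ring (torus_indices n ij J)
      in radical R (Idl\<^bsub>R\<^esub> (subst cst (affine_coord ij J) ` plucker_ideal n)))"


section \<open>Initial degenerations\<close>

text \<open>Since Laurent polynomial rings are free over the base field, the extension of scalars of
  an ideal is the ideal generated by it over the larger field.\<close>

definition extend_ideal ::
  "('k::field \<Rightarrow> 'l::field) \<Rightarrow> 'v set \<Rightarrow> (('v \<Rightarrow>\<^sub>0 int) \<Rightarrow>\<^sub>0 'k) set \<Rightarrow> (('v \<Rightarrow>\<^sub>0 int) \<Rightarrow>\<^sub>0 'l) set" where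
  "extend_ideal \<iota> V I = Idl\<^bsub>mon_ring V\<^esub> (Poly_Mapping.map \<iota> ` I)"

definition weight ::
  "('l::field \<Rightarrow> real) \<Rightarrow> ('v \<Rightarrow> real) \<Rightarrow> (('v \<Rightarrow>\<^sub>0 int) \<Rightarrow>\<^sub>0 'l) \<Rightarrow> real" where
  "weight \<nu> y f = Max ((\<lambda>\<alpha>. - \<nu> (Poly_Mapping.lookup f \<alpha>) +
     (\<Sum>v\<in>Poly_Mapping.keys \<alpha>. of_int (Poly_Mapping.lookup \<alpha> v) * y v)) ` Poly_Mapping.keys f)"

definition initial_form ::
  "('l::field \<Rightarrow> 'r::field) \<Rightarrow> ('v \<Rightarrow> 'l) \<Rightarrow> 'l \<Rightarrow> (('v \<Rightarrow>\<^sub>0 int) \<Rightarrow>\<^sub>0 'l) \<Rightarrow> (('v \<Rightarrow>\<^sub>0 int) \<Rightarrow>\<^sub>0 'r)" where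
  "initial_form res \<tau> c f = (\<Sum>\<alpha>\<in>Poly_Mapping.keys f. Poly_Mapping.single \<alpha>
     (res (c * Poly_Mapping.lookup f \<alpha> *
        (\<Prod>v\<in>Poly_Mapping.keys \<alpha>. \<tau> v powi Poly_Mapping.lookup \<alpha> v))))"

text \<open>The scalar \<open>c\<close> is only determined up to units of the valuation ring; all its admissible
  values are used, which does not affect the generated ideal.\<close>

definition initial_ideal ::
  "('l::field \<Rightarrow> real) \<Rightarrow> ('l \<Rightarrow> 'r::field) \<Rightarrow> 'v set \<Rightarrow> ('v \<Rightarrow> real) \<Rightarrow> ('v \<Rightarrow> 'l) \<Rightarrow>
   (('v \<Rightarrow>\<^sub>0 int) \<Rightarrow>\<^sub>0 'l) set \<Rightarrow> (('v \<Rightarrow>\<^sub>0 int) \<Rightarrow>\<^sub>0 'r) set" where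
  "initial_ideal \<nu> res V y \<tau> I =
     Idl\<^bsub>mon_ring V\<^esub> {initial_form res \<tau> c f | c f. f \<in> I \<and> f \<noteq> 0 \<and> c \<noteq> 0 \<and> \<nu> c = weight \<nu> y f}"

definition initial_degeneration ::
  "('l::field \<Rightarrow> real) \<Rightarrow> ('l \<Rightarrow> 'r::field) \<Rightarrow> 'v set \<Rightarrow> ('v \<Rightarrow> real) \<Rightarrow> ('v \<Rightarrow> 'l) \<Rightarrow>
   (('v \<Rightarrow>\<^sub>0 int) \<Rightarrow>\<^sub>0 'l) set \<Rightarrow> (('v \<Rightarrow>\<^sub>0 int) \<Rightarrow>\<^sub>0 'r) set ring" where
  "initial_degeneration \<nu> res V y \<tau> I = mon_ring V Quot initial_ideal \<nu> res V y \<tau> I"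


section \<open>Irreducible components of an affine scheme and their multiplicities\<close>

definition Spec :: "('a, 'b) ring_scheme \<Rightarrow> 'a set set" where
  "Spec R = {P. primeideal P R}"

definition zariski_closed :: "('a, 'b) ring_scheme \<Rightarrow> 'a set set \<Rightarrow> bool" where
  "zariski_closed R Z \<longleftrightarrow> (\<exists>S\<subseteq>carrier R. Z = {P \<in> Spec R. S \<subseteq> P})"

definition irreducible_closed :: "('a, 'b) ring_scheme \<Rightarrow> 'a set set \<Rightarrow> bool" where
  "irreducible_closed R Z \<longleftrightarrow> zariski_closed R Z \<and> Z \<noteq> {} \<and>
     (\<forall>Z1 Z2. zariski_closed R Z1 \<and> zariski_closed R Z2 \<and> Z \<subseteq> Z1 \<union> Z2 \<longrightarrow> Z \<subseteq> Z1 \<or> Z \<subseteq> Z2)"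

definition irreducible_components :: "('a, 'b) ring_scheme \<Rightarrow> 'a set set set" where
  "irreducible_components R =
     {Z. irreducible_closed R Z \<and> (\<forall>Z'. irreducible_closed R Z' \<and> Z \<subseteq> Z' \<longrightarrow> Z' = Z)}"

definition generic_point :: "('a, 'b) ring_scheme \<Rightarrow> 'a set set \<Rightarrow> 'a set" where
  "generic_point R Z = (THE P. P \<in> Spec R \<and> Z = \<Inter>{C. zariski_closed R C \<and> P \<in> C})"

text \<open>The localization of \<open>R\<close> at the prime ideal \<open>P\<close>; the pair \<open>(a, s)\<close> represents \<open>a / s\<close>.\<close>

definition frac_rel :: "('a, 'b) ring_scheme \<Rightarrow> 'a set \<Rightarrow> (('a \<times> 'a) \<times> ('a \<times> 'a)) set" where
  "frac_rel R P = {((a, s), (b, t)). a \<in> carrier R \<and> b \<in> carrier R \<and>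
     s \<in> carrier R - P \<and> t \<in> carrier R - P \<and>
     (\<exists>w\<in>carrier R - P. w \<otimes>\<^bsub>R\<^esub> (a \<otimes>\<^bsub>R\<^esub> t) = w \<otimes>\<^bsub>R\<^esub> (b \<otimes>\<^bsub>R\<^esub> s))}"

definition localization :: "('a, 'b) ring_scheme \<Rightarrow> 'a set \<Rightarrow> ('a \<times> 'a) set ring" where
  "localization R P =
     \<lparr>carrier = (carrier R \<times> (carrier R - P)) // frac_rel R P,
      mult = (\<lambda>X Y. \<Union>(a, s)\<in>X. \<Union>(b, t)\<in>Y. frac_rel R P `` {(a \<otimes>\<^bsub>R\<^esub> b, s \<otimes>\<^bsub>R\<^esub> t)}),
      one = frac_rel R P `` {(\<one>\<^bsub>R\<^esub>, \<one>\<^bsub>R\<^esub>)},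
      zero = frac_rel R P `` {(\<zero>\<^bsub>R\<^esub>, \<one>\<^bsub>R\<^esub>)},
      add = (\<lambda>X Y. \<Union>(a, s)\<in>X. \<Union>(b, t)\<in>Y.
        frac_rel R P `` {(a \<otimes>\<^bsub>R\<^esub> t \<oplus>\<^bsub>R\<^esub> b \<otimes>\<^bsub>R\<^esub> s, s \<otimes>\<^bsub>R\<^esub> t)})\<rparr>"

text \<open>The length of a commutative ring as a module over itself: the supremum of the lengths of
  chains of ideals.\<close>

definition ring_length :: "('a, 'b) ring_scheme \<Rightarrow> enat" where
  "ring_length R = (SUP k\<in>{k. \<exists>I::nat \<Rightarrow> 'a set.
     (\<forall>i\<le>k. ideal (I i) R) \<and> (\<forall>i<k. I i \<subset> I (Suc i))}. enat k)"

text \<open>The sum over the components is finite for Noetherian rings. (For infinitely many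
  components the sum below would be 0.)\<close>

definition components_with_multiplicity :: "('a, 'b) ring_scheme \<Rightarrow> enat" where
  "components_with_multiplicity R =
     (\<Sum>Z\<in>irreducible_components R. ring_length (localization R (generic_point R Z)))"

definition tropical_multiplicity ::
  "('l::field \<Rightarrow> real) \<Rightarrow> ('l \<Rightarrow> 'r::field) \<Rightarrow> 'v set \<Rightarrow> ('v \<Rightarrow> real) \<Rightarrow> ('v \<Rightarrow> 'l) \<Rightarrow>
   (('v \<Rightarrow>\<^sub>0 int) \<Rightarrow>\<^sub>0 'l) set \<Rightarrow> enat" where
  "tropical_multiplicity \<nu> res V y \<tau> I =
     components_with_multiplicity (initial_degeneration \<nu> res V y \<tau> I)"

end

theory Submission
  imports Defs
begin

text \<open>
  A domain has one irreducible component, of multiplicity one, so it is enough to show that the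
  initial ideal \<open>Q\<close> is prime. Normalise the column \<open>j\<close> of the generic 2 by n matrix to
  \<open>(0, 1)\<close>; each column \<open>k\<close> with \<open>p\<^sub>k\<^sub>j \<noteq> 0\<close> then is \<open>(a\<^sub>k, a\<^sub>k t\<^sub>k)\<close>, and
  \<open>p\<^sub>k\<^sub>l = a\<^sub>k a\<^sub>l (t\<^sub>l - t\<^sub>k)\<close>. By the tropical Pluecker relations the prescribed values of
  \<open>|t\<^sub>k - t\<^sub>l|\<close> satisfy the ultrametric inequality. Add the points \<open>t\<^sub>m\<close> one after the other, starting with
  \<open>t\<^sub>i = 0\<close>, and write \<open>t\<^sub>m = t\<^sub>s + z\<^sub>m\<close> with a free parameter \<open>z\<^sub>m\<close>, where \<open>t\<^sub>s\<close> is a nearest earlier point.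
  Since \<open>s\<close> is nearest, the left hand side of
  \<open>p\<^sub>m\<^sub>l p\<^sub>s\<^sub>j = p\<^sub>m\<^sub>j p\<^sub>s\<^sub>l + p\<^sub>m\<^sub>s p\<^sub>l\<^sub>j\<close> has the maximal absolute value, so its initial form
  expresses \<open>u\<^sub>m\<^sub>l\<close> modulo \<open>Q\<close> as a Laurent polynomial in the free coordinates.
  Hence every element is, up to a monomial, congruent modulo \<open>Q\<close> to a Laurent polynomial \<open>h\<close>
  in the free coordinates. On the other hand \<open>Q\<close> vanishes at the reductions of all \<open>L\<close>-points with
  the prescribed absolute values, and for any given \<open>h \<noteq> 0\<close> the free parameters can be chosen,
  one after the other and avoiding finitely many residue classes each time, such that \<open>h\<close> does
  not vanish there. So \<open>h \<in> Q\<close> only for \<open>h = 0\<close>, and \<open>Q\<close> is prime.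
\<close>

section \<open>Multiplicity of a domain\<close>

text \<open>Primality needs two opposite estimates of the initial ideal, and neither uses a Groebner
  basis. Three-term Pluecker relations put enough elements into it; points of the variety show that
  it contains no nonzero Laurent polynomial in the free coordinates. The radical and the extension
  of scalars are controlled by evaluation as well: a point over a field that kills the Pluecker
  relations also kills the radical of the ideal they generate and its scalar extension. The obstacle
  is that a relation eliminates a coordinate only if that coordinate sits in a dominant term. With a
  badly chosen tree of differences the wanted term is smaller than the other two, and its initial
  form is lost; nearest neighbours rule this out, also in case of ties. Vanishing coordinates
  produce two degenerate situations: points that coincide with an earlier one and contribute no
  parameter, and columns that are zero or proportional to column \<open>j\<close>. Genericity takes
  place in the residue field, which therefore has to be infinite; this is where the algebraic
  closedness of L enters.\<close>

context domain
begin

section \<open>The fraction field of a domain, as its localization at the zero ideal\<close>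

abbreviation nz where "nz \<equiv> carrier R - {\<zero>}"
abbreviation fr where "fr a s \<equiv> frac_rel R {\<zero>} `` {(a, s)}"

lemma fr_mem_iff:
  assumes "a \<in> carrier R" "s \<in> nz"
  shows "(b, t) \<in> fr a s \<longleftrightarrow> b \<in> carrier R \<and> t \<in> nz \<and> a \<otimes> t = b \<otimes> s"
proof -
  have "\<exists>w\<in>nz. w \<otimes> (a \<otimes> t) = w \<otimes> (b \<otimes> s)" if "a \<otimes> t = b \<otimes> s"
    using that one_closed one_not_zero by (intro bexI[of _ \<one>]) auto
  moreover have "a \<otimes> t = b \<otimes> s" if "w \<in> nz" "w \<otimes> (a \<otimes> t) = w \<otimes> (b \<otimes> s)" "b \<in> carrier R" "t \<in> nz" for w
    using that assms m_lcancel[of w "a \<otimes> t" "b \<otimes> s"] by auto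
  ultimately show ?thesis
    using assms by (auto simp: frac_rel_def)
qed

lemma fr_eq_iff:
  assumes "a \<in> carrier R" "s \<in> nz" "b \<in> carrier R" "t \<in> nz"
  shows "fr a s = fr b t \<longleftrightarrow> a \<otimes> t = b \<otimes> s"
proof
  assume "fr a s = fr b t"
  moreover have "(b, t) \<in> fr b t" by (rule iffD2[OF fr_mem_iff]) (use assms in auto)
  ultimately have "(b, t) \<in> fr a s" by simp
  then show "a \<otimes> t = b \<otimes> s" by (simp only: fr_mem_iff[OF assms(1,2)])
next
  \<comment> \<open>Transitivity of equality of fractions: multiply by the middle denominator
    \<open>u\<close>, rearrange, and cancel it.\<close>
  have aux: "c \<otimes> t' = d \<otimes> r"
    if "c \<in> carrier R" "c' \<in> carrier R" "d \<in> carrier R" "r \<in> nz" "t' \<in> nz" "u \<in> nz"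
      "c \<otimes> u = c' \<otimes> r" "c' \<otimes> t' = d \<otimes> u" for c c' d r t' u
  proof -
    have "u \<otimes> (c \<otimes> t') = (c \<otimes> u) \<otimes> t'" using that(1-6) by (auto simp: m_ac)
    also have "\<dots> = (c' \<otimes> r) \<otimes> t'" using that by simp
    also have "\<dots> = (c' \<otimes> t') \<otimes> r" using that(1-6) by (auto simp: m_ac)
    also have "\<dots> = (d \<otimes> u) \<otimes> r" using that by simp
    also have "\<dots> = u \<otimes> (d \<otimes> r)" using that(1-6) by (auto simp: m_ac)
    finally show ?thesis using that m_lcancel[of u "c \<otimes> t'" "d \<otimes> r"] by auto
  qed
  assume e: "a \<otimes> t = b \<otimes> s"
  have "x \<in> fr a s \<longleftrightarrow> x \<in> fr b t" for x
  proof (cases x)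
    case (Pair c r)
    show ?thesis unfolding Pair fr_mem_iff[OF assms(1,2)] fr_mem_iff[OF assms(3,4)]
    proof safe
      assume h: "c \<in> carrier R" "r \<in> carrier R" "r \<noteq> \<zero>" "a \<otimes> r = c \<otimes> s"
      show "b \<otimes> r = c \<otimes> t" by (rule aux[of b a c t r s]) (use h e assms in auto)
    next
      assume h: "c \<in> carrier R" "r \<in> carrier R" "r \<noteq> \<zero>" "b \<otimes> r = c \<otimes> t"
      show "a \<otimes> r = c \<otimes> s" by (rule aux[of a b c s r t]) (use h e assms in auto)
    qed
  qed
  then show "fr a s = fr b t" by blast
qed

lemma fr_refl: "a \<in> carrier R \<Longrightarrow> s \<in> nz \<Longrightarrow> (a, s) \<in> fr a s"
  by (rule iffD2[OF fr_mem_iff]) auto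

lemma carrier_localization: "carrier (localization R {\<zero>}) = {fr a s | a s. a \<in> carrier R \<and> s \<in> nz}"
  unfolding localization_def quotient_def by auto

lemma nz_mult: "s \<in> nz \<Longrightarrow> t \<in> nz \<Longrightarrow> s \<otimes> t \<in> nz"
  using integral_iff by auto

text \<open>Well-definedness of operations on fractions: if the result does not depend on the
  representatives, all sets in the union coincide, and the union is nonempty because a class
  contains its own representative.\<close>

lemma UN_fr_eq:
  assumes "a \<in> carrier R" "s \<in> nz" "b \<in> carrier R" "t \<in> nz"
    and "\<And>a' s' b' t'. (a', s') \<in> fr a s \<Longrightarrow> (b', t') \<in> fr b t \<Longrightarrow> F a' s' b' t' = F a s b t"
  shows "(\<Union>(a, s)\<in>fr a s. \<Union>(b, t)\<in>fr b t. F a s b t) = F a s b t"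
proof -
  have "(\<Union>(a', s')\<in>fr a s. \<Union>(b', t')\<in>fr b t. F a' s' b' t') = (\<Union>p\<in>fr a s. \<Union>q\<in>fr b t. F a s b t)"
    using assms(5) by fastforce
  also have "\<dots> = F a s b t" using fr_refl assms by blast
  finally show ?thesis .
qed

lemma fr_mult:
  assumes "a \<in> carrier R" "s \<in> nz" "b \<in> carrier R" "t \<in> nz"
  shows "fr a s \<otimes>\<^bsub>localization R {\<zero>}\<^esub> fr b t = fr (a \<otimes> b) (s \<otimes> t)"
  unfolding localization_def monoid.simps
proof (rule UN_fr_eq[where F = "\<lambda>a s b t. fr (a \<otimes> b) (s \<otimes> t)", OF assms])
  fix a' s' b' t' assume "(a', s') \<in> fr a s" "(b', t') \<in> fr b t"
  then have h: "a' \<in> carrier R" "s' \<in> nz" "a \<otimes> s' = a' \<otimes> s" "b' \<in> carrier R" "t' \<in> nz" "b \<otimes> t' = b' \<otimes> t"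
    by (simp_all only: fr_mem_iff assms simp_thms)
  have "a' \<otimes> b' \<otimes> (s \<otimes> t) = (a' \<otimes> s) \<otimes> (b' \<otimes> t)" using h(1,2,4,5) assms by (auto simp: m_ac)
  also have "\<dots> = (a \<otimes> s') \<otimes> (b \<otimes> t')" using h by simp
  also have "\<dots> = a \<otimes> b \<otimes> (s' \<otimes> t')" using h(1,2,4,5) assms by (auto simp: m_ac)
  finally show "fr (a' \<otimes> b') (s' \<otimes> t') = fr (a \<otimes> b) (s \<otimes> t)"
    using h assms by (subst fr_eq_iff) (auto intro: nz_mult simp: integral_iff)
qed

lemma fr_add:
  assumes "a \<in> carrier R" "s \<in> nz" "b \<in> carrier R" "t \<in> nz"
  shows "fr a s \<oplus>\<^bsub>localization R {\<zero>}\<^esub> fr b t = fr (a \<otimes> t \<oplus> b \<otimes> s) (s \<otimes> t)"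
  unfolding localization_def ring.simps
proof (rule UN_fr_eq[where F = "\<lambda>a s b t. fr (a \<otimes> t \<oplus> b \<otimes> s) (s \<otimes> t)", OF assms])
  fix a' s' b' t' assume "(a', s') \<in> fr a s" "(b', t') \<in> fr b t"
  then have h: "a' \<in> carrier R" "s' \<in> nz" "a \<otimes> s' = a' \<otimes> s" "b' \<in> carrier R" "t' \<in> nz" "b \<otimes> t' = b' \<otimes> t"
    by (simp_all only: fr_mem_iff assms simp_thms)
  have "(a' \<otimes> t' \<oplus> b' \<otimes> s') \<otimes> (s \<otimes> t) = (a' \<otimes> s) \<otimes> (t' \<otimes> t) \<oplus> (b' \<otimes> t) \<otimes> (s' \<otimes> s)"
    using h(1,2,4,5) assms by (simp add: l_distr r_distr m_ac)
  also have "\<dots> = (a \<otimes> s') \<otimes> (t' \<otimes> t) \<oplus> (b \<otimes> t') \<otimes> (s' \<otimes> s)" using h by simp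
  also have "\<dots> = (a \<otimes> t \<oplus> b \<otimes> s) \<otimes> (s' \<otimes> t')" using h(1,2,4,5) assms by (simp add: l_distr r_distr m_ac)
  finally show "fr (a' \<otimes> t' \<oplus> b' \<otimes> s') (s' \<otimes> t') = fr (a \<otimes> t \<oplus> b \<otimes> s) (s \<otimes> t)"
    using h assms by (subst fr_eq_iff) (auto simp: integral_iff)
qed

lemma one_localization: "\<one>\<^bsub>localization R {\<zero>}\<^esub> = fr \<one> \<one>"
  by (simp add: localization_def)

lemma zero_localization: "\<zero>\<^bsub>localization R {\<zero>}\<^esub> = fr \<zero> \<one>"
  by (simp add: localization_def)

text \<open>For a domain the local ring at the generic point is the fraction field; this is what
  makes the multiplicity equal to one.\<close>

lemma field_localization: "field (localization R {\<zero>})"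
proof (rule cring.cring_fieldI2)
  note d = carrier_localization one_localization zero_localization
  \<comment> \<open>These rules turn each axiom into a cross-multiplied identity in
    \<open>R\<close>; \<open>integral_iff\<close> shows that products of denominators are
    nonzero.\<close>
  note simps = fr_mult fr_add fr_eq_iff one_not_zero integral_iff
  show "cring (localization R {\<zero>})"
  proof (rule cringI)
    show "abelian_group (localization R {\<zero>})"
    proof (rule abelian_groupI)
      fix x assume "x \<in> carrier (localization R {\<zero>})"
      then obtain a s where x: "x = fr a s" "a \<in> carrier R" "s \<in> carrier R" "s \<noteq> \<zero>" by (auto simp: d)
      show "\<exists>y\<in>carrier (localization R {\<zero>}). y \<oplus>\<^bsub>localization R {\<zero>}\<^esub> x = \<zero>\<^bsub>localization R {\<zero>}\<^esub>"
        using x by (intro bexI[of _ "fr (\<ominus> a) s"]) (auto simp: d simps l_minus l_neg)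
      show "\<zero>\<^bsub>localization R {\<zero>}\<^esub> \<oplus>\<^bsub>localization R {\<zero>}\<^esub> x = x"
        using x by (simp add: d simps)
      fix y assume "y \<in> carrier (localization R {\<zero>})"
      then obtain b t where y: "y = fr b t" "b \<in> carrier R" "t \<in> carrier R" "t \<noteq> \<zero>" by (auto simp: d)
      show "x \<oplus>\<^bsub>localization R {\<zero>}\<^esub> y \<in> carrier (localization R {\<zero>})"
      proof -
        have "x \<oplus>\<^bsub>localization R {\<zero>}\<^esub> y = fr (a \<otimes> t \<oplus> b \<otimes> s) (s \<otimes> t)" using x y by (simp add: fr_add)
        then show ?thesis using x y unfolding d by (auto intro!: exI simp: integral_iff)
      qed
      show "x \<oplus>\<^bsub>localization R {\<zero>}\<^esub> y = y \<oplus>\<^bsub>localization R {\<zero>}\<^esub> x"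
        using x y by (simp add: simps) (simp add: a_ac m_ac)
      fix z assume "z \<in> carrier (localization R {\<zero>})"
      then obtain c u where z: "z = fr c u" "c \<in> carrier R" "u \<in> carrier R" "u \<noteq> \<zero>" by (auto simp: d)
      show "x \<oplus>\<^bsub>localization R {\<zero>}\<^esub> y \<oplus>\<^bsub>localization R {\<zero>}\<^esub> z =
          x \<oplus>\<^bsub>localization R {\<zero>}\<^esub> (y \<oplus>\<^bsub>localization R {\<zero>}\<^esub> z)"
        using x y z by (simp add: simps) (simp add: l_distr r_distr a_ac m_ac)
    qed (auto simp: d intro!: exI)
    show "comm_monoid (localization R {\<zero>})"
    proof (rule comm_monoidI)
      fix x assume "x \<in> carrier (localization R {\<zero>})"
      then obtain a s where x: "x = fr a s" "a \<in> carrier R" "s \<in> carrier R" "s \<noteq> \<zero>" by (auto simp: d)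
      show "\<one>\<^bsub>localization R {\<zero>}\<^esub> \<otimes>\<^bsub>localization R {\<zero>}\<^esub> x = x"
        using x by (simp add: d simps)
      fix y assume "y \<in> carrier (localization R {\<zero>})"
      then obtain b t where y: "y = fr b t" "b \<in> carrier R" "t \<in> carrier R" "t \<noteq> \<zero>" by (auto simp: d)
      show "x \<otimes>\<^bsub>localization R {\<zero>}\<^esub> y \<in> carrier (localization R {\<zero>})"
      proof -
        have "x \<otimes>\<^bsub>localization R {\<zero>}\<^esub> y = fr (a \<otimes> b) (s \<otimes> t)" using x y by (simp add: fr_mult)
        then show ?thesis using x y unfolding d by (auto intro!: exI simp: integral_iff)
      qed
      show "x \<otimes>\<^bsub>localization R {\<zero>}\<^esub> y = y \<otimes>\<^bsub>localization R {\<zero>}\<^esub> x"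
        using x y by (simp add: simps) (simp add: m_ac)
      fix z assume "z \<in> carrier (localization R {\<zero>})"
      then obtain c u where z: "z = fr c u" "c \<in> carrier R" "u \<in> carrier R" "u \<noteq> \<zero>" by (auto simp: d)
      show "x \<otimes>\<^bsub>localization R {\<zero>}\<^esub> y \<otimes>\<^bsub>localization R {\<zero>}\<^esub> z =
          x \<otimes>\<^bsub>localization R {\<zero>}\<^esub> (y \<otimes>\<^bsub>localization R {\<zero>}\<^esub> z)"
        using x y z by (simp add: simps) (simp add: m_ac)
    qed (auto simp: d intro!: exI)
    fix x y z assume "x \<in> carrier (localization R {\<zero>})" "y \<in> carrier (localization R {\<zero>})"
      "z \<in> carrier (localization R {\<zero>})"
    then obtain a s b t c u where "x = fr a s" "a \<in> carrier R" "s \<in> carrier R" "s \<noteq> \<zero>"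
       "y = fr b t" "b \<in> carrier R" "t \<in> carrier R" "t \<noteq> \<zero>"
       "z = fr c u" "c \<in> carrier R" "u \<in> carrier R" "u \<noteq> \<zero>" by (auto simp: d)
    then show "(x \<oplus>\<^bsub>localization R {\<zero>}\<^esub> y) \<otimes>\<^bsub>localization R {\<zero>}\<^esub> z =
      x \<otimes>\<^bsub>localization R {\<zero>}\<^esub> z \<oplus>\<^bsub>localization R {\<zero>}\<^esub> y \<otimes>\<^bsub>localization R {\<zero>}\<^esub> z"
      by (simp add: simps) (simp add: l_distr r_distr m_ac)
  qed
  show "\<zero>\<^bsub>localization R {\<zero>}\<^esub> \<noteq> \<one>\<^bsub>localization R {\<zero>}\<^esub>"
    by (simp add: d simps)
  fix x assume x: "x \<in> carrier (localization R {\<zero>})" "x \<noteq> \<zero>\<^bsub>localization R {\<zero>}\<^esub>"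
  then obtain a s where as: "x = fr a s" "a \<in> carrier R" "s \<in> carrier R" "s \<noteq> \<zero>" by (auto simp: d)
  then have "a \<noteq> \<zero>" using x by (auto simp: d simps)
  then show "\<exists>y\<in>carrier (localization R {\<zero>}). x \<otimes>\<^bsub>localization R {\<zero>}\<^esub> y = \<one>\<^bsub>localization R {\<zero>}\<^esub>"
    using as by (intro bexI[of _ "fr s a"]) (auto simp: d simps m_ac)
qed

end

text \<open>Length counts strict inclusions. Only two ideals exist, so two consecutive strict
  inclusions are impossible, while the step from zero to the whole field is one.\<close>

lemma (in field) ring_length_field: "ring_length R = 1"
proof -
  have k: "k \<le> 1" if "\<forall>i\<le>k. ideal (I i) R" "\<forall>i<k. I i \<subset> I (Suc i)" for k :: nat and I
  proof (rule ccontr)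
    assume "\<not> k \<le> 1"
    then have "I 0 \<subset> I 1" "I 1 \<subset> I 2" "ideal (I 0) R" "ideal (I 1) R" "ideal (I 2) R"
      using that by (auto simp: numeral_2_eq_2)
    moreover have "I i \<in> {{\<zero>}, carrier R}" if "ideal (I i) R" for i using all_ideals that by auto
    ultimately show False by (metis insertE psubset_eq singletonD subset_antisym)
  qed
  have "{\<zero>} \<subset> carrier R" using one_not_zero one_closed by blast
  then have "\<exists>I::nat \<Rightarrow> 'a set. (\<forall>i\<le>1. ideal (I i) R) \<and> (\<forall>i<1. I i \<subset> I (Suc i))"
    using zeroideal oneideal by (intro exI[of _ "\<lambda>i. if i = 0 then {\<zero>} else carrier R"]) auto
  then show ?thesis unfolding ring_length_def
    by (intro antisym SUP_least SUP_upper2[of 1]) (use k in \<open>auto simp: one_enat_def\<close>)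
qed

text \<open>Every prime ideal contains zero, so a closed set through the point
  \<open>{\<zero>}\<close> is the whole spectrum. Hence the spectrum is irreducible and is its own
  only component.\<close>

lemma (in domain) components_with_multiplicity_domain: "components_with_multiplicity R = 1"
proof -
  have z: "{\<zero>} \<in> Spec R" using zeroprimeideal by (simp add: Spec_def)
  have sp: "zariski_closed R (Spec R)" unfolding zariski_closed_def by (rule exI[of _ "{}"]) auto
  have zero_mem: "\<zero> \<in> P" if "P \<in> Spec R" for P
  proof -
    interpret primeideal P R using that by (simp add: Spec_def)
    show ?thesis by (rule additive_subgroup.zero_closed) (rule additive_subgroup_axioms)
  qed
  have eq: "Z = Spec R" if "zariski_closed R Z" "{\<zero>} \<in> Z" for Z
    using that zero_mem unfolding zariski_closed_def by blast
  have sub: "Z \<subseteq> Spec R" if "zariski_closed R Z" for Z using that unfolding zariski_closed_def by blast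
  have irr: "irreducible_closed R (Spec R)" unfolding irreducible_closed_def
    using sp z eq by blast
  have comps: "irreducible_components R = {Spec R}"
    unfolding irreducible_components_def using irr sub irreducible_closed_def by blast
  have "generic_point R (Spec R) = {\<zero>}" unfolding generic_point_def
  proof (rule the_equality)
    show "{\<zero>} \<in> Spec R \<and> Spec R = \<Inter> {C. zariski_closed R C \<and> {\<zero>} \<in> C}" using z eq sp by blast
    fix P assume P: "P \<in> Spec R \<and> Spec R = \<Inter> {C. zariski_closed R C \<and> P \<in> C}"
    then have "P \<subseteq> carrier R"
      using additive_subgroup.a_subset ideal.axioms(1) primeideal.axioms(1) Spec_def by fastforce
    \<comment> \<open>This closed set contains \<open>P\<close>, hence the whole spectrum and in
      particular \<open>{\<zero>}\<close>, which gives
      \<open>P \<subseteq> {\<zero>}\<close>.\<close>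
    then have "zariski_closed R {Q \<in> Spec R. P \<subseteq> Q}" unfolding zariski_closed_def by blast
    then have "Spec R \<subseteq> {Q \<in> Spec R. P \<subseteq> Q}" using P by blast
    then show "P = {\<zero>}" using z zero_mem P by blast
  qed
  then show ?thesis unfolding components_with_multiplicity_def comps
    using field.ring_length_field[OF field_localization] by simp
qed

section \<open>Evaluation of (Laurent) polynomials\<close>

lemma mon_ring_simps [simp]:
  "f \<otimes>\<^bsub>mon_ring V\<^esub> g = f * g" "f \<oplus>\<^bsub>mon_ring V\<^esub> g = f + g" "\<one>\<^bsub>mon_ring V\<^esub> = 1" "\<zero>\<^bsub>mon_ring V\<^esub> = 0"
  by (simp_all add: mon_ring_def)

lemma mon_ring_zero_closed: "0 \<in> carrier (mon_ring V)"
  by (simp add: mon_ring_def)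

lemma mon_ring_one_closed: "1 \<in> carrier (mon_ring V)"
  by (simp add: mon_ring_def)

lemma mon_ring_uminus_closed: "f \<in> carrier (mon_ring V) \<Longrightarrow> - f \<in> carrier (mon_ring V)"
  by (simp add: mon_ring_def in_keys_iff)

lemma mon_ring_add_closed:
  "f \<in> carrier (mon_ring V) \<Longrightarrow> g \<in> carrier (mon_ring V) \<Longrightarrow> f + g \<in> carrier (mon_ring V)"
  using keys_add[of f g] unfolding mon_ring_def by fastforce

lemma mon_ring_diff_closed:
  "f \<in> carrier (mon_ring V) \<Longrightarrow> g \<in> carrier (mon_ring V) \<Longrightarrow> f - g \<in> carrier (mon_ring V)"
  using mon_ring_add_closed[of f V "- g"] mon_ring_uminus_closed[of g V] by simp

lemma mon_ring_mult_closed: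
  assumes "f \<in> carrier (mon_ring V)" "g \<in> carrier (mon_ring V)"
  shows "f * g \<in> carrier (mon_ring V)"
proof -
  have "Poly_Mapping.keys \<alpha> \<subseteq> V" if \<alpha>: "\<alpha> \<in> Poly_Mapping.keys (f * g)" for \<alpha>
  proof -
    from \<alpha> keys_mult[of f g] obtain a b where
      ab: "a \<in> Poly_Mapping.keys f" "b \<in> Poly_Mapping.keys g" "\<alpha> = a + b" by blast
    then have "Poly_Mapping.keys a \<subseteq> V" "Poly_Mapping.keys b \<subseteq> V"
      using assms by (simp_all add: mon_ring_def)
    then show ?thesis using keys_add[of a b] ab(3) by blast
  qed
  then show ?thesis unfolding mon_ring_def by simp
qed

lemma cring_mon_ring: "cring (mon_ring V)"
proof (rule cringI)
  show "abelian_group (mon_ring V)"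
  proof (rule abelian_groupI)
    fix f assume "f \<in> carrier (mon_ring V)"
    then show "\<exists>g\<in>carrier (mon_ring V). g \<oplus>\<^bsub>mon_ring V\<^esub> f = \<zero>\<^bsub>mon_ring V\<^esub>"
      by (intro bexI[of _ "- f"] mon_ring_uminus_closed) simp_all
  qed (simp_all add: add_ac mon_ring_add_closed mon_ring_zero_closed)
  show "comm_monoid (mon_ring V)"
    by (rule comm_monoidI) (simp_all add: mult_ac mon_ring_mult_closed mon_ring_one_closed)
qed (simp add: algebra_simps)

lemma ring_mon_ring: "ring (mon_ring V)"
  using cring_mon_ring by (rule cring.axioms)

lemma mon_ring_a_inv:
  assumes "f \<in> carrier (mon_ring V)"
  shows "\<ominus>\<^bsub>mon_ring V\<^esub> f = - f"
proof -
  interpret ring "mon_ring V" by (rule ring_mon_ring)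
  have "- f \<in> carrier (mon_ring V)" using assms by (simp add: mon_ring_def in_keys_iff)
  then show ?thesis using assms minus_equality[of "- f" f] by simp
qed

lemma mon_ring_pow: "f [^]\<^bsub>mon_ring V\<^esub> (m::nat) = f ^ m"
  by (induction m) (simp_all add: nat_pow_def monoid.nat_pow_0 mult.commute)

lemma single_in_mon_ring: "Poly_Mapping.keys \<alpha> \<subseteq> V \<Longrightarrow> Poly_Mapping.single \<alpha> a \<in> carrier (mon_ring V)"
  by (simp add: mon_ring_def)

lemma cst_in_mon_ring: "cst a \<in> carrier (mon_ring V)"
  by (simp add: cst_def single_in_mon_ring)

lemma var_in_mon_ring: "v \<in> V \<Longrightarrow> var v \<in> carrier (mon_ring V)"
  by (simp add: var_def single_in_mon_ring)

lemma mon_ring_mono: "f \<in> carrier (mon_ring B) \<Longrightarrow> B \<subseteq> V \<Longrightarrow> f \<in> carrier (mon_ring V)"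
  by (auto simp: mon_ring_def)

lemma ideal_mon_ring_diff:
  assumes "ideal I (mon_ring V)" "f \<in> I" "g \<in> I"
  shows "f - g \<in> I"
proof -
  interpret ideal I "mon_ring V" by fact
  have "f \<oplus>\<^bsub>mon_ring V\<^esub> \<ominus>\<^bsub>mon_ring V\<^esub> g \<in> I"
    using assms(2,3) a_closed a_inv_closed by blast
  then show ?thesis using mon_ring_a_inv[OF Icarr[OF assms(3)]] by simp
qed

lemma ideal_mon_ringI:
  assumes "I \<subseteq> carrier (mon_ring V)" "0 \<in> I" "\<And>f g. f \<in> I \<Longrightarrow> g \<in> I \<Longrightarrow> f + g \<in> I"
    and "\<And>f g. f \<in> I \<Longrightarrow> g \<in> carrier (mon_ring V) \<Longrightarrow> g * f \<in> I"
  shows "ideal I (mon_ring V)"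
proof (rule idealI[OF ring_mon_ring])
  interpret ring "mon_ring V" by (rule ring_mon_ring)
  \<comment> \<open>Additive inverses come for free, as multiples by the ring element -1.\<close>
  have m: "- f \<in> I" if "f \<in> I" for f
    using assms(4)[OF that mon_ring_uminus_closed[OF mon_ring_one_closed]] by simp
  show "subgroup I (add_monoid (mon_ring V))"
  proof (rule group.subgroupI[OF a_group])
    show "\<And>a. a \<in> I \<Longrightarrow> inv\<^bsub>add_monoid (mon_ring V)\<^esub> a \<in> I"
      using m mon_ring_a_inv assms(1) by (metis a_inv_def subsetD)
  qed (use assms in auto)
qed (use assms in \<open>auto simp: mult.commute\<close>)

lemma poly_mapping_sum_single:
  "f = (\<Sum>\<alpha>\<in>Poly_Mapping.keys f. Poly_Mapping.single \<alpha> (Poly_Mapping.lookup f \<alpha>))"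
  by (rule poly_mapping_eqI) (auto simp: lookup_sum lookup_single when_def in_keys_iff)

lemma mon_ring_induct [consumes 1, case_names zero single add]:
  assumes "f \<in> carrier (mon_ring V)" "P 0"
    and "\<And>\<alpha> a. Poly_Mapping.keys \<alpha> \<subseteq> V \<Longrightarrow> P (Poly_Mapping.single \<alpha> a)"
    and "\<And>f g. f \<in> carrier (mon_ring V) \<Longrightarrow> g \<in> carrier (mon_ring V) \<Longrightarrow> P f \<Longrightarrow> P g \<Longrightarrow> P (f + g)"
  shows "P f"
proof -
  have "(\<Sum>\<alpha>\<in>A. Poly_Mapping.single \<alpha> (Poly_Mapping.lookup f \<alpha>)) \<in> carrier (mon_ring V) \<and>
      P (\<Sum>\<alpha>\<in>A. Poly_Mapping.single \<alpha> (Poly_Mapping.lookup f \<alpha>))"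
    if "A \<subseteq> Poly_Mapping.keys f" for A
    using finite_subset[OF that finite_keys] that
  proof (induction A rule: finite_induct)
    case empty
    then show ?case by (simp add: assms mon_ring_zero_closed)
  next
    case (insert \<alpha> A)
    then have "Poly_Mapping.keys \<alpha> \<subseteq> V" using assms(1) by (auto simp: mon_ring_def)
    then show ?case using insert by (simp add: assms single_in_mon_ring mon_ring_add_closed)
  qed
  from this[of "Poly_Mapping.keys f"] show ?thesis unfolding poly_mapping_sum_single[of f, symmetric] by simp
qed

lemma in_mon_ring_UNIV: "f \<in> carrier (mon_ring UNIV)"
  by (simp add: mon_ring_def)

lemmas poly_mapping_single_induct = mon_ring_induct[OF in_mon_ring_UNIV, case_names zero single add]

text \<open>Homomorphisms between whole types, without carriers: evaluations, substitutions and
  coefficient changes are all defined on every polynomial, so their algebra reduces to unconditional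
  rewriting.\<close>

definition ring_map :: "('a::comm_ring_1 \<Rightarrow> 'b::comm_ring_1) \<Rightarrow> bool" where
  "ring_map h \<longleftrightarrow> h 1 = 1 \<and> (\<forall>a b. h (a + b) = h a + h b) \<and> (\<forall>a b. h (a * b) = h a * h b)"

lemma ring_map_simps:
  assumes "ring_map h"
  shows "h 1 = 1" "h (a + b) = h a + h b" "h (a * b) = h a * h b" "h 0 = 0" "h (- a) = - h a"
    "h (a - b) = h a - h b" "h (a ^ k) = h a ^ k" "h (sum g A) = (\<Sum>x\<in>A. h (g x))"
    "h (prod g A) = (\<Prod>x\<in>A. h (g x))"
proof -
  show *: "h 1 = 1" "h (a + b) = h a + h b" "h (a * b) = h a * h b" for a b
    using assms unfolding ring_map_def by auto
  have "h 0 + h 0 = h 0 + 0" using *(2)[of 0 0] by simp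
  then show 0: "h 0 = 0" by (simp only: add_left_cancel)
  show m: "h (- a) = - h a" for a using *(2)[of a "- a"] 0 by (simp add: eq_neg_iff_add_eq_0 add.commute)
  show "h (a - b) = h a - h b" using *(2)[of a "- b"] m by simp
  show "h (a ^ k) = h a ^ k" by (induction k) (simp_all add: *)
  show "h (sum g A) = (\<Sum>x\<in>A. h (g x))" by (induction A rule: infinite_finite_induct) (simp_all add: * 0)
  show "h (prod g A) = (\<Prod>x\<in>A. h (g x))" by (induction A rule: infinite_finite_induct) (simp_all add: *)
qed

text \<open>With \<open>h\<close> acting on coefficients and \<open>M\<close> giving the value of
  each monomial, this one map covers evaluation of Laurent polynomials (\<open>lmon\<close>),
  substitution into polynomials (\<open>nmon\<close>) and change of coefficients.\<close>

definition mon_eval :: "('a \<Rightarrow> 'b) \<Rightarrow> ('m \<Rightarrow> 'b) \<Rightarrow> ('m \<Rightarrow>\<^sub>0 'a::comm_ring_1) \<Rightarrow> 'b::comm_ring_1" where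
  "mon_eval h M f = (\<Sum>\<alpha>\<in>Poly_Mapping.keys f. h (Poly_Mapping.lookup f \<alpha>) * M \<alpha>)"

lemma mon_eval_superset:
  assumes "h 0 = 0" "finite A" "Poly_Mapping.keys f \<subseteq> A"
  shows "mon_eval h M f = (\<Sum>\<alpha>\<in>A. h (Poly_Mapping.lookup f \<alpha>) * M \<alpha>)"
  unfolding mon_eval_def
  by (rule sum.mono_neutral_left) (use assms in \<open>auto simp: in_keys_iff\<close>)

lemma mon_eval_zero: "mon_eval h M 0 = 0"
  by (simp add: mon_eval_def)

lemma mon_eval_single: "h 0 = 0 \<Longrightarrow> mon_eval h M (Poly_Mapping.single \<alpha> a) = h a * M \<alpha>"
  by (simp add: mon_eval_def)

lemma mon_eval_add:
  assumes "h 0 = 0" "\<And>a b. h (a + b) = h a + h b"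
  shows "mon_eval h M (f + g) = mon_eval h M f + mon_eval h M g"
proof -
  let ?A = "Poly_Mapping.keys f \<union> Poly_Mapping.keys g"
  have "mon_eval h M k = (\<Sum>\<alpha>\<in>?A. h (Poly_Mapping.lookup k \<alpha>) * M \<alpha>)" if "k \<in> {f, g, f + g}" for k
    by (rule mon_eval_superset) (use that assms keys_add[of f g] in auto)
  then show ?thesis by (simp add: lookup_add assms distrib_right sum.distrib)
qed

text \<open>Both sides of the product rule are additive in each factor, so it suffices to compare
  them on monomials, where it is the multiplicativity of \<open>h\<close> and
  \<open>M\<close>.\<close>

lemma ring_map_mon_eval:
  fixes M :: "('v \<Rightarrow>\<^sub>0 'e::comm_monoid_add) \<Rightarrow> 'b::comm_ring_1"
  assumes h: "ring_map h" and M: "M 0 = 1" "\<And>\<alpha> \<beta>. M (\<alpha> + \<beta>) = M \<alpha> * M \<beta>"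
  shows "ring_map (mon_eval h M)"
proof -
  note [simp] = ring_map_simps[OF h]
  have single: "mon_eval h M (Poly_Mapping.single \<alpha> a) = h a * M \<alpha>" for \<alpha> a
    by (simp add: mon_eval_single)
  have add: "mon_eval h M (f + g) = mon_eval h M f + mon_eval h M g" for f g
    by (rule mon_eval_add) auto
  have "mon_eval h M (f * g) = mon_eval h M f * mon_eval h M g" for f g
  proof (induction f rule: poly_mapping_single_induct)
    case (single \<alpha> a)
    show ?case
    proof (induction g rule: poly_mapping_single_induct)
      case (single \<beta> b)
      show ?case by (simp add: mult_single mon_eval_single M mult_ac)
    qed (simp_all add: mon_eval_zero add algebra_simps)
  qed (simp_all add: mon_eval_zero add algebra_simps)
  moreover have "mon_eval h M 1 = 1"
    using single[of 0 1] by (simp add: M)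
  ultimately show ?thesis using add by (simp add: ring_map_def)
qed

text \<open>Negative exponents make this multiplicative only at points without zero coordinates.
  Points are therefore total functions that are nonzero everywhere, with dummy value 1 where no
  coordinate is prescribed.\<close>

definition lmon :: "('v \<Rightarrow> 'b::field) \<Rightarrow> ('v \<Rightarrow>\<^sub>0 int) \<Rightarrow> 'b" where
  "lmon s \<alpha> = (\<Prod>v\<in>Poly_Mapping.keys \<alpha>. s v powi Poly_Mapping.lookup \<alpha> v)"

lemma lmon_superset:
  "finite A \<Longrightarrow> Poly_Mapping.keys \<alpha> \<subseteq> A \<Longrightarrow> lmon s \<alpha> = (\<Prod>v\<in>A. s v powi Poly_Mapping.lookup \<alpha> v)"
  unfolding lmon_def by (rule prod.mono_neutral_left) (auto simp: in_keys_iff)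

lemma lmon_zero [simp]: "lmon s 0 = 1"
  by (simp add: lmon_def)

lemma lmon_add:
  assumes "\<And>v. s v \<noteq> 0"
  shows "lmon s (\<alpha> + \<beta>) = lmon s \<alpha> * lmon s \<beta>"
proof -
  let ?A = "Poly_Mapping.keys \<alpha> \<union> Poly_Mapping.keys \<beta>"
  have "lmon s \<gamma> = (\<Prod>v\<in>?A. s v powi Poly_Mapping.lookup \<gamma> v)" if "\<gamma> \<in> {\<alpha>, \<beta>, \<alpha> + \<beta>}" for \<gamma>
    by (rule lmon_superset) (use that keys_add[of \<alpha> \<beta>] in auto)
  then show ?thesis by (simp add: lookup_add power_int_add assms prod.distrib)
qed

lemma lmon_nonzero: "(\<And>v. s v \<noteq> 0) \<Longrightarrow> lmon s \<alpha> \<noteq> 0"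
  by (simp add: lmon_def power_int_not_zero)

lemma lmon_single [simp]: "lmon s (Poly_Mapping.single v e) = s v powi e"
  by (simp add: lmon_def)

lemma ring_map_leval:
  assumes "ring_map h" "\<And>v. s v \<noteq> 0"
  shows "ring_map (mon_eval h (lmon s))"
  using assms by (intro ring_map_mon_eval) (simp_all add: lmon_add)

lemma mon_eval_cong:
  assumes "f \<in> carrier (mon_ring V)" "\<And>v. v \<in> V \<Longrightarrow> s v = s' v"
  shows "mon_eval h (lmon s) f = mon_eval h (lmon s') f"
proof -
  have "lmon s \<alpha> = lmon s' \<alpha>" if "\<alpha> \<in> Poly_Mapping.keys f" for \<alpha>
    unfolding lmon_def using assms that by (intro prod.cong) (force simp: mon_ring_def)+
  then show ?thesis by (simp add: mon_eval_def)
qed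

lemma mon_eval_var: "h 0 = 0 \<Longrightarrow> h 1 = 1 \<Longrightarrow> mon_eval h (lmon s) (var v) = s v"
  by (simp add: var_def mon_eval_single)

lemma mon_eval_cst: "h 0 = 0 \<Longrightarrow> mon_eval h (lmon s) (cst a) = h a"
  by (simp add: cst_def mon_eval_single)

lemma ring_map_cst: "ring_map cst"
  by (simp add: ring_map_def cst_def single_add mult_single)

lemma ring_map_id: "ring_map id" by (simp add: ring_map_def)

definition nmon :: "('v \<Rightarrow> 'b::comm_ring_1) \<Rightarrow> ('v \<Rightarrow>\<^sub>0 nat) \<Rightarrow> 'b" where
  "nmon s \<alpha> = (\<Prod>v\<in>Poly_Mapping.keys \<alpha>. s v ^ Poly_Mapping.lookup \<alpha> v)"

lemma subst_eq_mon_eval: "subst h s = mon_eval h (nmon s)"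
  by (rule ext) (simp add: subst_def mon_eval_def nmon_def)

lemma nmon_superset:
  "finite A \<Longrightarrow> Poly_Mapping.keys \<alpha> \<subseteq> A \<Longrightarrow> nmon s \<alpha> = (\<Prod>v\<in>A. s v ^ Poly_Mapping.lookup \<alpha> v)"
  unfolding nmon_def by (rule prod.mono_neutral_left) (auto simp: in_keys_iff)

lemma ring_map_subst:
  assumes "ring_map h"
  shows "ring_map (subst h s)"
proof -
  have "nmon s (\<alpha> + \<beta>) = nmon s \<alpha> * nmon s \<beta>" for \<alpha> \<beta>
  proof -
    let ?A = "Poly_Mapping.keys \<alpha> \<union> Poly_Mapping.keys \<beta>"
    have "nmon s \<gamma> = (\<Prod>v\<in>?A. s v ^ Poly_Mapping.lookup \<gamma> v)" if "\<gamma> \<in> {\<alpha>, \<beta>, \<alpha> + \<beta>}" for \<gamma>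
      by (rule nmon_superset) (use that keys_add[of \<alpha> \<beta>] in auto)
    then show ?thesis by (simp add: lookup_add power_add prod.distrib)
  qed
  moreover have "nmon s 0 = 1" by (simp add: nmon_def)
  ultimately show ?thesis unfolding subst_eq_mon_eval using assms by (intro ring_map_mon_eval) auto
qed

lemma subst_var: "ring_map h \<Longrightarrow> subst h s (var v) = s v"
  by (simp add: subst_eq_mon_eval var_def mon_eval_single ring_map_simps nmon_def)

lemma ring_map_comp_subst:
  assumes "ring_map H"
  shows "H (subst h s f) = subst (\<lambda>a. H (h a)) (\<lambda>v. H (s v)) f"
  by (simp add: subst_def ring_map_simps[OF assms])

lemma subst_cong:
  assumes "f \<in> carrier (mon_ring V)" "\<And>v. v \<in> V \<Longrightarrow> s v = s' v"
  shows "subst h s f = subst h s' f"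
proof -
  have "nmon s \<alpha> = nmon s' \<alpha>" if "\<alpha> \<in> Poly_Mapping.keys f" for \<alpha>
    unfolding nmon_def using assms that by (intro prod.cong) (force simp: mon_ring_def)+
  then show ?thesis by (simp add: subst_eq_mon_eval mon_eval_def)
qed

lemma subst_in_mon_ring:
  assumes "f \<in> carrier (mon_ring W)" "\<And>v. v \<in> W \<Longrightarrow> s v \<in> carrier (mon_ring V)"
  shows "subst cst s f \<in> carrier (mon_ring V)"
  using assms(1)
proof (induction f rule: mon_ring_induct)
  case zero
  then show ?case by (simp add: ring_map_simps[OF ring_map_subst[OF ring_map_cst]] mon_ring_zero_closed)
next
  case (single \<alpha> a)
  interpret cring "mon_ring V" by (rule cring_mon_ring)
  have "(\<Prod>v\<in>A. s v ^ Poly_Mapping.lookup \<alpha> v) \<in> carrier (mon_ring V)" if "A \<subseteq> W" for A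
    using that
  proof (induction A rule: infinite_finite_induct)
    case (insert v A)
    have "s v ^ Poly_Mapping.lookup \<alpha> v \<in> carrier (mon_ring V)"
      using nat_pow_closed[of "s v" "Poly_Mapping.lookup \<alpha> v"] insert assms(2) by (simp add: mon_ring_pow)
    then show ?case using insert by (simp add: mon_ring_mult_closed)
  qed (simp_all add: mon_ring_one_closed)
  then show ?case using single
    by (simp add: subst_eq_mon_eval mon_eval_single ring_map_simps[OF ring_map_cst] nmon_def
        mon_ring_mult_closed cst_in_mon_ring)
next
  case (add f g)
  then show ?case by (simp add: ring_map_simps[OF ring_map_subst[OF ring_map_cst]] mon_ring_add_closed)
qed

lemma mon_ring_sum_closed:
  "(\<And>x. x \<in> A \<Longrightarrow> f x \<in> carrier (mon_ring V)) \<Longrightarrow> sum f A \<in> carrier (mon_ring V)"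
  by (induction A rule: infinite_finite_induct) (simp_all add: mon_ring_zero_closed mon_ring_add_closed)

section \<open>Generic points avoiding finitely many hypersurfaces of a torus\<close>

lemma lmon_fun_upd:
  fixes s :: "'v \<Rightarrow> 'a::field"
  assumes "s b \<noteq> 0"
  shows "lmon s \<alpha> = s b powi Poly_Mapping.lookup \<alpha> b * lmon (s(b := 1)) \<alpha>"
proof -
  let ?A = "insert b (Poly_Mapping.keys \<alpha>)"
  have "lmon s' \<alpha> = s' b powi Poly_Mapping.lookup \<alpha> b *
      (\<Prod>v\<in>?A - {b}. s' v powi Poly_Mapping.lookup \<alpha> v)" for s' :: "'v \<Rightarrow> 'a"
    unfolding lmon_superset[of ?A, OF finite.insertI[OF finite_keys] subset_insertI]
    by (rule prod.remove) auto
  from this[of s] this[of "s(b := 1)"] show ?thesis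
    by (simp del: insert_Diff_single)
qed

text \<open>View \<open>h\<close> as a Laurent polynomial in the variable \<open>b\<close>, with
  coefficients in the other variables. One of its nonzero coefficients serves as \<open>h'\<close>:
  where it does not vanish, a nonzero Laurent polynomial in one variable remains, which has finitely
  many zeros.\<close>

lemma finite_zeros_peel:
  fixes h :: "('v \<Rightarrow>\<^sub>0 int) \<Rightarrow>\<^sub>0 'a::field"
  assumes h: "h \<in> carrier (mon_ring (insert b B))" "h \<noteq> 0"
  shows "\<exists>h'\<in>carrier (mon_ring B) - {0}. \<forall>\<rho>. (\<forall>v. \<rho> v \<noteq> 0) \<and> mon_eval id (lmon \<rho>) h' \<noteq> 0 \<longrightarrow>
    finite {c. c \<noteq> 0 \<and> mon_eval id (lmon (\<rho>(b := c))) h = 0}"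
proof -
  obtain \<alpha>0 where \<alpha>0: "\<alpha>0 \<in> Poly_Mapping.keys h" using h(2) keys_eq_empty by blast
  define e where "e = Poly_Mapping.lookup \<alpha>0 b"
  \<comment> \<open>The terms whose exponent at \<open>b\<close> is \<open>e\<close>. Erasing this
    exponent with \<open>r\<close> is injective on \<open>K\<close>, so the terms of
    \<open>h'\<close> cannot cancel.\<close>
  define K where "K = {\<alpha> \<in> Poly_Mapping.keys h. Poly_Mapping.lookup \<alpha> b = e}"
  define r where "r \<alpha> = Poly_Mapping.update b 0 \<alpha>" for \<alpha> :: "'v \<Rightarrow>\<^sub>0 int"
  define h' where "h' = (\<Sum>\<alpha>\<in>K. Poly_Mapping.single (r \<alpha>) (Poly_Mapping.lookup h \<alpha>))"
  have r_inj: "r \<alpha> = r \<beta> \<longleftrightarrow> \<alpha> = \<beta>" if "\<alpha> \<in> K" "\<beta> \<in> K" for \<alpha> \<beta>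
  proof
    assume "r \<alpha> = r \<beta>"
    then have *: "Poly_Mapping.lookup (r \<alpha>) v = Poly_Mapping.lookup (r \<beta>) v" for v by simp
    show "\<alpha> = \<beta>"
    proof (rule poly_mapping_eqI)
      fix v show "Poly_Mapping.lookup \<alpha> v = Poly_Mapping.lookup \<beta> v"
        using *[of v] that by (cases "v = b") (simp_all add: K_def r_def lookup_update)
    qed
  qed simp
  have finK: "finite K" by (simp add: K_def)
  have h'C: "h' \<in> carrier (mon_ring B)"
  proof -
    have "Poly_Mapping.keys (r \<alpha>) \<subseteq> B" if "\<alpha> \<in> K" for \<alpha>
      using that h(1) by (auto simp: K_def r_def mon_ring_def keys_update in_keys_iff lookup_update split: if_splits)
    then show ?thesis unfolding h'_def by (intro mon_ring_sum_closed single_in_mon_ring)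
  qed
  have "Poly_Mapping.lookup h' (r \<alpha>0) = (\<Sum>\<alpha>\<in>K. if \<alpha> = \<alpha>0 then Poly_Mapping.lookup h \<alpha> else 0)"
    unfolding h'_def lookup_sum using r_inj \<alpha>0
    by (intro sum.cong) (auto simp: lookup_single when_def K_def e_def)
  also have "\<dots> = Poly_Mapping.lookup h \<alpha>0" using finK \<alpha>0 by (simp add: K_def e_def)
  finally have "h' \<noteq> 0" using \<alpha>0 by (auto simp: in_keys_iff)
  moreover have "finite {c. c \<noteq> 0 \<and> mon_eval id (lmon (\<rho>(b := c))) h = 0}"
    if \<rho>: "\<And>v. \<rho> v \<noteq> 0" and nz: "mon_eval id (lmon \<rho>) h' \<noteq> 0" for \<rho>
  proof -
    let ?k = "Poly_Mapping.keys h"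
    let ?M = "lmon (\<rho>(b := 1))"
    \<comment> \<open>Multiplication by the \<open>N\<close>-th power of \<open>b\<close> clears all
      negative exponents and yields the ordinary polynomial \<open>p\<close>.\<close>
    define N where "N = Max ((\<lambda>\<alpha>. nat \<bar>Poly_Mapping.lookup \<alpha> b\<bar>) ` ?k)"
    have N: "0 \<le> int N + Poly_Mapping.lookup \<alpha> b" if "\<alpha> \<in> ?k" for \<alpha>
    proof -
      have "nat \<bar>Poly_Mapping.lookup \<alpha> b\<bar> \<le> N" unfolding N_def using that by (intro Max_ge) auto
      then show ?thesis by linarith
    qed
    define p where "p = (\<Sum>\<alpha>\<in>?k. monom (Poly_Mapping.lookup h \<alpha> * ?M \<alpha>) (nat (int N + Poly_Mapping.lookup \<alpha> b)))"
    have ev: "poly p c = c ^ N * mon_eval id (lmon (\<rho>(b := c))) h" if "c \<noteq> 0" for c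
    proof -
      have "lmon (\<rho>(b := c)) \<alpha> = c powi Poly_Mapping.lookup \<alpha> b * ?M \<alpha>" for \<alpha>
        using lmon_fun_upd[of "\<rho>(b := c)" b \<alpha>] that by simp
      moreover have "c ^ nat (int N + Poly_Mapping.lookup \<alpha> b) = c ^ N * c powi Poly_Mapping.lookup \<alpha> b"
        if "\<alpha> \<in> ?k" for \<alpha>
        using power_int_add[of c "int N" "Poly_Mapping.lookup \<alpha> b"] \<open>c \<noteq> 0\<close> N[OF that]
        by (simp add: power_int_def)
      ultimately show ?thesis
        by (auto simp: p_def poly_sum poly_monom mon_eval_def sum_distrib_left intro!: sum.cong)
    qed
    \<comment> \<open>This coefficient of \<open>p\<close> is the value of \<open>h'\<close> at
      \<open>\<rho>\<close>, which certifies that \<open>p\<close> is not the zero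
      polynomial.\<close>
    have "coeff p (nat (int N + e)) = (\<Sum>\<alpha>\<in>?k. if Poly_Mapping.lookup \<alpha> b = e then Poly_Mapping.lookup h \<alpha> * ?M \<alpha> else 0)"
      unfolding p_def coeff_sum
    proof (rule sum.cong)
      fix \<alpha> assume \<alpha>: "\<alpha> \<in> ?k"
      have "nat (int N + Poly_Mapping.lookup \<alpha> b) = nat (int N + e) \<longleftrightarrow> Poly_Mapping.lookup \<alpha> b = e"
        using N[OF \<alpha>] N[OF \<alpha>0] unfolding e_def by linarith
      then show "coeff (monom (Poly_Mapping.lookup h \<alpha> * ?M \<alpha>) (nat (int N + Poly_Mapping.lookup \<alpha> b))) (nat (int N + e)) =
          (if Poly_Mapping.lookup \<alpha> b = e then Poly_Mapping.lookup h \<alpha> * ?M \<alpha> else 0)"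
        by simp
    qed simp
    also have "\<dots> = (\<Sum>\<alpha>\<in>K. Poly_Mapping.lookup h \<alpha> * ?M \<alpha>)"
      unfolding K_def by (subst sum.inter_filter[symmetric]) simp_all
    also have "\<dots> = (\<Sum>\<alpha>\<in>K. mon_eval id (lmon \<rho>) (Poly_Mapping.single (r \<alpha>) (Poly_Mapping.lookup h \<alpha>)))"
    proof (rule sum.cong)
      fix \<alpha>
      have "lmon \<rho> (r \<alpha>) = ?M (r \<alpha>)"
        using lmon_fun_upd[of \<rho> b "r \<alpha>"] \<rho> by (simp add: r_def lookup_update)
      also have "\<dots> = ?M \<alpha>"
        by (subst (1 2) lmon_superset[of "insert b (Poly_Mapping.keys \<alpha>)"])
          (auto simp: r_def keys_update lookup_update intro!: prod.cong)
      finally show "Poly_Mapping.lookup h \<alpha> * ?M \<alpha> = mon_eval id (lmon \<rho>) (Poly_Mapping.single (r \<alpha>) (Poly_Mapping.lookup h \<alpha>))"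
        by (simp add: mon_eval_single)
    qed simp
    also have "\<dots> = mon_eval id (lmon \<rho>) h'"
      unfolding h'_def by (rule ring_map_simps(8)[symmetric]) (intro ring_map_leval ring_map_id \<rho>)
    finally have "p \<noteq> 0" using nz by auto
    then have "finite {c. poly p c = 0}" by (rule poly_roots_finite)
    then show ?thesis by (rule finite_subset[rotated]) (auto simp: ev)
  qed
  ultimately show ?thesis using h'C by blast
qed

lemma finite_zeros_peel_set:
  fixes H :: "(('v \<Rightarrow>\<^sub>0 int) \<Rightarrow>\<^sub>0 'a::field) set"
  assumes "finite H" "H \<subseteq> carrier (mon_ring (insert b B)) - {0}"
  shows "\<exists>H'. finite H' \<and> H' \<subseteq> carrier (mon_ring B) - {0} \<and>
    (\<forall>\<rho>. (\<forall>v. \<rho> v \<noteq> 0) \<and> (\<forall>h\<in>H'. mon_eval id (lmon \<rho>) h \<noteq> 0) \<longrightarrow>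
      finite {c. c \<noteq> 0 \<and> (\<exists>h\<in>H. mon_eval id (lmon (\<rho>(b := c))) h = 0)})"
proof -
  let ?P = "\<lambda>h h'. h' \<in> carrier (mon_ring B) - {0} \<and> (\<forall>\<rho>. (\<forall>v. \<rho> v \<noteq> 0) \<and> mon_eval id (lmon \<rho>) h' \<noteq> 0 \<longrightarrow>
      finite {c. c \<noteq> 0 \<and> mon_eval id (lmon (\<rho>(b := c))) h = 0})"
  have "\<forall>h\<in>H. \<exists>h'. ?P h h'"
  proof
    fix h assume "h \<in> H"
    then have "h \<in> carrier (mon_ring (insert b B))" "h \<noteq> 0" using assms(2) by auto
    from finite_zeros_peel[OF this] show "\<exists>h'. ?P h h'" unfolding Bex_def .
  qed
  from bchoice[OF this] obtain F where "\<forall>h\<in>H. ?P h (F h)" ..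
  then have F: "?P h (F h)" if "h \<in> H" for h using that by (rule bspec)
  have "finite {c. c \<noteq> 0 \<and> (\<exists>h\<in>H. mon_eval id (lmon (\<rho>(b := c))) h = 0)}"
    if \<rho>: "(\<forall>v. \<rho> v \<noteq> 0) \<and> (\<forall>h\<in>F ` H. mon_eval id (lmon \<rho>) h \<noteq> 0)" for \<rho>
  proof -
    have "finite (\<Union>h\<in>H. {c. c \<noteq> 0 \<and> mon_eval id (lmon (\<rho>(b := c))) h = 0})"
      using F \<rho> assms(1) by (intro finite_UN_I) blast+
    then show ?thesis by (rule finite_subset[rotated]) blast
  qed
  then have "\<forall>\<rho>. (\<forall>v. \<rho> v \<noteq> 0) \<and> (\<forall>h\<in>F ` H. mon_eval id (lmon \<rho>) h \<noteq> 0) \<longrightarrow>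
      finite {c. c \<noteq> 0 \<and> (\<exists>h\<in>H. mon_eval id (lmon (\<rho>(b := c))) h = 0)}"
    by (intro allI impI)
  moreover have "F ` H \<subseteq> carrier (mon_ring B) - {0}"
    by (rule image_subsetI) (rule F[THEN conjunct1])
  ultimately show ?thesis using assms(1) by (intro exI[of _ "F ` H"] conjI finite_imageI)
qed

text \<open>Induction on the variables: the coefficients obtained by peeling off \<open>b\<close>
  are kept nonzero by the earlier coordinates, after which only finitely many values of
  \<open>b\<close> are forbidden.\<close>

lemma exists_generic_point:
  fixes H :: "(('v \<Rightarrow>\<^sub>0 int) \<Rightarrow>\<^sub>0 'a::field) set"
  assumes inf: "infinite (UNIV :: 'a set)" and B: "finite B"
    and H: "finite H" "H \<subseteq> carrier (mon_ring B) - {0}"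
  shows "\<exists>\<rho>. (\<forall>v. \<rho> v \<noteq> 0) \<and> (\<forall>h\<in>H. mon_eval id (lmon \<rho>) h \<noteq> 0)"
  using B H
proof (induction B arbitrary: H rule: finite_induct)
  case empty
  have "mon_eval id (lmon (\<lambda>_. 1)) h \<noteq> 0" if "h \<in> H" for h
  proof -
    have h: "h \<in> carrier (mon_ring {})" "h \<noteq> 0" using that empty by auto
    then have "Poly_Mapping.keys h \<subseteq> {0}" by (auto simp: mon_ring_def keys_eq_empty)
    then have "mon_eval id (lmon (\<lambda>_. 1)) h = Poly_Mapping.lookup h 0"
      by (subst mon_eval_superset[of _ "{0}"]) auto
    moreover obtain \<alpha> where "\<alpha> \<in> Poly_Mapping.keys h" using h(2) keys_eq_empty by blast
    ultimately show ?thesis using \<open>Poly_Mapping.keys h \<subseteq> {0}\<close> by (auto simp: in_keys_iff)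
  qed
  then show ?case by (intro exI[of _ "\<lambda>_. 1"] conjI allI ballI) (rule one_neq_zero, blast)
next
  case (insert b B)
  obtain H' where H': "finite H'" "H' \<subseteq> carrier (mon_ring B) - {0}"
    and fin: "\<forall>\<rho>. (\<forall>v. \<rho> v \<noteq> 0) \<and> (\<forall>h\<in>H'. mon_eval id (lmon \<rho>) h \<noteq> 0) \<longrightarrow>
      finite {c. c \<noteq> 0 \<and> (\<exists>h\<in>H. mon_eval id (lmon (\<rho>(b := c))) h = 0)}"
    using finite_zeros_peel_set[OF insert.prems] by blast
  obtain \<rho> where \<rho>: "\<forall>v. \<rho> v \<noteq> 0" "\<forall>h\<in>H'. mon_eval id (lmon \<rho>) h \<noteq> 0"
    using insert.IH[OF H'] by blast
  have "finite ({0} \<union> {c. c \<noteq> 0 \<and> (\<exists>h\<in>H. mon_eval id (lmon (\<rho>(b := c))) h = 0)})"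
    using fin \<rho> by blast
  from ex_new_if_finite[OF inf this]
  obtain c where "c \<notin> {0} \<union> {c. c \<noteq> 0 \<and> (\<exists>h\<in>H. mon_eval id (lmon (\<rho>(b := c))) h = 0)}" ..
  then have c: "c \<noteq> 0 \<and> \<not> (c \<noteq> 0 \<and> (\<exists>h\<in>H. mon_eval id (lmon (\<rho>(b := c))) h = 0))"
    unfolding Un_iff mem_Collect_eq singleton_iff de_Morgan_disj .
  have "\<forall>v. (\<rho>(b := c)) v \<noteq> 0" using \<rho>(1) c by simp
  moreover have "\<forall>h\<in>H. mon_eval id (lmon (\<rho>(b := c))) h \<noteq> 0"
  proof (intro ballI notI)
    fix h assume "h \<in> H" "mon_eval id (lmon (\<rho>(b := c))) h = 0"
    then show False using conjunct2[OF c] conjunct1[OF c] by - (erule notE, rule conjI, assumption, rule bexI)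
  qed
  ultimately show ?case by (intro exI[of _ "\<rho>(b := c)"] conjI)
qed

section \<open>Initial ideals over a valued field\<close>

locale valued_field =
  fixes \<nu> :: "'l::field \<Rightarrow> real"
  assumes valuation: "valuation \<nu>"
begin

abbreviation av :: "'l \<Rightarrow> real" where "av \<equiv> absv \<nu>"

lemma av_nonneg [simp]: "0 \<le> av a" by (simp add: absv_def)

lemma av_eq_0_iff [simp]: "av a = 0 \<longleftrightarrow> a = 0" by (simp add: absv_def)

lemma av_pos_iff [simp]: "0 < av a \<longleftrightarrow> a \<noteq> 0" by (simp add: absv_def)

lemma av_le_0_iff [simp]: "av a \<le> 0 \<longleftrightarrow> a = 0"
  using av_nonneg[of a] av_eq_0_iff[of a] by linarith

lemma av_zero [simp]: "av 0 = 0" by (simp add: absv_def)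

lemma av_mult: "av (a * b) = av a * av b"
  using valuation by (simp add: absv_def valuation_def exp_add [symmetric])

lemma av_one [simp]: "av 1 = 1"
  using av_mult[of 1 1] av_pos_iff[of 1] by simp

lemma av_uminus [simp]: "av (- a) = av a"
proof -
  have "av (-1) * av (-1) = 1" using av_mult[of "-1" "-1"] by simp
  then have "av (-1) = 1" using av_nonneg[of "-1"] by (simp add: square_eq_1_iff)
  then show ?thesis using av_mult[of "-1" a] by simp
qed

lemma av_add: "av (a + b) \<le> max (av a) (av b)"
proof (cases "a = 0 \<or> b = 0 \<or> a + b = 0")
  case True
  then show ?thesis by (auto simp: le_max_iff_disj)
next
  case False
  then have "min (\<nu> a) (\<nu> b) \<le> \<nu> (a + b)" using valuation by (auto simp: valuation_def)
  then show ?thesis using False by (auto simp: absv_def max_def min_def split: if_splits)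
qed

lemma av_add_le: "av a \<le> r \<Longrightarrow> av b \<le> r \<Longrightarrow> av (a + b) \<le> r"
  using av_add[of a b] by linarith

lemma av_diff_le: "av a \<le> r \<Longrightarrow> av b \<le> r \<Longrightarrow> av (a - b) \<le> r"
  using av_add_le[of a r "- b"] by simp

lemma av_inverse: "av (inverse a) = inverse (av a)"
proof (cases "a = 0")
  case False
  then have "av a * av (inverse a) = 1" using av_mult[of a "inverse a"] by simp
  then show ?thesis by (metis inverse_unique)
qed simp

lemma av_divide: "av (a / b) = av a / av b"
  by (simp add: divide_inverse av_mult av_inverse)

lemma av_power: "av (a ^ k) = av a ^ k"
  by (induction k) (simp_all add: av_mult)

lemma av_powi: "av (a powi k) = av a powi k"
  by (simp add: power_int_def av_power av_inverse power_inverse)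

lemma av_prod: "av (prod f A) = (\<Prod>x\<in>A. av (f x))"
  by (induction A rule: infinite_finite_induct) (simp_all add: av_mult)

lemma av_sum_le: "(\<And>x. x \<in> A \<Longrightarrow> av (f x) \<le> r) \<Longrightarrow> 0 \<le> r \<Longrightarrow> av (sum f A) \<le> r"
  by (induction A rule: infinite_finite_induct) (simp_all add: av_add_le)

lemma av_of_nat_le: "av (of_nat k) \<le> 1"
  by (induction k) (simp_all add: av_add_le)

end

locale residue_field = valued_field \<nu> for \<nu> :: "'l::field \<Rightarrow> real" +
  fixes res :: "'l \<Rightarrow> 'r::field"
  assumes residue_map: "residue_map \<nu> res"
begin

lemma res_one [simp]: "res 1 = 1" using residue_map by (simp add: residue_map_def)

lemma res_add: "av a \<le> 1 \<Longrightarrow> av b \<le> 1 \<Longrightarrow> res (a + b) = res a + res b"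
  and res_mult: "av a \<le> 1 \<Longrightarrow> av b \<le> 1 \<Longrightarrow> res (a * b) = res a * res b"
  and res_eq_0_iff: "av a \<le> 1 \<Longrightarrow> res a = 0 \<longleftrightarrow> av a < 1"
  and res_surj: "\<exists>a. av a \<le> 1 \<and> res a = c"
  using residue_map by (simp_all add: residue_map_def)

lemma res_zero [simp]: "res 0 = 0" by (simp add: res_eq_0_iff)

lemma res_nonzero_iff: "av a \<le> 1 \<Longrightarrow> res a \<noteq> 0 \<longleftrightarrow> av a = 1"
  by (auto simp: res_eq_0_iff)

lemma res_uminus: "av a \<le> 1 \<Longrightarrow> res (- a) = - res a"
  using res_add[of a "- a"] by (simp add: eq_neg_iff_add_eq_0 add.commute)

lemma res_lift:
  assumes "c \<noteq> 0"
  obtains a where "av a = 1" "res a = c"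
  using res_surj[of c] assms by (auto simp: res_nonzero_iff)

lemma res_inverse:
  assumes "av a = 1"
  shows "res (inverse a) = inverse (res a)"
proof -
  have "a \<noteq> 0" using assms by auto
  then have "res a * res (inverse a) = 1"
    using assms res_mult[of a "inverse a"] by (auto simp: av_inverse)
  then show ?thesis by (metis inverse_unique)
qed

lemma res_power: "av a \<le> 1 \<Longrightarrow> res (a ^ k) = res a ^ k"
  by (induction k) (simp_all add: res_mult av_power power_le_one)

lemma res_powi: "av a = 1 \<Longrightarrow> res (a powi k) = res a powi k"
  by (simp add: power_int_def res_power res_inverse av_inverse)

lemma res_prod: "(\<And>x. x \<in> A \<Longrightarrow> av (f x) \<le> 1) \<Longrightarrow> res (prod f A) = (\<Prod>x\<in>A. res (f x))"
  by (induction A rule: infinite_finite_induct) (simp_all add: res_mult av_prod prod_le_1)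

lemma res_sum: "(\<And>x. x \<in> A \<Longrightarrow> av (f x) \<le> 1) \<Longrightarrow> res (sum f A) = (\<Sum>x\<in>A. res (f x))"
  by (induction A rule: infinite_finite_induct) (simp_all add: res_add av_sum_le)

lemma av_lmon: "(\<And>v. av (W v) = 1) \<Longrightarrow> av (lmon W \<alpha>) = 1"
  by (simp add: lmon_def av_prod av_powi)

lemma res_lmon: "(\<And>v. av (W v) = 1) \<Longrightarrow> res (lmon W \<alpha>) = lmon (\<lambda>v. res (W v)) \<alpha>"
  by (simp add: lmon_def res_prod av_powi res_powi)

end

text \<open>A root of \<open>\<Prod>c (X - c) + 1\<close>, with \<open>c\<close> running through representatives of all residue
  classes, would be integral and hence congruent to some \<open>c\<close>.\<close>

lemma infinite_residue_field:
  fixes \<nu> :: "'l::alg_closed_field \<Rightarrow> real" and res :: "'l \<Rightarrow> 'r::field"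
  assumes "residue_field \<nu> res"
  shows "infinite (UNIV :: 'r set)"
proof
  interpret residue_field \<nu> res by fact
  assume fin: "finite (UNIV :: 'r set)"
  obtain lift where lift: "\<And>c::'r. av (lift c) \<le> 1 \<and> res (lift c) = c" using res_surj by metis
  define q :: "'l poly" where "q = (\<Prod>c\<in>UNIV. [:- lift c, 1:])"
  have "degree q = card (UNIV :: 'r set)"
    unfolding q_def by (subst degree_prod_eq_sum_degree) auto
  then have deg: "degree (q + 1) > 0"
    using fin by (subst degree_add_eq_left) (simp_all add: finite_UNIV_card_ge_0)
  then obtain z where "poly (q + 1) z = 0" using alg_closed_imp_poly_has_root by blast
  then have z: "(\<Prod>c\<in>UNIV. z - lift c) = - 1"
    by (simp add: q_def poly_prod eq_neg_iff_add_eq_0)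
  \<comment> \<open>If \<open>z\<close> were not integral, every factor \<open>z - lift c\<close>
    would have absolute value above 1, but their product is -1.\<close>
  have int: "av z \<le> 1"
  proof (rule ccontr)
    assume z1: "\<not> av z \<le> 1"
    have "av (z - lift c) \<ge> av z" for c
    proof -
      have "av z \<le> max (av (z - lift c)) (av (lift c))" using av_add[of "z - lift c" "lift c"] by simp
      then show ?thesis using lift[of c] z1 by linarith
    qed
    then have "1 < av (z - lift c)" for c using z1 by (meson less_le_trans not_le)
    then have "1 < (\<Prod>c\<in>UNIV. av (z - lift c))" using fin by (intro less_1_prod) auto
    then show False using arg_cong[OF z, of av] by (simp add: av_prod)
  qed
  have "res (\<Prod>c\<in>UNIV. z - lift c) = (\<Prod>c\<in>UNIV. res (z - lift c))"
    by (rule res_prod) (use int lift in \<open>auto intro: av_diff_le\<close>)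
  also have "\<dots> = 0"
  proof (rule prod_zero[OF fin], rule bexI)
    show "res (z - lift (res z)) = 0"
      using res_add[of z "- lift (res z)"] res_uminus[of "lift (res z)"] int lift[of "res z"] by simp
  qed simp
  finally have "res (- 1) = 0" using z by simp
  then show False by (simp add: res_uminus)
qed

section \<open>Initial forms, and evaluation of the initial ideal at reduced points\<close>

lemma initial_form_cong:
  assumes "f \<in> carrier (mon_ring V)" "\<And>v. v \<in> V \<Longrightarrow> \<tau> v = \<tau>' v"
  shows "initial_form res \<tau> c f = initial_form res \<tau>' c f"
proof -
  have "lmon \<tau> \<alpha> = lmon \<tau>' \<alpha>" if "\<alpha> \<in> Poly_Mapping.keys f" for \<alpha>
    unfolding lmon_def using assms that by (intro prod.cong) (force simp: mon_ring_def)+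
  then show ?thesis by (simp add: initial_form_def lmon_def)
qed

text \<open>Allows the torus point to be redefined outside \<open>V\<close>, where nothing is
  assumed about it, so that it becomes nonzero everywhere.\<close>

lemma initial_ideal_cong:
  assumes "I \<subseteq> carrier (mon_ring V)" "\<And>v. v \<in> V \<Longrightarrow> \<tau> v = \<tau>' v"
  shows "initial_ideal \<nu> res V y \<tau> I = initial_ideal \<nu> res V y \<tau>' I"
proof -
  have "initial_form res \<tau> c f = initial_form res \<tau>' c f" if "f \<in> I" for c f
    using initial_form_cong[of f V \<tau> \<tau>' res c] assms that by blast
  then show ?thesis unfolding initial_ideal_def by metis
qed

locale degeneration = residue_field \<nu> res
  for \<nu> :: "'l::field \<Rightarrow> real" and res :: "'l \<Rightarrow> 'r::field" +
  fixes V :: "'v set" and y :: "'v \<Rightarrow> real" and \<tau> :: "'v \<Rightarrow> 'l" and I :: "(('v \<Rightarrow>\<^sub>0 int) \<Rightarrow>\<^sub>0 'l) set"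
  assumes \<tau>_nonzero: "\<tau> v \<noteq> 0"
    and \<tau>_val: "v \<in> V \<Longrightarrow> ln (absv \<nu> (\<tau> v)) = y v"
    and I_carrier: "I \<subseteq> carrier (mon_ring V)"
begin

text \<open>Relaxes the exact normalisation \<open>\<nu> c = weight \<nu> y f\<close> to an
  inequality. Unlike the exact weight, which may drop by cancellation, this is stable under sums for
  a fixed \<open>c\<close>, so that \<open>In c\<close> is additive.\<close>

definition integral :: "'l \<Rightarrow> (('v \<Rightarrow>\<^sub>0 int) \<Rightarrow>\<^sub>0 'l) \<Rightarrow> bool" where
  "integral c f \<longleftrightarrow> (\<forall>\<alpha>. av (c * Poly_Mapping.lookup f \<alpha> * lmon \<tau> \<alpha>) \<le> 1)"

abbreviation In :: "'l \<Rightarrow> (('v \<Rightarrow>\<^sub>0 int) \<Rightarrow>\<^sub>0 'l) \<Rightarrow> (('v \<Rightarrow>\<^sub>0 int) \<Rightarrow>\<^sub>0 'r)" where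
  "In c f \<equiv> initial_form res \<tau> c f"

abbreviation Q :: "(('v \<Rightarrow>\<^sub>0 int) \<Rightarrow>\<^sub>0 'r) set" where
  "Q \<equiv> initial_ideal \<nu> res V y \<tau> I"

lemma lookup_In: "Poly_Mapping.lookup (In c f) \<alpha> = res (c * Poly_Mapping.lookup f \<alpha> * lmon \<tau> \<alpha>)"
  by (auto simp: initial_form_def lookup_sum lookup_single when_def lmon_def in_keys_iff)

lemma In_in_mon_ring:
  assumes "f \<in> carrier (mon_ring V)"
  shows "In c f \<in> carrier (mon_ring V)"
proof -
  have "Poly_Mapping.keys (In c f) \<subseteq> Poly_Mapping.keys f" by (auto simp: in_keys_iff lookup_In)
  then show ?thesis using assms by (auto simp: mon_ring_def)
qed

text \<open>Translates between absolute values of rescaled terms and the additive expression that is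
  maximised in \<open>weight\<close>.\<close>

lemma ln_av_term:
  assumes "c \<noteq> 0" "a \<noteq> 0" "Poly_Mapping.keys \<alpha> \<subseteq> V"
  shows "ln (av (c * a * lmon \<tau> \<alpha>)) =
    - \<nu> c + (- \<nu> a + (\<Sum>v\<in>Poly_Mapping.keys \<alpha>. of_int (Poly_Mapping.lookup \<alpha> v) * y v))"
proof -
  have p: "ln (av (\<tau> v powi k)) = of_int k * ln (av (\<tau> v))" for v k
    by (cases "k \<ge> 0") (simp_all add: av_power av_inverse power_int_def ln_realpow ln_inverse \<tau>_nonzero)
  have "ln (av (lmon \<tau> \<alpha>)) = (\<Sum>v\<in>Poly_Mapping.keys \<alpha>. ln (av (\<tau> v powi Poly_Mapping.lookup \<alpha> v)))"
    unfolding lmon_def av_prod by (subst ln_prod) (simp_all add: \<tau>_nonzero power_int_not_zero)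
  also have "\<dots> = (\<Sum>v\<in>Poly_Mapping.keys \<alpha>. of_int (Poly_Mapping.lookup \<alpha> v) * y v)"
    using assms(3) \<tau>_val by (intro sum.cong) (auto simp: p)
  finally have "ln (av (lmon \<tau> \<alpha>)) = \<dots>" .
  moreover have "ln (av c) = - \<nu> c" "ln (av a) = - \<nu> a" using assms by (simp_all add: absv_def)
  ultimately show ?thesis
    using assms by (simp add: av_mult ln_mult lmon_nonzero \<tau>_nonzero)
qed

lemma weight_eq_imp_integral:
  assumes "f \<in> carrier (mon_ring V)" "c \<noteq> 0" "\<nu> c = weight \<nu> y f"
  shows "integral c f"
  unfolding integral_def
proof
  fix \<alpha>
  show "av (c * Poly_Mapping.lookup f \<alpha> * lmon \<tau> \<alpha>) \<le> 1"
  proof (cases "\<alpha> \<in> Poly_Mapping.keys f")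
    case True
    let ?a = "Poly_Mapping.lookup f \<alpha>"
    have a: "?a \<noteq> 0" "Poly_Mapping.keys \<alpha> \<subseteq> V" using True assms by (auto simp: mon_ring_def)
    have "- \<nu> ?a + (\<Sum>v\<in>Poly_Mapping.keys \<alpha>. of_int (Poly_Mapping.lookup \<alpha> v) * y v) \<le> weight \<nu> y f"
      unfolding weight_def using True by (intro Max_ge) auto
    then have "ln (av (c * ?a * lmon \<tau> \<alpha>)) \<le> 0"
      unfolding ln_av_term[OF assms(2) a] using assms(3) by linarith
    moreover have "0 < av (c * ?a * lmon \<tau> \<alpha>)" using a assms(2) by (simp add: lmon_nonzero \<tau>_nonzero)
    ultimately show ?thesis by (simp only: ln_le_zero_iff)
  qed (simp add: in_keys_iff)
qed

lemma ideal_Q: "ideal Q (mon_ring V)"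
  unfolding initial_ideal_def
  by (rule ring.genideal_ideal[OF ring_mon_ring]) (use I_carrier In_in_mon_ring in auto)

text \<open>If \<open>c\<close> is smaller than the exact normalisation, all residues vanish and the
  form is 0. Otherwise some term becomes a unit, which forces \<open>\<nu> c\<close> to be the
  weight, and the form is one of the generators.\<close>

lemma In_in_Q:
  assumes "f \<in> I" "integral c f"
  shows "In c f \<in> Q"
proof (cases "In c f = 0")
  case True
  interpret ideal Q "mon_ring V" by (rule ideal_Q)
  show ?thesis using True additive_subgroup.zero_closed[OF additive_subgroup_axioms] by simp
next
  case False
  then obtain \<alpha> where \<alpha>: "res (c * Poly_Mapping.lookup f \<alpha> * lmon \<tau> \<alpha>) \<noteq> 0"
    by (metis lookup_In lookup_zero poly_mapping_eqI)
  have f: "f \<in> carrier (mon_ring V)" using assms I_carrier by auto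
  have c: "c \<noteq> 0" "Poly_Mapping.lookup f \<alpha> \<noteq> 0" "\<alpha> \<in> Poly_Mapping.keys f" using \<alpha> by (auto simp: in_keys_iff)
  have "av (c * Poly_Mapping.lookup f \<alpha> * lmon \<tau> \<alpha>) = 1"
    using \<alpha> assms(2) res_nonzero_iff unfolding integral_def by blast
  then have eq: "- \<nu> (Poly_Mapping.lookup f \<alpha>) + (\<Sum>v\<in>Poly_Mapping.keys \<alpha>. of_int (Poly_Mapping.lookup \<alpha> v) * y v) = \<nu> c"
    using ln_av_term[of c "Poly_Mapping.lookup f \<alpha>" \<alpha>] c f by (auto simp: mon_ring_def)
  have "weight \<nu> y f = \<nu> c" unfolding weight_def
  proof (rule Max_eqI)
    fix r assume "r \<in> (\<lambda>\<alpha>. - \<nu> (Poly_Mapping.lookup f \<alpha>) +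
        (\<Sum>v\<in>Poly_Mapping.keys \<alpha>. real_of_int (Poly_Mapping.lookup \<alpha> v) * y v)) ` Poly_Mapping.keys f"
    then obtain \<beta> where \<beta>: "\<beta> \<in> Poly_Mapping.keys f" "r = - \<nu> (Poly_Mapping.lookup f \<beta>) +
        (\<Sum>v\<in>Poly_Mapping.keys \<beta>. real_of_int (Poly_Mapping.lookup \<beta> v) * y v)" by auto
    have b: "Poly_Mapping.lookup f \<beta> \<noteq> 0" "Poly_Mapping.keys \<beta> \<subseteq> V" using \<beta> f by (auto simp: mon_ring_def)
    have "av (c * Poly_Mapping.lookup f \<beta> * lmon \<tau> \<beta>) \<le> 1" using assms(2) by (simp add: integral_def)
    moreover have "0 < av (c * Poly_Mapping.lookup f \<beta> * lmon \<tau> \<beta>)"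
      using b c by (simp add: lmon_nonzero \<tau>_nonzero)
    ultimately have "ln (av (c * Poly_Mapping.lookup f \<beta> * lmon \<tau> \<beta>)) \<le> 0" by simp
    then show "r \<le> \<nu> c" unfolding ln_av_term[OF c(1) b] \<beta>(2) by linarith
  qed (use c eq in \<open>auto intro!: image_eqI\<close>)
  then have "In c f \<in> {initial_form res \<tau> c f |c f. f \<in> I \<and> f \<noteq> 0 \<and> c \<noteq> 0 \<and> \<nu> c = weight \<nu> y f}"
    using assms(1) c by force
  then show ?thesis unfolding initial_ideal_def
    by (intro subsetD[OF ring.genideal_self[OF ring_mon_ring]]) (use I_carrier In_in_mon_ring in auto)
qed

lemma Q_subset:
  assumes "ideal P (mon_ring V)" "\<And>c f. f \<in> I \<Longrightarrow> integral c f \<Longrightarrow> In c f \<in> P"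
  shows "Q \<subseteq> P"
  unfolding initial_ideal_def
proof (rule ring.genideal_minimal[OF ring_mon_ring assms(1)], safe)
  fix c f assume "f \<in> I" "c \<noteq> 0" "\<nu> c = weight \<nu> y f"
  then show "In c f \<in> P" using assms(2) weight_eq_imp_integral I_carrier by blast
qed

lemma In_single: "In c (Poly_Mapping.single \<alpha> a) = Poly_Mapping.single \<alpha> (res (c * a * lmon \<tau> \<alpha>))"
  by (rule poly_mapping_eqI) (auto simp: lookup_In lookup_single when_def)

lemma integral_single: "integral c (Poly_Mapping.single \<alpha> a) \<longleftrightarrow> av (c * a * lmon \<tau> \<alpha>) \<le> 1"
  by (auto simp: integral_def lookup_single when_def)

lemma integral_zero: "integral c 0"
  by (simp add: integral_def)

lemma In_zero: "In c 0 = 0"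
  by (simp add: initial_form_def)

lemma integral_add: "integral c f \<Longrightarrow> integral c g \<Longrightarrow> integral c (f + g)"
  by (simp add: integral_def lookup_add distrib_left distrib_right av_add_le)

lemma In_add: "integral c f \<Longrightarrow> integral c g \<Longrightarrow> In c (f + g) = In c f + In c g"
  by (rule poly_mapping_eqI) (simp add: lookup_In lookup_add distrib_left distrib_right res_add integral_def)

lemma integral_uminus: "integral c f \<Longrightarrow> integral c (- f)"
  by (simp add: integral_def)

lemma In_uminus: "integral c f \<Longrightarrow> In c (- f) = - In c f"
  by (rule poly_mapping_eqI) (simp add: lookup_In res_uminus integral_def)

text \<open>Reducing an \<open>L\<close>-point of the variety all of whose coordinates differ from those of \<open>\<tau>\<close> by
  units gives a point of the initial degeneration.\<close>

lemma eval_In: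
  assumes W: "\<And>v. av (W v) = 1" and f: "integral c f"
  shows "mon_eval id (lmon (\<lambda>v. res (W v))) (In c f) = res (c * mon_eval id (lmon (\<lambda>v. \<tau> v * W v)) f)"
proof -
  have m: "lmon (\<lambda>v. \<tau> v * W v) \<alpha> = lmon \<tau> \<alpha> * lmon W \<alpha>" for \<alpha>
    by (simp add: lmon_def power_int_mult_distrib prod.distrib)
  have "mon_eval id (lmon (\<lambda>v. res (W v))) (In c f) =
      (\<Sum>\<alpha>\<in>Poly_Mapping.keys f. res (c * Poly_Mapping.lookup f \<alpha> * lmon \<tau> \<alpha>) * lmon (\<lambda>v. res (W v)) \<alpha>)"
    by (subst mon_eval_superset[where A = "Poly_Mapping.keys f"]) (auto simp: lookup_In in_keys_iff)
  also have "\<dots> = (\<Sum>\<alpha>\<in>Poly_Mapping.keys f. res (c * Poly_Mapping.lookup f \<alpha> * lmon \<tau> \<alpha> * lmon W \<alpha>))"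
    using f by (intro sum.cong) (simp_all add: integral_def res_mult av_lmon W res_lmon)
  also have "\<dots> = res (\<Sum>\<alpha>\<in>Poly_Mapping.keys f. c * Poly_Mapping.lookup f \<alpha> * lmon \<tau> \<alpha> * lmon W \<alpha>)"
    using f by (subst res_sum) (simp_all add: integral_def av_mult[of _ "lmon W _"] av_lmon W)
  also have "\<dots> = res (c * mon_eval id (lmon (\<lambda>v. \<tau> v * W v)) f)"
    by (simp add: mon_eval_def m sum_distrib_left mult.assoc)
  finally show ?thesis .
qed

text \<open>The upper bound for \<open>Q\<close>: the polynomials vanishing at the reduced point
  form an ideal, and it contains each initial form because that form takes the value
  \<open>res 0\<close>.\<close>

lemma eval_Q:
  assumes W: "\<And>v. av (W v) = 1" and van: "\<And>f. f \<in> I \<Longrightarrow> mon_eval id (lmon (\<lambda>v. \<tau> v * W v)) f = 0"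
    and g: "g \<in> Q"
  shows "mon_eval id (lmon (\<lambda>v. res (W v))) g = 0"
proof -
  let ?e = "mon_eval id (lmon (\<lambda>v. res (W v)))"
  have "res (W v) \<noteq> 0" for v using W res_nonzero_iff by simp
  then have e: "ring_map ?e" by (intro ring_map_leval ring_map_id)
  have "Q \<subseteq> {g \<in> carrier (mon_ring V). ?e g = 0}"
  proof (rule Q_subset)
    show "ideal {g \<in> carrier (mon_ring V). ?e g = 0} (mon_ring V)"
      by (rule ideal_mon_ringI)
        (auto simp: ring_map_simps[OF e] mon_ring_zero_closed mon_ring_add_closed mon_ring_mult_closed)
    fix c f assume "f \<in> I" "integral c f"
    then show "In c f \<in> {g \<in> carrier (mon_ring V). ?e g = 0}"
      using eval_In[OF W] van In_in_mon_ring I_carrier by auto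
  qed
  then show ?thesis using g by blast
qed

end

section \<open>Pluecker relations\<close>

text \<open>Variables are indexed by unordered pairs; this sign turns them into the antisymmetric
  Pluecker coordinates.\<close>

definition sg :: "nat \<Rightarrow> nat \<Rightarrow> 'a::comm_ring_1" where
  "sg k l = (if k < l then 1 else - 1)"

lemma sg_swap: "k \<noteq> l \<Longrightarrow> sg l k = - sg k l"
  by (auto simp: sg_def)

lemma sg_square: "sg k l * sg k l = 1"
  by (simp add: sg_def)

lemma ring_map_sg: "ring_map h \<Longrightarrow> h (sg k l) = sg k l"
  by (simp add: sg_def ring_map_simps)

lemma pair_in_pairs: "k \<in> {1..n} \<Longrightarrow> l \<in> {1..n} \<Longrightarrow> k \<noteq> l \<Longrightarrow> {k, l} \<in> pairs n"
  by (auto simp: pairs_def nsets_def)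

lemma pairsE:
  assumes "e \<in> pairs n"
  obtains k l where "e = {k, l}" "k < l" "k \<in> {1..n}" "l \<in> {1..n}"
proof -
  from assms obtain k l where "e = {k, l}" "k \<noteq> l" "e \<subseteq> {1..n}"
    by (auto simp: pairs_def nsets_def card_2_iff)
  then show ?thesis using that[of k l] that[of l k] by (cases "k < l") (auto simp: insert_commute)
qed

definition plucker_rel ::
  "(nat \<Rightarrow> nat \<Rightarrow> 'a) \<Rightarrow> nat \<Rightarrow> nat \<Rightarrow> nat \<Rightarrow> nat \<Rightarrow> 'a::comm_ring_1" where
  "plucker_rel p a b c d = p a b * p c d - p a c * p b d + p a d * p b c"

lemma ring_map_plucker_rel:
  "ring_map h \<Longrightarrow> h (plucker_rel p a b c d) = plucker_rel (\<lambda>k l. h (p k l)) a b c d"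
  by (simp add: plucker_rel_def ring_map_simps)

lemma subst_minor:
  assumes "k \<noteq> l"
  shows "subst cst minor (sg k l * var {k, l}) =
    var (1, k) * var (2, l) - var (1, l) * var (2, k)"
proof -
  note s = ring_map_simps[OF ring_map_subst[OF ring_map_cst]]
    ring_map_sg[OF ring_map_subst[OF ring_map_cst]] subst_var[OF ring_map_cst]
  show ?thesis using assms
    by (cases "k < l") (simp_all add: s sg_def minor_def min_def max_def)
qed

lemma sg_in_mon_ring: "sg k l \<in> carrier (mon_ring V)"
  by (simp add: sg_def mon_ring_one_closed mon_ring_uminus_closed)

lemma plucker_rel_in_mon_ring:
  assumes "\<And>k l. k \<in> {a, b, c, d} \<Longrightarrow> l \<in> {a, b, c, d} \<Longrightarrow> k \<noteq> l \<Longrightarrow> p k l \<in> carrier (mon_ring V)"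
    and "distinct [a, b, c, d]"
  shows "plucker_rel p a b c d \<in> carrier (mon_ring V)"
  unfolding plucker_rel_def
  by (intro mon_ring_add_closed mon_ring_diff_closed mon_ring_mult_closed) (use assms in auto)

lemma plucker_rel_in_plucker_ideal:
  assumes "{a, b, c, d} \<subseteq> {1..n}" "distinct [a, b, c, d]"
  shows "plucker_rel (\<lambda>k l. sg k l * var {k, l}) a b c d \<in> plucker_ideal n"
  unfolding plucker_ideal_def
proof (rule CollectI, rule conjI)
  show "plucker_rel (\<lambda>k l. sg k l * var {k, l}) a b c d \<in> carrier (mon_ring (pairs n))"
    by (intro plucker_rel_in_mon_ring mon_ring_mult_closed sg_in_mon_ring var_in_mon_ring pair_in_pairs)
      (use assms in auto)
  have "subst cst minor (plucker_rel (\<lambda>k l. sg k l * var {k, l}) a b c d) =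
      plucker_rel (\<lambda>k l. var (1, k) * var (2, l) - var (1, l) * var (2, k)) a b c d"
    using assms(2) unfolding ring_map_plucker_rel[OF ring_map_subst[OF ring_map_cst]]
    by (simp add: plucker_rel_def subst_minor)
  also have "\<dots> = 0" by (simp add: plucker_rel_def algebra_simps)
  finally show "subst cst minor (plucker_rel (\<lambda>k l. sg k l * var {k, l}) a b c d) = 0" .
qed

lemma affine_coord_in_mon_ring:
  "kl \<in> pairs n \<Longrightarrow> affine_coord ij J kl \<in> carrier (mon_ring (pairs n - (J \<union> {ij})))"
  by (simp add: affine_coord_def mon_ring_zero_closed mon_ring_one_closed var_in_mon_ring)

lemma subst_plucker_ideal_in_mon_ring:
  "subst cst (affine_coord ij J) ` plucker_ideal n \<subseteq> carrier (mon_ring (pairs n - (J \<union> {ij})))"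
  using affine_coord_in_mon_ring by (auto simp: plucker_ideal_def intro!: subst_in_mon_ring)

lemma subst_plucker_rel:
  "subst cst (affine_coord ij J) (plucker_rel (\<lambda>k l. sg k l * var {k, l}) a b c d) =
    plucker_rel (\<lambda>k l. sg k l * affine_coord ij J {k, l}) a b c d"
  by (simp add: ring_map_plucker_rel ring_map_subst ring_map_cst ring_map_simps ring_map_sg subst_var)

text \<open>Expand \<open>(f + g)^m\<close>: the binomial coefficients have seminorm at most 1.\<close>

lemma seminorm_ultrametric:
  fixes \<Gamma> :: "'a::comm_ring_1 \<Rightarrow> real"
  assumes C: "\<And>f g. f \<in> C \<Longrightarrow> g \<in> C \<Longrightarrow> f + g \<in> C" "\<And>f g. f \<in> C \<Longrightarrow> g \<in> C \<Longrightarrow> f * g \<in> C"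
      "\<And>k. of_nat k \<in> C"
    and nonneg: "\<And>f. f \<in> C \<Longrightarrow> 0 \<le> \<Gamma> f"
    and mult: "\<And>f g. f \<in> C \<Longrightarrow> g \<in> C \<Longrightarrow> \<Gamma> (f * g) = \<Gamma> f * \<Gamma> g"
    and add: "\<And>f g. f \<in> C \<Longrightarrow> g \<in> C \<Longrightarrow> \<Gamma> (f + g) \<le> \<Gamma> f + \<Gamma> g"
    and nat: "\<And>k. \<Gamma> (of_nat k) \<le> 1" and zero: "\<Gamma> 0 = 0" and one: "\<Gamma> 1 = 1"
    and f: "f \<in> C" and g: "g \<in> C"
  shows "\<Gamma> (f + g) \<le> max (\<Gamma> f) (\<Gamma> g)"
proof (rule ccontr)
  define M where "M = max (\<Gamma> f) (\<Gamma> g)"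
  assume "\<not> \<Gamma> (f + g) \<le> max (\<Gamma> f) (\<Gamma> g)"
  then have gt: "M < \<Gamma> (f + g)" unfolding M_def by linarith
  have C1: "1 \<in> C" using C(3)[of 1] by simp
  have pow: "f ^ k \<in> C \<and> \<Gamma> (f ^ k) = \<Gamma> f ^ k" if "f \<in> C" for f k
    by (induction k) (simp_all add: C1 one that C mult)
  have sum: "sum h A \<in> C \<and> \<Gamma> (sum h A) \<le> (\<Sum>k\<in>A. \<Gamma> (h k))" if "finite A" "\<And>k. k \<in> A \<Longrightarrow> h k \<in> C"
    for h and A :: "nat set"
    using that
  proof (induction A rule: finite_induct)
    case empty
    show ?case using C(3)[of 0] zero by simp
  next
    case (insert k A)
    then have "h k \<in> C" "sum h A \<in> C" "\<Gamma> (sum h A) \<le> (\<Sum>k\<in>A. \<Gamma> (h k))" by auto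
    then show ?case using add[of "h k" "sum h A"] insert C(1) by simp
  qed
  have M0: "0 \<le> M" using nonneg[OF f] by (simp add: M_def)
  \<comment> \<open>Only the number of binomial terms, which is linear in \<open>m\<close>,
    separates the triangle inequality from the ultrametric one.\<close>
  have bound: "\<Gamma> (f + g) ^ m \<le> (real m + 1) * M ^ m" for m
  proof -
    let ?t = "\<lambda>k. of_nat (m choose k) * f ^ k * g ^ (m - k)"
    have t: "?t k \<in> C \<and> \<Gamma> (?t k) \<le> M ^ m" if "k \<le> m" for k
    proof -
      have 1: "f ^ k \<in> C" "g ^ (m - k) \<in> C" "of_nat (m choose k) * f ^ k \<in> C"
        using pow f g C by auto
      have "\<Gamma> (?t k) = \<Gamma> (of_nat (m choose k)) * (\<Gamma> f ^ k * \<Gamma> g ^ (m - k))"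
        using 1 C(3) pow f g by (simp add: mult)
      also have "\<dots> \<le> 1 * (M ^ k * M ^ (m - k))"
        using nat nonneg f g M0 C(3)
        by (intro mult_mono power_mono) (simp_all add: M_def)
      also have "\<dots> = M ^ m" using that by (simp flip: power_add)
      finally show ?thesis using C(2) 1 by simp
    qed
    have "\<Gamma> (f + g) ^ m = \<Gamma> (\<Sum>k\<le>m. ?t k)"
      using pow[OF C(1)[OF f g], of m] by (simp add: binomial_ring)
    also have "\<dots> \<le> (\<Sum>k\<le>m. \<Gamma> (?t k))" using sum[of "{..m}" ?t] t by auto
    also have "\<dots> \<le> (\<Sum>k\<le>m. M ^ m)" using t by (intro sum_mono) auto
    finally show ?thesis by (simp add: algebra_simps)
  qed
  have "M \<noteq> 0" using bound[of 1] gt by auto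
  then have Mp: "0 < M" using M0 by simp
  \<comment> \<open>Bernoulli's inequality for the square root of the ratio, squared afterwards,
    gives quadratic growth of the \<open>m\<close>-th power of the ratio. This beats the linear
    bound \<open>m + 1\<close>; Bernoulli for the ratio itself would give only linear
    growth.\<close>
  define s where "s = sqrt (\<Gamma> (f + g) / M)"
  define \<delta> where "\<delta> = s - 1"
  have "s > 1" using gt Mp by (simp add: s_def)
  then have \<delta>: "\<delta> > 0" by (simp add: \<delta>_def)
  have s2: "s ^ 2 = \<Gamma> (f + g) / M" using gt Mp by (simp add: s_def)
  \<comment> \<open>Chosen so that \<open>real m * \<delta> ^ 2 > 2\<close> and
    \<open>m > 1\<close>; then the left side exceeds \<open>2 * m\<close>, which is larger than
    \<open>m + 1\<close>.\<close>
  obtain m :: nat where m: "real m > 2 / \<delta> ^ 2 + 1"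
    using reals_Archimedean2 by blast
  have "0 \<le> 2 / \<delta> ^ 2" by simp
  then have m1: "real m > 1" using m by linarith
  have "real m * \<delta> \<le> s ^ m"
    using Bernoulli_inequality[of \<delta> m] \<delta> by (simp add: \<delta>_def)
  then have "(real m * \<delta>) ^ 2 \<le> (s ^ m) ^ 2" using \<delta> by (intro power_mono) auto
  also have "\<dots> = (s ^ 2) ^ m" by (simp add: power_mult[symmetric] mult.commute)
  also have "\<dots> \<le> real m + 1"
    using bound[of m] Mp by (simp add: s2 power_divide divide_le_eq)
  finally have "real m * (real m * \<delta> ^ 2) \<le> real m + 1" by (simp add: power2_eq_square mult_ac)
  moreover have "real m * \<delta> ^ 2 > 2"
  proof -
    have "2 / \<delta> ^ 2 < real m" using m by simp
    then show ?thesis using \<delta> by (simp add: divide_less_eq)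
  qed
  then have "real m * 2 < real m * (real m * \<delta> ^ 2)" using m1 by (intro mult_strict_left_mono) auto
  ultimately show False using m1 by linarith
qed

text \<open>Multiplicative notation for tropical coordinates: -\<infinity> becomes 0 and sums become
  products, so no arithmetic with infinite values is needed.\<close>

definition trop_exp :: "(nat set \<Rightarrow> ereal) \<Rightarrow> nat set \<Rightarrow> real" where
  "trop_exp x kl = (if x kl = -\<infinity> then 0 else exp (real_of_ereal (x kl)))"

text \<open>A tropical point records a multiplicative seminorm on a chart. The three-term relation
  is zero there, so by the ultrametric inequality none of its terms exceeds both others.\<close>

lemma TGr_plucker:
  fixes \<nu> :: "'k::field \<Rightarrow> real"
  assumes \<nu>: "complete_valuation \<nu>" and X: "X \<in> TGr \<nu> n" and x: "x \<in> X"
    and abcd: "{a, b, c, d} \<subseteq> {1..n}" "distinct [a, b, c, d]"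
  shows "trop_exp x {a, b} * trop_exp x {c, d} \<le>
    max (trop_exp x {a, c} * trop_exp x {b, d}) (trop_exp x {a, d} * trop_exp x {b, c})"
proof -
  interpret valued_field \<nu> using \<nu> by unfold_locales (simp add: complete_valuation_def)
  \<comment> \<open>The chart that witnesses membership of \<open>X\<close>; it may differ from the
    one in which the multiplicity is computed.\<close>
  obtain ij \<gamma> where ij: "ij \<in> pairs n" and \<gamma>: "\<gamma> \<in> chart_an \<nu> n ij" and xt: "x \<in> trop n ij \<gamma>"
    using X x by (auto simp: TGr_def)
  let ?R = "chart_poly_ring n ij :: ((nat set \<Rightarrow>\<^sub>0 nat) \<Rightarrow>\<^sub>0 'k) ring"
  let ?I = "chart_ideal n ij :: ((nat set \<Rightarrow>\<^sub>0 nat) \<Rightarrow>\<^sub>0 'k) set"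
  let ?pr = "chart_proj n ij :: ((nat set \<Rightarrow>\<^sub>0 nat) \<Rightarrow>\<^sub>0 'k) \<Rightarrow> _"
  have gens: "subst cst (affine_coord ij {}) ` plucker_ideal n \<subseteq> carrier ?R"
    using subst_plucker_ideal_in_mon_ring[of ij "{}" n] by (simp add: chart_poly_ring_def)
  interpret R: ring ?R unfolding chart_poly_ring_def by (rule ring_mon_ring)
  interpret I: ideal ?I ?R unfolding chart_ideal_def by (rule R.genideal_ideal[OF gens])
  define \<Gamma> where "\<Gamma> f = \<gamma> (?pr f)" for f
  note Rs = chart_poly_ring_def[where 'k = 'k, of n ij]
  have pr: "?pr \<in> ring_hom ?R (chart_ring n ij)"
    using I.rcos_ring_hom unfolding chart_proj_def chart_ring_def by simp
  have prC: "?pr f \<in> carrier (chart_ring n ij)" if "f \<in> carrier ?R" for f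
    using ring_hom_closed[OF pr that] .
  note \<gamma>' = \<gamma>[unfolded chart_an_def berkovich_def]
  have nonneg: "0 \<le> \<Gamma> f" if "f \<in> carrier ?R" for f
    using \<gamma>' prC[OF that] by (auto simp: \<Gamma>_def)
  have mult: "\<Gamma> (f * g) = \<Gamma> f * \<Gamma> g" if "f \<in> carrier ?R" "g \<in> carrier ?R" for f g
    using \<gamma>' prC that ring_hom_mult[OF pr that] by (simp add: \<Gamma>_def Rs)
  have add: "\<Gamma> (f + g) \<le> \<Gamma> f + \<Gamma> g" if "f \<in> carrier ?R" "g \<in> carrier ?R" for f g
    using \<gamma>' prC that ring_hom_add[OF pr that] by (simp add: \<Gamma>_def Rs)
  have cst: "\<Gamma> (cst c) = av c" for c using \<gamma>' by (simp add: \<Gamma>_def)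
  have one: "\<Gamma> 1 = 1" using cst[of 1] ring_map_simps(1)[OF ring_map_cst] by (metis av_one)
  have zero: "\<Gamma> 0 = 0" using cst[of 0] ring_map_simps(4)[OF ring_map_cst] by (metis av_zero)
  have nat: "\<Gamma> (of_nat k) \<le> 1" for k
    using cst[of "of_nat k"] av_of_nat_le[of k] by (simp add: cst_def)
  have ideal0: "\<Gamma> f = 0" if "f \<in> ?I" for f
  proof -
    have "?pr f = ?pr 0" unfolding chart_proj_def
      using R.a_rcos_zero[OF I.is_ideal] that additive_subgroup.zero_closed[OF I.additive_subgroup_axioms, unfolded Rs mon_ring_simps] by metis
    then show ?thesis using zero by (simp add: \<Gamma>_def)
  qed
  have natC: "of_nat k \<in> carrier ?R" for k
    using cst_in_mon_ring[of "of_nat k"] by (simp add: Rs cst_def)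
  \<comment> \<open>Points of the analytification are only required to satisfy the triangle
    inequality; the bound on integers in a non-Archimedean field upgrades it.\<close>
  have ultra: "\<Gamma> (f + g) \<le> max (\<Gamma> f) (\<Gamma> g)" if "f \<in> carrier ?R" "g \<in> carrier ?R" for f g
    by (rule seminorm_ultrametric[where C = "carrier ?R"])
      (use that nonneg mult add nat zero one natC in \<open>auto simp: Rs mon_ring_add_closed mon_ring_mult_closed\<close>)
  have uminus: "\<Gamma> (- f) = \<Gamma> f" if "f \<in> carrier ?R" for f
  proof -
    have "cst (- 1) \<in> carrier ?R" by (simp add: Rs cst_in_mon_ring)
    from mult[OF this that] show ?thesis
      using cst[of "- 1"] by (simp add: ring_map_simps[OF ring_map_cst])
  qed
  let ?A = "\<lambda>kl. affine_coord ij {} kl :: (nat set \<Rightarrow>\<^sub>0 nat) \<Rightarrow>\<^sub>0 'k"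
  define U where "U k l = (sg k l * ?A {k, l} :: (nat set \<Rightarrow>\<^sub>0 nat) \<Rightarrow>\<^sub>0 'k)" for k l
  have AC: "?A kl \<in> carrier ?R" if "kl \<in> pairs n" for kl
    using affine_coord_in_mon_ring[OF that, of ij "{}"] by (simp add: Rs)
  have UC: "U k l \<in> carrier ?R" if "{k, l} \<in> pairs n" for k l
    using mon_ring_mult_closed[OF sg_in_mon_ring AC[OF that, unfolded Rs]] by (simp add: U_def Rs)
  have GU: "\<Gamma> (U k l) = \<Gamma> (?A {k, l})" if "{k, l} \<in> pairs n" for k l
    using uminus[OF AC[OF that]] by (simp add: U_def sg_def)
  \<comment> \<open>A representative of the class differs from the chart values by one common
    positive factor.\<close>
  have N: "trop_exp x kl = exp (real_of_ereal (x ij)) * \<Gamma> (?A kl)" if kl: "kl \<in> pairs n" for kl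
  proof -
    have *: "x kl - x ij = elog (\<Gamma> (?A kl))" "x ij \<noteq> -\<infinity>" "x kl \<noteq> \<infinity>" "x ij \<noteq> \<infinity>"
      using xt kl ij by (auto simp: trop_def \<Gamma>_def PiE_def Pi_def)
    then obtain r where r: "x ij = ereal r" by (cases "x ij") auto
    have pos: "0 \<le> \<Gamma> (?A kl)" using nonneg[OF AC[OF kl]] .
    show ?thesis
    proof (cases "x kl")
      case (real q)
      then have e: "\<Gamma> (?A kl) \<noteq> 0" "q - r = ln (\<Gamma> (?A kl))" using * r by (auto simp: elog_def split: if_splits)
      then have "exp (q - r) = \<Gamma> (?A kl)" using pos by simp
      then show ?thesis using real r by (simp add: trop_exp_def flip: exp_add \<open>exp (q - r) = _\<close>)
    qed (use * r in \<open>auto simp: elog_def trop_exp_def split: if_splits\<close>)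
  qed
  have P: "{k, l} \<in> pairs n" if "k \<in> {a, b, c, d}" "l \<in> {a, b, c, d}" "k \<noteq> l" for k l
    using that abcd(1) by (intro pair_in_pairs) auto
  have Ps: "{a, b} \<in> pairs n" "{c, d} \<in> pairs n" "{a, c} \<in> pairs n" "{b, d} \<in> pairs n"
    "{a, d} \<in> pairs n" "{b, c} \<in> pairs n"
    by (rule P; use abcd(2) in simp)+
  note cl = UC[OF Ps(1)] UC[OF Ps(2)] UC[OF Ps(3)] UC[OF Ps(4)] UC[OF Ps(5)] UC[OF Ps(6)]
  have mC: "f * g \<in> carrier ?R" "f + g \<in> carrier ?R" "- f \<in> carrier ?R"
    if "f \<in> carrier ?R" "g \<in> carrier ?R" for f g
    using that by (simp_all add: Rs mon_ring_add_closed mon_ring_mult_closed mon_ring_uminus_closed)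
  have "plucker_rel U a b c d \<in> subst cst (affine_coord ij {}) ` plucker_ideal n"
    using imageI[OF plucker_rel_in_plucker_ideal[OF abcd], of "subst cst (affine_coord ij {})"]
    unfolding subst_plucker_rel U_def[abs_def] .
  then have "plucker_rel U a b c d \<in> ?I"
    using R.genideal_self[OF gens] unfolding chart_ideal_def by blast
  then have r0: "\<Gamma> (plucker_rel U a b c d) = 0" by (rule ideal0)
  let ?s = "- (U a c * U b d) + U a d * U b c"
  have sC: "?s \<in> carrier ?R" using cl by (intro mC) auto
  have "U a b * U c d = plucker_rel U a b c d + (- ?s)" by (simp add: plucker_rel_def)
  moreover have rC: "plucker_rel U a b c d \<in> carrier ?R"
    using \<open>plucker_rel U a b c d \<in> ?I\<close> I.Icarr by blast
  ultimately have "\<Gamma> (U a b * U c d) \<le> max 0 (\<Gamma> (- ?s))"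
    using ultra[OF rC, of "- ?s"] r0 mC(3)[OF sC sC] by simp
  also have "\<dots> = \<Gamma> ?s" using nonneg[OF sC] uminus[OF sC] by simp
  also have "\<dots> \<le> max (\<Gamma> (- (U a c * U b d))) (\<Gamma> (U a d * U b c))"
    using cl by (intro ultra mC) auto
  also have "\<Gamma> (- (U a c * U b d)) = \<Gamma> (U a c * U b d)" using cl by (intro uminus mC) auto
  finally have le: "\<Gamma> (?A {a, b}) * \<Gamma> (?A {c, d}) \<le>
      max (\<Gamma> (?A {a, c}) * \<Gamma> (?A {b, d})) (\<Gamma> (?A {a, d}) * \<Gamma> (?A {b, c}))"
    using cl by (simp add: mult GU Ps)
  \<comment> \<open>The relation is quadratic in the coordinates, so the common factor enters
    squared.\<close>
  define E where "E = exp (real_of_ereal (x ij)) ^ 2"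
  have "E * (\<Gamma> (?A {a, b}) * \<Gamma> (?A {c, d})) \<le>
      E * max (\<Gamma> (?A {a, c}) * \<Gamma> (?A {b, d})) (\<Gamma> (?A {a, d}) * \<Gamma> (?A {b, c}))"
    using le by (intro mult_left_mono) (simp_all add: E_def)
  then show ?thesis
    by (simp add: N Ps E_def max_mult_distrib_left power2_eq_square mult_ac)
qed

section \<open>Extension of scalars, and points of the variety given by 2 by n matrices\<close>

lemma ring_map_comp: "ring_map f \<Longrightarrow> ring_map g \<Longrightarrow> ring_map (\<lambda>a. g (f a))"
  by (simp add: ring_map_def)

text \<open>Applying \<open>\<iota>\<close> to coefficients is an instance of
  \<open>mon_eval\<close>, with every monomial sent to itself.\<close>

lemma ring_map_map:
  fixes \<iota> :: "'k::comm_ring_1 \<Rightarrow> 'l::comm_ring_1"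
  assumes "ring_map \<iota>"
  shows "ring_map (Poly_Mapping.map \<iota> :: (('v \<Rightarrow>\<^sub>0 int) \<Rightarrow>\<^sub>0 'k) \<Rightarrow> _)"
proof -
  note [simp] = ring_map_simps[OF assms] ring_map_simps[OF ring_map_cst]
  have "Poly_Mapping.map \<iota> f = mon_eval (\<lambda>a. cst (\<iota> a)) (\<lambda>\<alpha>. Poly_Mapping.single \<alpha> 1) f"
    for f :: "('v \<Rightarrow>\<^sub>0 int) \<Rightarrow>\<^sub>0 'k"
    by (rule poly_mapping_eqI)
      (auto simp: mon_eval_def lookup_sum cst_def mult_single lookup_single when_def map.rep_eq in_keys_iff)
  moreover have "ring_map (mon_eval (\<lambda>a. cst (\<iota> a)) (\<lambda>\<alpha>. Poly_Mapping.single \<alpha> 1 :: ('v \<Rightarrow>\<^sub>0 int) \<Rightarrow>\<^sub>0 'l))"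
    by (rule ring_map_mon_eval[OF ring_map_comp[OF assms ring_map_cst]]) (simp_all add: mult_single)
  ultimately show ?thesis by presburger
qed

lemma map_in_mon_ring:
  assumes "f \<in> carrier (mon_ring V)"
  shows "Poly_Mapping.map \<iota> f \<in> carrier (mon_ring V)"
proof -
  have "Poly_Mapping.keys (Poly_Mapping.map \<iota> f) \<subseteq> Poly_Mapping.keys f"
    by (auto simp: in_keys_iff map.rep_eq when_def split: if_splits)
  then show ?thesis using assms by (auto simp: mon_ring_def)
qed

lemma map_affine_coord:
  fixes \<iota> :: "'k::field \<Rightarrow> 'l::field"
  assumes "ring_map \<iota>"
  shows "Poly_Mapping.map \<iota> (affine_coord ij J kl :: (nat set \<Rightarrow>\<^sub>0 int) \<Rightarrow>\<^sub>0 'k) = affine_coord ij J kl"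
proof -
  have "ring_map (Poly_Mapping.map \<iota> :: ((nat set \<Rightarrow>\<^sub>0 int) \<Rightarrow>\<^sub>0 'k) \<Rightarrow> _)"
    by (rule ring_map_map[OF assms])
  from ring_map_simps(1,4)[OF this] show ?thesis
    by (simp add: affine_coord_def var_def ring_map_simps[OF assms])
qed

lemma mon_eval_map:
  assumes "ring_map \<iota>"
  shows "mon_eval id M (Poly_Mapping.map \<iota> f) = mon_eval \<iota> M f"
proof -
  note [simp] = ring_map_simps[OF assms]
  have "Poly_Mapping.keys (Poly_Mapping.map \<iota> f) \<subseteq> Poly_Mapping.keys f"
    by (auto simp: in_keys_iff map.rep_eq when_def split: if_splits)
  then have "mon_eval id M (Poly_Mapping.map \<iota> f) =
      (\<Sum>\<alpha>\<in>Poly_Mapping.keys f. id (Poly_Mapping.lookup (Poly_Mapping.map \<iota> f) \<alpha>) * M \<alpha>)"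
    by (intro mon_eval_superset) auto
  then show ?thesis by (simp add: mon_eval_def map.rep_eq in_keys_iff)
qed

lemma GrJ_ideal_subset: "GrJ_ideal n ij J \<subseteq> carrier (mon_ring (torus_indices n ij J))"
  by (auto simp: GrJ_ideal_def radical_def Let_def)

lemma extend_ideal_subset:
  assumes "I \<subseteq> carrier (mon_ring V)"
  shows "extend_ideal \<iota> V I \<subseteq> carrier (mon_ring V)"
proof -
  have "Poly_Mapping.map \<iota> ` I \<subseteq> carrier (mon_ring V)" using assms map_in_mon_ring by blast
  then interpret ideal "extend_ideal \<iota> V I" "mon_ring V"
    unfolding extend_ideal_def by (rule ring.genideal_ideal[OF ring_mon_ring])
  show ?thesis using Icarr by blast
qed

lemma ideal_eval_kernel:
  assumes "ring_map e"
  shows "ideal {g \<in> carrier (mon_ring V). e g = 0} (mon_ring V)"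
  by (rule ideal_mon_ringI)
    (auto simp: ring_map_simps[OF assms] mon_ring_zero_closed mon_ring_add_closed mon_ring_mult_closed)

text \<open>The numbers \<open>p k\<close> and \<open>q k\<close> are the rows of a matrix over L.
  If its minors are the prescribed coordinates, these define an L-point of the stratum, at which the
  whole extended ideal vanishes.\<close>

lemma eval_extended_GrJ_ideal:
  fixes \<iota> :: "'k::field \<Rightarrow> 'l::field"
  assumes \<iota>: "ring_map \<iota>" and s: "\<And>v. s v \<noteq> 0"
    and minors: "\<And>k l. k \<in> {1..n} \<Longrightarrow> l \<in> {1..n} \<Longrightarrow> k < l \<Longrightarrow> p k * q l - p l * q k =
      (if {k, l} \<in> J then 0 else if {k, l} = ij then 1 else s {k, l})"
    and f: "f \<in> extend_ideal \<iota> (torus_indices n ij J) (GrJ_ideal n ij J)"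
  shows "mon_eval id (lmon s) f = 0"
proof -
  let ?V = "torus_indices n ij J"
  let ?e = "mon_eval \<iota> (lmon s)"
  note V = torus_indices_def[of n ij J]
  have e: "ring_map ?e" by (intro ring_map_leval \<iota> s)
  have e': "ring_map (mon_eval id (lmon s))" by (intro ring_map_leval ring_map_id s)
  have gen: "?e (subst cst (affine_coord ij J) F) = 0" if F: "F \<in> plucker_ideal n" for F
  proof -
    define P where "P v = (if fst v = (1::nat) then p (snd v) else q (snd v))" for v :: "nat \<times> nat"
    have P: "ring_map (subst \<iota> P)" by (intro ring_map_subst \<iota>)
    have "?e (affine_coord ij J kl) = subst \<iota> P (minor kl)" if klp: "kl \<in> pairs n" for kl
    proof -
      obtain k l where kl: "kl = {k, l}" "k < l" "k \<in> {1..n}" "l \<in> {1..n}" using klp by (rule pairsE)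
      have "subst \<iota> P (minor kl) = p k * q l - p l * q k"
        using kl by (simp add: minor_def ring_map_simps[OF P] subst_var[OF \<iota>] P_def min_def max_def)
      also have "\<dots> = ?e (affine_coord ij J kl)"
        using minors[OF kl(3,4,2)] kl(1)
        by (simp add: affine_coord_def ring_map_simps[OF e] mon_eval_var ring_map_simps[OF \<iota>])
      finally show ?thesis ..
    qed
    \<comment> \<open>Substituting the minors of the numerical matrix is the same as first
      substituting the generic minors, which kills \<open>F\<close>, and then specialising the
      matrix entries.\<close>
    then have "?e (subst cst (affine_coord ij J) F) = subst \<iota> (\<lambda>kl. subst \<iota> P (minor kl)) F"
      using F unfolding ring_map_comp_subst[OF e]
      by (subst subst_cong[of F "pairs n"]) (auto simp: plucker_ideal_def mon_eval_cst ring_map_simps[OF \<iota>])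
    also have "\<dots> = subst \<iota> P (subst cst minor F)"
      unfolding ring_map_comp_subst[OF P]
      by (simp add: subst_eq_mon_eval cst_def mon_eval_single ring_map_simps[OF \<iota>] nmon_def)
    also have "\<dots> = 0" using F by (simp add: plucker_ideal_def ring_map_simps[OF P])
    finally show ?thesis .
  qed
  have *: "Idl\<^bsub>mon_ring ?V\<^esub> (subst cst (affine_coord ij J) ` plucker_ideal n) \<subseteq> {g \<in> carrier (mon_ring ?V). ?e g = 0}"
    using subst_plucker_ideal_in_mon_ring[of ij J n] gen
    by (intro ring.genideal_minimal[OF ring_mon_ring ideal_eval_kernel[OF e]]) (auto simp: V)
  \<comment> \<open>A field has no nilpotent elements, so vanishing passes from the ideal to its
    radical.\<close>
  have "?e g = 0" if "g \<in> GrJ_ideal n ij J" for g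
  proof -
    obtain m where "g ^ m \<in> Idl\<^bsub>mon_ring ?V\<^esub> (subst cst (affine_coord ij J) ` plucker_ideal n)"
      using \<open>g \<in> _\<close> by (auto simp: GrJ_ideal_def radical_def Let_def mon_ring_pow)
    then have "?e g ^ m = 0" using * ring_map_simps(7)[OF e, of g m] by auto
    then show ?thesis by simp
  qed
  then have "Poly_Mapping.map \<iota> ` GrJ_ideal n ij J \<subseteq> {g \<in> carrier (mon_ring ?V). mon_eval id (lmon s) g = 0}"
    using GrJ_ideal_subset[of n ij J] by (auto simp: mon_eval_map[OF \<iota>] intro!: map_in_mon_ring)
  then have "extend_ideal \<iota> ?V (GrJ_ideal n ij J) \<subseteq> {g \<in> carrier (mon_ring ?V). mon_eval id (lmon s) g = 0}"
    unfolding extend_ideal_def by (intro ring.genideal_minimal[OF ring_mon_ring ideal_eval_kernel[OF e']])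
  then show ?thesis using f by blast
qed

lemma plucker_rel_in_extended_GrJ_ideal:
  fixes \<iota> :: "'k::field \<Rightarrow> 'l::field"
  assumes \<iota>: "ring_map \<iota>" and abcd: "{a, b, c, d} \<subseteq> {1..n}" "distinct [a, b, c, d]"
  shows "plucker_rel (\<lambda>k l. sg k l * affine_coord ij J {k, l}) a b c d \<in>
    extend_ideal \<iota> (torus_indices n ij J) (GrJ_ideal n ij J)" (is "?f \<in> _")
proof -
  let ?R = "mon_ring (torus_indices n ij J) :: ((nat set \<Rightarrow>\<^sub>0 int) \<Rightarrow>\<^sub>0 'k) ring"
  let ?g = "plucker_rel (\<lambda>k l. sg k l * affine_coord ij J {k, l}) a b c d :: (nat set \<Rightarrow>\<^sub>0 int) \<Rightarrow>\<^sub>0 'k"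
  have gens: "subst cst (affine_coord ij J) ` plucker_ideal n \<subseteq> carrier ?R"
    using subst_plucker_ideal_in_mon_ring[of ij J n] by (simp add: torus_indices_def)
  have "?g \<in> subst cst (affine_coord ij J) ` plucker_ideal n"
    using imageI[OF plucker_rel_in_plucker_ideal[OF abcd], of "subst cst (affine_coord ij J)"]
    unfolding subst_plucker_rel .
  then have g: "?g \<in> Idl\<^bsub>?R\<^esub> (subst cst (affine_coord ij J) ` plucker_ideal n)" "?g \<in> carrier ?R"
    using ring.genideal_self[OF ring_mon_ring gens] gens by blast+
  then have "?g \<in> GrJ_ideal n ij J"
    unfolding GrJ_ideal_def Let_def radical_def
    by (intro CollectI conjI exI[of _ 1]) (simp_all add: mon_ring_pow)
  then have "Poly_Mapping.map \<iota> ?g \<in> extend_ideal \<iota> (torus_indices n ij J) (GrJ_ideal n ij J)"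
    unfolding extend_ideal_def using GrJ_ideal_subset[of n ij J]
    by (intro subsetD[OF ring.genideal_self[OF ring_mon_ring] imageI]) (auto intro: map_in_mon_ring)
  moreover have "Poly_Mapping.map \<iota> ?g = ?f"
    unfolding ring_map_plucker_rel[OF ring_map_map[OF \<iota>]]
    by (simp add: ring_map_simps[OF ring_map_map[OF \<iota>]] ring_map_sg[OF ring_map_map[OF \<iota>]] map_affine_coord[OF \<iota>])
  ultimately show ?thesis by simp
qed

section \<open>Primality of the initial ideal\<close>

text \<open>The value of \<open>affine_coord ij J\<close> at \<open>\<tau>\<close>. The point
  \<open>\<tau>\<close> need not satisfy the Pluecker relations; only its absolute values will be
  compatible with them.\<close>

definition torus_coord :: "nat set \<Rightarrow> nat set set \<Rightarrow> (nat set \<Rightarrow> 'a::field) \<Rightarrow> nat set \<Rightarrow> 'a" where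
  "torus_coord ij J \<tau> kl = (if kl \<in> J then 0 else if kl = ij then 1 else \<tau> kl)"

text \<open>Membership in the tropical Grassmannian enters only as \<open>plucker_ineq\<close>, an
  ultrametric condition on absolute values.\<close>

locale grassmann_degeneration = residue_field \<nu> res
  for \<nu> :: "'l::field \<Rightarrow> real" and res :: "'l \<Rightarrow> 'r::field" +
  fixes \<iota> :: "'k::field \<Rightarrow> 'l" and n i j :: nat and J :: "nat set set"
    and y :: "nat set \<Rightarrow> real" and \<tau> :: "nat set \<Rightarrow> 'l"
  assumes ring_map_\<iota>: "ring_map \<iota>"
    and infinite_residue: "infinite (UNIV :: 'r set)"
    and ij: "i \<in> {1..n}" "j \<in> {1..n}" "i < j" "{i, j} \<notin> J"
    and \<tau>0: "\<tau> v \<noteq> 0"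
    and \<tau>y: "v \<in> torus_indices n {i, j} J \<Longrightarrow> ln (absv \<nu> (\<tau> v)) = y v"
    and plucker_ineq: "{a, b, c, d} \<subseteq> {1..n} \<Longrightarrow> distinct [a, b, c, d] \<Longrightarrow>
      absv \<nu> (torus_coord {i, j} J \<tau> {a, b}) * absv \<nu> (torus_coord {i, j} J \<tau> {c, d}) \<le>
      max (absv \<nu> (torus_coord {i, j} J \<tau> {a, c}) * absv \<nu> (torus_coord {i, j} J \<tau> {b, d}))
          (absv \<nu> (torus_coord {i, j} J \<tau> {a, d}) * absv \<nu> (torus_coord {i, j} J \<tau> {b, c}))"
begin

abbreviation V where "V \<equiv> torus_indices n {i, j} J"

abbreviation "RV \<equiv> mon_ring V :: ((nat set \<Rightarrow>\<^sub>0 int) \<Rightarrow>\<^sub>0 'r) ring"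

sublocale degeneration \<nu> res V y \<tau> "extend_ideal \<iota> V (GrJ_ideal n {i, j} J)"
  by unfold_locales (simp_all add: \<tau>0 \<tau>y extend_ideal_subset GrJ_ideal_subset)

interpretation Q: ideal Q RV by (rule ideal_Q)

abbreviation T where "T \<equiv> torus_coord {i, j} J \<tau>"
abbreviation N where "N kl \<equiv> av (T kl)"

abbreviation coord :: "nat set \<Rightarrow> (nat set \<Rightarrow>\<^sub>0 int) \<Rightarrow>\<^sub>0 'a::field" where
  "coord \<equiv> affine_coord {i, j} J"

abbreviation U :: "nat \<Rightarrow> nat \<Rightarrow> (nat set \<Rightarrow>\<^sub>0 int) \<Rightarrow>\<^sub>0 'r" where
  "U k l \<equiv> sg k l * coord {k, l}"

lemma T_eq_0_iff: "T kl = 0 \<longleftrightarrow> kl \<in> J"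
  by (simp add: torus_coord_def \<tau>0)

lemma T_ij: "T {i, j} = 1"
  using ij by (simp add: torus_coord_def)

lemma U_swap: "k \<noteq> l \<Longrightarrow> U l k = - U k l"
  using sg_swap[of k l, where 'a = "(nat set \<Rightarrow>\<^sub>0 int) \<Rightarrow>\<^sub>0 'r"] by (simp add: insert_commute)

lemma U_ij: "U i j = 1"
  using ij by (simp add: sg_def affine_coord_def)

lemma U_in_J: "{k, l} \<in> J \<Longrightarrow> U k l = 0"
  by (simp add: affine_coord_def)

text \<open>A product of two coordinates is zero or a single monomial with coefficient 1, so its
  initial form is the residue of the rescaled value times the product itself.\<close>

lemma coord_mult:
  assumes "av (c * (T e * T f)) \<le> 1"
  shows "integral c (coord e * coord f)"
    "In c (coord e * coord f) = cst (res (c * (T e * T f))) * (coord e * coord f)"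
proof -
  define \<delta> where "\<delta> e = (if e = {i, j} then 0 else Poly_Mapping.single e 1 :: nat set \<Rightarrow>\<^sub>0 int)" for e
  have c: "coord e = (if e \<in> J then 0 else Poly_Mapping.single (\<delta> e) 1)" for e
    by (simp add: affine_coord_def \<delta>_def var_def)
  have T: "lmon \<tau> (\<delta> e) = T e" if "e \<notin> J" for e
    using that by (simp add: \<delta>_def torus_coord_def)
  show "integral c (coord e * coord f)"
    "In c (coord e * coord f) = cst (res (c * (T e * T f))) * (coord e * coord f)"
    using assms by (simp_all add: c integral_zero In_zero mult_single integral_single In_single lmon_add \<tau>0 T cst_def)
qed

lemma In_sg_mult:
  assumes "integral c t"
  shows "integral c (sg k l * sg k' l' * t)" "In c (sg k l * sg k' l' * t) = sg k l * sg k' l' * In c t"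
  using assms by (simp_all add: sg_def integral_uminus In_uminus)

text \<open>When the first term is dominant, it survives in the initial form with coefficient 1. The
  constants \<open>c1\<close> and \<open>c2\<close> are residues and may be zero.\<close>

lemma plucker_rel_in_Q:
  assumes abcd: "{a, b, c, d} \<subseteq> {1..n}" "distinct [a, b, c, d]"
    and nz: "{a, b} \<notin> J" "{c, d} \<notin> J"
    and le: "N {a, c} * N {b, d} \<le> N {a, b} * N {c, d}" "N {a, d} * N {b, c} \<le> N {a, b} * N {c, d}"
  obtains c1 c2 where "U a b * U c d - cst c1 * (U a c * U b d) + cst c2 * (U a d * U b c) \<in> Q"
proof -
  \<comment> \<open>Rescaling by the inverse of the dominant term makes the whole relation
    integral.\<close>
  define r where "r = inverse (T {a, b} * T {c, d})"
  have pos: "0 < N {a, b} * N {c, d}" using nz by (simp add: T_eq_0_iff)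
  have 1: "r * (T {a, b} * T {c, d}) = 1"
    using nz unfolding r_def by (intro left_inverse) (simp add: T_eq_0_iff)
  have 2: "av (r * (T {a, c} * T {b, d})) \<le> 1" and 3: "av (r * (T {a, d} * T {b, c})) \<le> 1"
  proof -
    have *: "av (r * z) = av z / (N {a, b} * N {c, d})" for z
      by (simp add: r_def av_mult av_inverse divide_inverse)
    show "av (r * (T {a, c} * T {b, d})) \<le> 1" "av (r * (T {a, d} * T {b, c})) \<le> 1"
      using le pos unfolding * by (simp_all add: divide_le_eq_1 av_mult del: av_pos_iff)
  qed
  let ?m = "\<lambda>k l k' l'. sg k l * sg k' l' * (coord {k, l} * coord {k', l'}) :: (nat set \<Rightarrow>\<^sub>0 int) \<Rightarrow>\<^sub>0 'l"
  have int: "integral r (?m a b c d)" "integral r (?m a c b d)" "integral r (?m a d b c)"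
    using coord_mult(1)[OF 2] coord_mult(1)[OF 3] coord_mult(1)[of r "{a, b}" "{c, d}"] 1
    by (simp_all add: In_sg_mult)
  have f: "plucker_rel (\<lambda>k l. sg k l * coord {k, l}) a b c d = ?m a b c d + (- ?m a c b d) + ?m a d b c"
    by (simp add: plucker_rel_def mult_ac)
  note int' = integral_add[OF integral_add[OF int(1) integral_uminus[OF int(2)]] int(3)]
  have "In r (?m a b c d + (- ?m a c b d) + ?m a d b c) \<in> Q"
    using plucker_rel_in_extended_GrJ_ideal[OF ring_map_\<iota> abcd, of "{i, j}" J] int'
    unfolding f by (rule In_in_Q)
  moreover have "In r (?m a b c d + (- ?m a c b d) + ?m a d b c) =
      In r (?m a b c d) - In r (?m a c b d) + In r (?m a d b c)"
    unfolding In_add[OF integral_add[OF int(1) integral_uminus[OF int(2)]] int(3)]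
      In_add[OF int(1) integral_uminus[OF int(2)]] In_uminus[OF int(2)] by simp
  moreover have "In r (?m a b c d) = U a b * U c d"
    using coord_mult[of r "{a, b}" "{c, d}"] 1
    by (subst In_sg_mult(2)) (simp_all add: ring_map_simps[OF ring_map_cst] mult_ac)
  moreover have "In r (?m a c b d) = cst (res (r * (T {a, c} * T {b, d}))) * (U a c * U b d)"
    using coord_mult[OF 2] by (subst In_sg_mult(2)) (simp_all add: mult_ac)
  moreover have "In r (?m a d b c) = cst (res (r * (T {a, d} * T {b, c}))) * (U a d * U b c)"
    using coord_mult[OF 3] by (subst In_sg_mult(2)) (simp_all add: mult_ac)
  ultimately show ?thesis using that by metis
qed

text \<open>The subring of \<open>RV\<close> whose image modulo \<open>Q\<close> comes from Laurent
  polynomials in the coordinates \<open>B\<close>.\<close>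

definition spanned :: "nat set set \<Rightarrow> ((nat set \<Rightarrow>\<^sub>0 int) \<Rightarrow>\<^sub>0 'r) set" where
  "spanned B = {g \<in> carrier RV. \<exists>h\<in>carrier (mon_ring B). g - h \<in> Q}"

lemma Q_zero: "0 \<in> Q"
  using additive_subgroup.zero_closed[OF Q.additive_subgroup_axioms] by simp

lemma Q_add: "f \<in> Q \<Longrightarrow> g \<in> Q \<Longrightarrow> f + g \<in> Q"
  using additive_subgroup.a_closed[OF Q.additive_subgroup_axioms] by simp

lemma Q_mult: "f \<in> Q \<Longrightarrow> g \<in> carrier RV \<Longrightarrow> g * f \<in> Q"
  using Q.I_l_closed by simp

lemma spanned_base: "B \<subseteq> V \<Longrightarrow> h \<in> carrier (mon_ring B) \<Longrightarrow> h \<in> spanned B"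
  unfolding spanned_def using mon_ring_mono[of h B V] Q_zero by (auto intro!: bexI[of _ h])

lemma spanned_mono: "B \<subseteq> B' \<Longrightarrow> g \<in> spanned B \<Longrightarrow> g \<in> spanned B'"
  unfolding spanned_def by (auto intro: mon_ring_mono)

lemma spanned_add:
  assumes "f \<in> spanned B" "g \<in> spanned B"
  shows "f + g \<in> spanned B"
proof -
  from assms obtain f' g' where h: "f' \<in> carrier (mon_ring B)" "f - f' \<in> Q" "g' \<in> carrier (mon_ring B)"
    "g - g' \<in> Q" "f \<in> carrier RV" "g \<in> carrier RV" unfolding spanned_def by blast
  have "f + g - (f' + g') = (f - f') + (g - g')" by simp
  then have "f + g - (f' + g') \<in> Q" using Q_add[OF h(2,4)] by (simp only:)
  then show ?thesis unfolding spanned_def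
    using mon_ring_add_closed[OF h(1,3)] mon_ring_add_closed[OF h(5,6)] by blast
qed

lemma spanned_mult:
  assumes B: "B \<subseteq> V" and "f \<in> spanned B" "g \<in> spanned B"
  shows "f * g \<in> spanned B"
proof -
  from assms obtain f' g' where h: "f' \<in> carrier (mon_ring B)" "f - f' \<in> Q" "g' \<in> carrier (mon_ring B)"
    "g - g' \<in> Q" "f \<in> carrier RV" "g \<in> carrier RV" unfolding spanned_def by blast
  have "f * g - f' * g' = f * (g - g') + g' * (f - f')" by (simp add: algebra_simps)
  then have "f * g - f' * g' \<in> Q"
    using Q_add[OF Q_mult[OF h(4,5)] Q_mult[OF h(2) mon_ring_mono[OF h(3) B]]] by simp
  then show ?thesis unfolding spanned_def
    using mon_ring_mult_closed[OF h(1,3)] mon_ring_mult_closed[OF h(5,6)] by blast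
qed

lemma spanned_cong:
  assumes "g \<in> spanned B" "f - g \<in> Q"
  shows "f \<in> spanned B"
proof -
  from assms obtain g' where h: "g' \<in> carrier (mon_ring B)" "g - g' \<in> Q" "g \<in> carrier RV"
    unfolding spanned_def by blast
  have "f - g' = (f - g) + (g - g')" by simp
  then have "f - g' \<in> Q" using Q_add[OF assms(2) h(2)] by simp
  moreover have "f = (f - g) + g" by simp
  then have "f \<in> carrier RV" using mon_ring_add_closed[OF Q.Icarr[OF assms(2)] h(3)] by simp
  ultimately show ?thesis unfolding spanned_def using h(1) by blast
qed

lemma spanned_sg: "B \<subseteq> V \<Longrightarrow> sg k l \<in> spanned B"
  by (rule spanned_base[OF _ sg_in_mon_ring])

lemma spanned_cst: "B \<subseteq> V \<Longrightarrow> cst c \<in> spanned B"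
  by (rule spanned_base[OF _ cst_in_mon_ring])

lemma spanned_zero: "B \<subseteq> V \<Longrightarrow> 0 \<in> spanned B"
  by (rule spanned_base[OF _ mon_ring_zero_closed])

lemma U_in_mon_ring: "{k, l} \<in> B \<or> {k, l} \<in> J \<or> {k, l} = {i, j} \<Longrightarrow> U k l \<in> carrier (mon_ring B)"
  by (intro mon_ring_mult_closed sg_in_mon_ring)
    (auto simp: affine_coord_def mon_ring_zero_closed mon_ring_one_closed var_in_mon_ring)

lemma U_in_spanned: "B \<subseteq> V \<Longrightarrow> {k, l} \<in> B \<or> {k, l} \<in> J \<or> {k, l} = {i, j} \<Longrightarrow> U k l \<in> spanned B"
  by (rule spanned_base[OF _ U_in_mon_ring])

lemma spanned_uminus: "B \<subseteq> V \<Longrightarrow> g \<in> spanned B \<Longrightarrow> - g \<in> spanned B"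
  using spanned_mult[OF _ spanned_cst[of B "- 1"], of g] by (simp add: ring_map_simps[OF ring_map_cst])

text \<open>Coordinates in \<open>B\<close> are invertible inside \<open>spanned B\<close>; other
  coordinates are in general invertible only in \<open>RV\<close>.\<close>

lemma U_inverse:
  assumes "B \<subseteq> V" "{k, l} \<in> B \<or> {k, l} = {i, j}"
  obtains X where "X \<in> spanned B" "U k l * X = 1"
proof (cases "{k, l} = {i, j}")
  case True
  have "U k l * sg k l = 1" using True ij sg_square[of k l] by (simp add: affine_coord_def sg_def)
  then show ?thesis using that spanned_sg assms by blast
next
  case False
  let ?X = "Poly_Mapping.single (Poly_Mapping.single {k, l} (- 1)) 1 :: (nat set \<Rightarrow>\<^sub>0 int) \<Rightarrow>\<^sub>0 'r"
  have "{k, l} \<in> B" "{k, l} \<notin> J" using False assms by (auto simp: torus_indices_def)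
  then have X: "?X \<in> spanned B" "coord {k, l} * ?X = 1" using assms(1) False
    by (auto simp: affine_coord_def var_def mult_single simp flip: single_add intro!: spanned_base single_in_mon_ring)
  have "U k l * (sg k l * ?X) = (sg k l * sg k l) * (coord {k, l} * ?X)" by (simp only: mult_ac)
  also have "\<dots> = 1" by (simp add: sg_square X)
  finally show ?thesis using that[of "sg k l * ?X"] spanned_mult[OF assms(1) spanned_sg[OF assms(1)] X(1)] by blast
qed

text \<open>The columns in \<open>infinite_pts\<close> are the nonzero multiples of column \<open>j\<close> (with \<open>t = \<infinity>\<close>); columns
  other than \<open>j\<close> in neither set are zero.\<close>

definition finite_pts :: "nat set" where "finite_pts = {k \<in> {1..n} - {j}. {k, j} \<notin> J}"
definition infinite_pts :: "nat set" where "infinite_pts = {l \<in> {1..n} - {j}. {l, j} \<in> J \<and> {i, l} \<notin> J}"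
text \<open>The free column scalars: up to sign, \<open>p\<^sub>k\<^sub>j\<close> is the scalar of a
  finite column and \<open>p\<^sub>i\<^sub>l\<close> that of an infinite column. The scalar of
  column \<open>i\<close> is fixed by \<open>p\<^sub>i\<^sub>j = 1\<close>.\<close>

definition base_coords :: "nat set set" where "base_coords = (\<lambda>k. {k, j}) ` (finite_pts - {i}) \<union> (\<lambda>l. {i, l}) ` infinite_pts"

text \<open>With columns normalised to \<open>(a\<^sub>k, a\<^sub>k t\<^sub>k)\<close> for \<open>k \<in> finite_pts\<close>, the number \<open>N\<^sub>m\<^sub>s / N\<^sub>s\<^sub>j\<close> is
  proportional to the distance of \<open>t\<^sub>m\<close> from \<open>t\<^sub>s\<close>. Each new point \<open>m\<close> is attached to a nearest
  point \<open>s\<close> among the previous ones, and the coordinate \<open>ms\<close> is taken as a free variable.\<close>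

inductive attached :: "nat set \<Rightarrow> nat set set \<Rightarrow> bool" where
  start: "attached {i} base_coords"
| step: "attached S B \<Longrightarrow> m \<in> finite_pts - S \<Longrightarrow> s \<in> S \<Longrightarrow>
    (\<And>l. l \<in> S \<Longrightarrow> N {m, s} * N {l, j} \<le> N {m, l} * N {s, j}) \<Longrightarrow>
    attached (insert m S) (B \<union> ({{m, s}} - J))"

section \<open>Nearest-neighbour attachment and reduction to free coordinates\<close>

lemma i_in_finite_pts: "i \<in> finite_pts"
  using ij by (auto simp: finite_pts_def)

lemma finite_pts_props: "k \<in> finite_pts \<Longrightarrow> k \<in> {1..n} \<and> k \<noteq> j \<and> {k, j} \<notin> J \<and> N {k, j} > 0"
  by (auto simp: finite_pts_def T_eq_0_iff)

lemma finite_pts_pair_ne: "k \<in> finite_pts \<Longrightarrow> l \<in> finite_pts \<Longrightarrow> {k, l} \<noteq> {i, j}"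
  by (auto simp: finite_pts_def doubleton_eq_iff)

lemma infinite_pts_props: "l \<in> infinite_pts \<Longrightarrow> l \<in> {1..n} \<and> l \<noteq> j \<and> l \<noteq> i \<and> l \<notin> finite_pts \<and> {l, j} \<in> J \<and> {i, l} \<notin> J"
  using ij by (auto simp: infinite_pts_def finite_pts_def)

lemma base_coords_subset: "base_coords \<subseteq> V"
proof -
  have "{k, j} \<in> V" if "k \<in> finite_pts - {i}" for k
    using that finite_pts_props[of k] ij pair_in_pairs[of k n j] by (auto simp: torus_indices_def doubleton_eq_iff)
  moreover have "{i, l} \<in> V" if "l \<in> infinite_pts" for l
    using that infinite_pts_props[of l] ij pair_in_pairs[of i n l] by (auto simp: torus_indices_def doubleton_eq_iff)
  ultimately show ?thesis by (auto simp: base_coords_def)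
qed

lemma finite_finite_pts: "finite finite_pts" by (simp add: finite_pts_def)

lemma finite_base_coords: "finite base_coords" by (simp add: base_coords_def finite_pts_def infinite_pts_def)

lemma attached_props:
  assumes "attached S B"
  shows "i \<in> S \<and> S \<subseteq> finite_pts \<and> base_coords \<subseteq> B \<and> finite S \<and> finite B \<and> B \<subseteq> V \<and>
    (\<forall>e\<in>B. e \<in> base_coords \<or> (\<exists>k\<in>S. \<exists>l\<in>S. e = {k, l}))"
  using assms
proof (induction rule: attached.induct)
  case start
  then show ?case using i_in_finite_pts finite_base_coords base_coords_subset by auto
next
  case (step S B m s)
  then have ms: "m \<in> finite_pts" "s \<in> finite_pts" "m \<noteq> s" by auto
  then have "{m, s} \<in> V" if "{m, s} \<notin> J"
    using that finite_pts_props[of m] finite_pts_props[of s] finite_pts_pair_ne[of m s] pair_in_pairs[of m n s]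
    by (auto simp: torus_indices_def)
  moreover have "\<forall>e\<in>B \<union> ({{m, s}} - J). e \<in> base_coords \<or> (\<exists>k\<in>insert m S. \<exists>l\<in>insert m S. e = {k, l})"
  proof
    fix e assume "e \<in> B \<union> ({{m, s}} - J)"
    then consider "e \<in> B" | "e = {m, s}" by blast
    then show "e \<in> base_coords \<or> (\<exists>k\<in>insert m S. \<exists>l\<in>insert m S. e = {k, l})"
    proof cases
      case 1 then show ?thesis using step.IH by blast
    next
      case 2 then show ?thesis using step.hyps(3) by blast
    qed
  qed
  ultimately show ?case using step by auto
qed

lemma exists_attached: "\<exists>B. attached finite_pts B"
proof -
  have "\<exists>B. attached (insert i F) B" if "finite F" "F \<subseteq> finite_pts - {i}" for F
    using that
  proof (induction F rule: finite_induct)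
    case empty
    then show ?case using attached.start by blast
  next
    case (insert m F)
    then obtain B where B: "attached (insert i F) B" by auto
    let ?S = "insert i F"
    \<comment> \<open>Proportional to the distance from \<open>m\<close> to \<open>s\<close>; a
      minimum over the finitely many earlier points is the required neighbour.\<close>
    let ?f = "\<lambda>s. N {m, s} / N {s, j}"
    have "Min (?f ` ?S) \<in> ?f ` ?S" using insert.hyps by (intro Min_in) auto
    then obtain s where s: "Min (?f ` ?S) = ?f s" "s \<in> ?S" by (rule imageE)
    have SA: "?S \<subseteq> finite_pts" using insert.prems i_in_finite_pts by auto
    have "N {m, s} * N {l, j} \<le> N {m, l} * N {s, j}" if "l \<in> ?S" for l
    proof -
      have "?f s \<le> ?f l" unfolding s(1)[symmetric] using insert.hyps that by (intro Min_le) auto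
      moreover have "0 < N {s, j}" "0 < N {l, j}" using finite_pts_props SA s that by blast+
      ultimately show ?thesis by (simp add: field_simps)
    qed
    from attached.step[OF B _ s(2) this] have "attached (insert m ?S) (B \<union> ({{m, s}} - J))"
      using insert by auto
    then show ?case by (metis insert_commute)
  qed
  from this[of "finite_pts - {i}"] show ?thesis using finite_finite_pts i_in_finite_pts by (simp add: insert_absorb)
qed

text \<open>In terms of distances: if \<open>s\<close> is at least as near to \<open>m\<close> as
  \<open>l\<close> is, then the distance from \<open>l\<close> to \<open>s\<close> is at most that
  from \<open>m\<close> to \<open>l\<close>, and the latter is at most the larger of the other two
  sides. Multiplying by the column scalars turns each into a Pluecker inequality.\<close>

lemma step_ineqs:
  assumes "S \<subseteq> finite_pts" "m \<in> finite_pts - S" "s \<in> S" "l \<in> S" "l \<noteq> s"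
    "N {m, s} * N {l, j} \<le> N {m, l} * N {s, j}"
  shows "N {m, j} * N {l, s} \<le> N {m, l} * N {s, j}"
    "N {m, l} * N {s, j} \<le> max (N {m, s} * N {l, j}) (N {m, j} * N {l, s})"
    "{m, l, s, j} \<subseteq> {1..n}" "distinct [m, l, s, j]"
proof -
  have m: "m \<in> finite_pts" "s \<in> finite_pts" "l \<in> finite_pts" using assms by auto
  show d: "{m, l, s, j} \<subseteq> {1..n}" "distinct [m, l, s, j]"
    using finite_pts_props[OF m(1)] finite_pts_props[OF m(2)] finite_pts_props[OF m(3)] assms ij by auto
  show "N {m, l} * N {s, j} \<le> max (N {m, s} * N {l, j}) (N {m, j} * N {l, s})"
    using plucker_ineq[OF d] .
  have "{m, j, l, s} \<subseteq> {1..n}" "distinct [m, j, l, s]" using d by auto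
  from plucker_ineq[OF this] show "N {m, j} * N {l, s} \<le> N {m, l} * N {s, j}"
    using assms(6) by (simp add: insert_commute)
qed

text \<open>In the relation for \<open>m, l, s, j\<close> the product \<open>U m l * U s j\<close>
  is dominant and \<open>U s j\<close> is invertible over \<open>B\<close>. All other coordinates in
  it are free, zero, or handled by induction, so the relation can be solved for
  \<open>U m l\<close>.\<close>

lemma U_spanned:
  assumes "attached S B"
  shows "k \<in> S \<Longrightarrow> l \<in> S \<Longrightarrow> k \<noteq> l \<Longrightarrow> U k l \<in> spanned B"
  using assms
proof (induction arbitrary: k l rule: attached.induct)
  case start
  then show ?case by auto
next
  case (step S B m s)
  note p = attached_props[OF step.hyps(1)]
  let ?B = "B \<union> ({{m, s}} - J)"
  have BV: "?B \<subseteq> V" using attached_props[OF attached.step[OF step.hyps]] by blast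
  have ml: "U m l \<in> spanned ?B" if l: "l \<in> S" for l
  proof (cases "l = s \<or> {m, l} \<in> J")
    case True
    then show ?thesis using U_in_spanned[OF BV, of m l] by blast
  next
    case False
    then have ls: "l \<noteq> s" by simp
    note st = step_ineqs[OF _ step.hyps(2,3) l ls step.hyps(4)[OF l]]
    have SA: "S \<subseteq> finite_pts" using p by blast
    have sA: "s \<in> finite_pts" "l \<in> finite_pts" "m \<in> finite_pts" using SA step.hyps l by auto
    have nz: "{m, l} \<notin> J" "{s, j} \<notin> J" using False finite_pts_props sA by auto
    obtain c1 c2 where rel: "U m l * U s j - cst c1 * (U m s * U l j) + cst c2 * (U m j * U l s) \<in> Q"
      using plucker_rel_in_Q[OF st(3,4)[OF SA] nz step.hyps(4)[OF l] st(1)[OF SA]] by blast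
    have jB: "{k, j} \<in> ?B \<or> {k, j} = {i, j}" if "k \<in> finite_pts" for k
      using that p by (cases "k = i") (auto simp: base_coords_def)
    obtain X where X: "X \<in> spanned ?B" "U s j * X = 1" using U_inverse[OF BV jB[OF sA(1)]] by blast
    let ?Y = "cst c1 * (U m s * U l j) + - (cst c2 * (U m j * U l s))"
    have g1: "U l s \<in> spanned ?B" by (rule spanned_mono[OF Un_upper1 step.IH[OF l step.hyps(3) ls]])
    have g2: "U m s \<in> spanned ?B" using U_in_spanned[OF BV, of m s] by blast
    have g3: "U k j \<in> spanned ?B" if "k \<in> finite_pts" for k using U_in_spanned[OF BV, of k j] jB[OF that] by blast
    have Y: "X * ?Y \<in> spanned ?B"
      by (rule spanned_mult[OF BV X(1) spanned_add[OF spanned_mult[OF BV spanned_cst[OF BV] spanned_mult[OF BV g2 g3[OF sA(2)]]]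
            spanned_uminus[OF BV spanned_mult[OF BV spanned_cst[OF BV] spanned_mult[OF BV g3[OF sA(3)] g1]]]]])
    have "X \<in> carrier RV" using X(1) by (simp add: spanned_def)
    then have "X * (U m l * U s j - cst c1 * (U m s * U l j) + cst c2 * (U m j * U l s)) \<in> Q"
      using Q_mult[OF rel] by blast
    moreover have "X * (U m l * U s j - cst c1 * (U m s * U l j) + cst c2 * (U m j * U l s)) =
        U m l * (U s j * X) - X * ?Y"
      by (simp add: ring_distribs mult_ac)
    ultimately have "U m l - X * ?Y \<in> Q" using X(2) by simp
    then show ?thesis by (rule spanned_cong[OF Y])
  qed
  consider "k = m" "l \<in> S" | "l = m" "k \<in> S" | "k \<in> S" "l \<in> S" using step.prems by blast
  then show ?case
  proof cases
    case 1 then show ?thesis using ml by simp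
  next
    case 2
    then have "U k l = - U m k" using step.prems(3) U_swap[of m k] by (simp only:)
    then show ?thesis using spanned_uminus[OF BV ml[OF 2(2)]] by (simp only:)
  next
    case 3
    then show ?thesis by (intro spanned_mono[OF Un_upper1 step.IH] step.prems)
  qed
qed

text \<open>For a column with \<open>p\<^sub>l\<^sub>j = 0\<close> the relation for
  \<open>k, l, i, j\<close> has only two terms left. Two instances of the inequality, one for each
  direction, give equality.\<close>

lemma infinite_pts_rel:
  assumes k: "k \<in> finite_pts" "k \<noteq> i" and l: "l \<in> {1..n}" "l \<noteq> j" "l \<notin> finite_pts"
  shows "N {k, l} = N {k, j} * N {i, l}" "{k, l, i, j} \<subseteq> {1..n}" "distinct [k, l, i, j]" "{l, j} \<in> J"
proof -
  have "l \<noteq> i" using l i_in_finite_pts by auto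
  show d: "{k, l, i, j} \<subseteq> {1..n}" "distinct [k, l, i, j]"
    using finite_pts_props[OF k(1)] k l ij \<open>l \<noteq> i\<close> by auto
  show J: "{l, j} \<in> J" using l by (auto simp: finite_pts_def)
  then have 0: "N {l, j} = 0" "N {j, l} = 0" by (simp_all add: T_eq_0_iff insert_commute)
  have "N {k, l} * N {i, j} \<le> max (N {k, i} * N {l, j}) (N {k, j} * N {l, i})"
    by (rule plucker_ineq[OF d])
  moreover have "N {k, j} * N {l, i} \<le> max (N {k, l} * N {j, i}) (N {k, i} * N {j, l})"
    by (rule plucker_ineq) (use d in auto)
  ultimately show "N {k, l} = N {k, j} * N {i, l}"
    using 0 T_ij mult_nonneg_nonneg[OF av_nonneg[of "T {k, j}"] av_nonneg[of "T {i, l}"]]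
      av_nonneg[of "T {k, l}"]
    unfolding insert_commute[of l i "{}"] insert_commute[of j i "{}"] by simp
qed

text \<open>Both columns are multiples of column \<open>j\<close>, hence proportional to each
  other.\<close>

lemma neither_finite_pts_in_J:
  assumes "k \<in> {1..n}" "l \<in> {1..n}" "k \<noteq> l" "k \<notin> finite_pts" "l \<notin> finite_pts"
  shows "{k, l} \<in> J"
proof (cases "k = j \<or> l = j")
  case True
  then show ?thesis using assms by (auto simp: finite_pts_def insert_commute)
next
  case False
  then have J: "{k, j} \<in> J" "{l, j} \<in> J" using assms by (auto simp: finite_pts_def)
  have "k \<noteq> i" "l \<noteq> i" using assms i_in_finite_pts by auto
  then have "N {k, l} * N {i, j} \<le> max (N {k, i} * N {l, j}) (N {k, j} * N {l, i})"
    using False assms ij by (intro plucker_ineq) auto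
  moreover have "T {k, j} = 0" "T {l, j} = 0" using J by (simp_all add: T_eq_0_iff)
  ultimately have "N {k, l} \<le> 0" using T_ij by simp
  then have "N {k, l} = 0" by (intro antisym) simp_all
  then show ?thesis by (simp add: T_eq_0_iff)
qed

text \<open>A nonvanishing coordinate involves at least one finite column. The remaining case pairs
  it with an infinite column, where the two-term relation expresses it by the column
  scalars.\<close>

lemma var_spanned:
  assumes B: "attached finite_pts B" and e: "e \<in> V"
  shows "var e \<in> spanned B"
proof -
  note p = attached_props[OF B]
  have BV: "B \<subseteq> V" using p by blast
  have eJ: "e \<notin> J" "e \<noteq> {i, j}" "e \<in> pairs n" using e by (auto simp: torus_indices_def)
  obtain k l where kl: "e = {k, l}" "k < l" "k \<in> {1..n}" "l \<in> {1..n}" using eJ(3) by (rule pairsE)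
  have main: "U k l \<in> spanned B" if h: "e = {k, l}" "k \<noteq> l" "k \<in> {1..n}" "l \<in> {1..n}" "k \<in> finite_pts" for k l
  proof -
    consider "l = j" | "l \<in> finite_pts" | "k = i" "l \<in> infinite_pts" | "k \<noteq> i" "l \<noteq> j" "l \<notin> finite_pts"
      using h(2-5) eJ(1)[unfolded h(1)] by (auto simp: finite_pts_def infinite_pts_def)
    then show ?thesis
    proof cases
      case 1
      then have "{k, l} \<in> B" using h eJ p by (auto simp: base_coords_def)
      then show ?thesis using U_in_spanned[OF BV, of k l] by blast
    next
      case 2
      then show ?thesis using U_spanned[OF B] h by blast
    next
      case 3
      then have "{k, l} \<in> B" using p by (auto simp: base_coords_def)
      then show ?thesis using U_in_spanned[OF BV, of k l] by blast
    next
      case 4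
      note r = infinite_pts_rel[OF h(5) 4(1) h(4) 4(2,3)]
      have N: "N {k, l} = N {k, j} * N {l, i}" "N {l, j} = 0"
        using r(1,4) by (simp_all add: insert_commute T_eq_0_iff)
      \<comment> \<open>Zero columns are excluded here: by the product formula they would make the
        coordinate \<open>{k, l}\<close> vanish.\<close>
      have "{l, i} \<notin> J"
        using N(1) eJ h(1) T_eq_0_iff[of "{k, l}"] T_eq_0_iff[of "{l, i}"] by auto
      then have "l \<in> infinite_pts" using r(4) 4 h by (auto simp: infinite_pts_def insert_commute)
      obtain c1 c2 where rel: "U k l * U i j - cst c1 * (U k i * U l j) + cst c2 * (U k j * U l i) \<in> Q"
        by (rule plucker_rel_in_Q[OF r(2,3)]) (use eJ h(1) ij N T_ij in auto)
      have "U k l - - (cst c2 * (U k j * U l i)) \<in> Q"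
        using rel unfolding U_ij U_in_J[OF r(4)] by simp
      moreover have "- (cst c2 * (U k j * U l i)) \<in> spanned B"
      proof -
        have "{k, j} \<in> B" "{l, i} \<in> B" using p h 4 \<open>l \<in> infinite_pts\<close> by (auto simp: base_coords_def insert_commute)
        then have "U k j \<in> spanned B" "U l i \<in> spanned B" using U_in_spanned[OF BV] by blast+
        then show ?thesis by (rule spanned_uminus[OF BV spanned_mult[OF BV spanned_cst[OF BV] spanned_mult[OF BV]]])
      qed
      ultimately show ?thesis by (rule spanned_cong[rotated])
    qed
  qed
  have "U k l \<in> spanned B"
  proof (cases "k \<in> finite_pts")
    case True then show ?thesis using main kl by simp
  next
    case False
    have "l \<in> finite_pts" using neither_finite_pts_in_J[of k l] False kl eJ by auto
    then have "U l k \<in> spanned B" using main[of l k] kl by (simp add: insert_commute)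
    then show ?thesis using U_swap[of l k] spanned_uminus[OF BV] kl by simp
  qed
  then show ?thesis using kl eJ by (simp add: sg_def affine_coord_def)
qed

section \<open>Points of the variety with prescribed absolute values and generic reduction\<close>

abbreviation acoord :: "(nat set \<Rightarrow> 'l) \<Rightarrow> nat \<Rightarrow> 'l" where
  "acoord W k \<equiv> sg k j * T {k, j} * W {k, j}"

text \<open>The unit-valued \<open>W\<close> corrects \<open>\<tau>\<close> so that, on the columns
  in \<open>S\<close>, the coordinates are those of the matrix with columns
  \<open>(a\<^sub>k, a\<^sub>k t\<^sub>k)\<close>, where \<open>a\<^sub>k\<close> is
  \<open>acoord W k\<close>.\<close>

definition is_point :: "nat set \<Rightarrow> (nat set \<Rightarrow> 'l) \<Rightarrow> (nat \<Rightarrow> 'l) \<Rightarrow> bool" where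
  "is_point S W t \<longleftrightarrow> (\<forall>v. av (W v) = 1) \<and> W {i, j} = 1 \<and>
    (\<forall>k\<in>S. \<forall>l\<in>S. k \<noteq> l \<longrightarrow> sg k l * T {k, l} * W {k, l} = acoord W k * acoord W l * (t l - t k))"

abbreviation eval_res :: "(nat set \<Rightarrow> 'l) \<Rightarrow> ((nat set \<Rightarrow>\<^sub>0 int) \<Rightarrow>\<^sub>0 'r) \<Rightarrow> 'r" where
  "eval_res W \<equiv> mon_eval id (lmon (\<lambda>v. res (W v)))"

lemma av_sg [simp]: "av (sg k l) = 1"
  by (simp add: sg_def)

lemma lift_generic_point:
  assumes "finite B" "finite H" "H \<subseteq> carrier (mon_ring B) - {0}"
  obtains W where "\<forall>v. av (W v) = 1" "\<forall>v. v \<notin> B \<longrightarrow> W v = 1" "\<forall>h\<in>H. eval_res W h \<noteq> 0"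
proof -
  obtain \<rho> where \<rho>: "\<forall>v. \<rho> v \<noteq> 0" "\<forall>h\<in>H. mon_eval id (lmon \<rho>) h \<noteq> 0"
    using exists_generic_point[OF infinite_residue assms] by blast
  have "\<exists>a. av a = 1 \<and> res a = \<rho> v" for v using res_lift[of "\<rho> v"] \<rho>(1) by metis
  then obtain W where W: "\<And>v. av (W v) = 1" "\<And>v. res (W v) = \<rho> v" by metis
  let ?W = "\<lambda>v. if v \<in> B then W v else 1"
  have "eval_res ?W h = mon_eval id (lmon \<rho>) h" if "h \<in> H" for h
    by (rule mon_eval_cong[of _ B]) (use that assms W in auto)
  then show ?thesis using that[of ?W] W \<rho>(2) by auto
qed

text \<open>\<open>H\<close> must vary in the induction: avoiding its zeros with the new parameter
  requires earlier coordinates at which the peeled-off coefficients are nonzero.\<close>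

lemma exists_point_avoiding:
  assumes "attached S B" "finite H" "H \<subseteq> carrier (mon_ring B) - {0}"
  shows "\<exists>W t. is_point S W t \<and> (\<forall>h\<in>H. eval_res W h \<noteq> 0)"
  using assms
proof (induction arbitrary: H rule: attached.induct)
  case start
  obtain W where W: "\<forall>v. av (W v) = 1" "\<forall>v. v \<notin> base_coords \<longrightarrow> W v = 1" "\<forall>h\<in>H. eval_res W h \<noteq> 0"
    using start by (rule lift_generic_point[OF finite_base_coords])
  have "{i, j} \<notin> base_coords" using base_coords_subset by (auto simp: torus_indices_def)
  then have "is_point {i} W t" for t using W(1,2) by (simp add: is_point_def)
  then show ?case using W(3) by blast
next
  case (step S B m s)
  note p = attached_props[OF step.hyps(1)]
  have SA: "S \<subseteq> finite_pts" using p by blast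
  have mA: "m \<in> finite_pts" "m \<notin> S" and sA: "s \<in> finite_pts" "m \<noteq> s" using step.hyps SA by auto
  \<comment> \<open>Corrections at pairs of \<open>m\<close> with old points may thus be changed
    without affecting values of the earlier free coordinates.\<close>
  have mS: "{m, l} \<notin> B" if "l \<in> S" for l
  proof
    assume e: "{m, l} \<in> B"
    have l: "l \<in> finite_pts" using that SA by blast
    consider "{m, l} \<in> base_coords" | k k' where "k \<in> S" "k' \<in> S" "{m, l} = {k, k'}" using e p by blast
    then show False
    proof cases
      case 1
      then show False using mA l finite_pts_props[OF mA(1)] finite_pts_props[OF l] infinite_pts_props
        unfolding base_coords_def by (auto simp: doubleton_eq_iff)
    qed (use mA in \<open>auto simp: doubleton_eq_iff\<close>)
  qed
  \<comment> \<open>If \<open>{m, s}\<close> lies in \<open>J\<close> no variable is added; peeling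
    it off is then still valid, so both cases are treated alike.\<close>
  have "H \<subseteq> carrier (mon_ring (insert {m, s} B)) - {0}"
    using step.prems(2) mon_ring_mono[of _ "B \<union> ({{m, s}} - J)" "insert {m, s} B"] by blast
  from finite_zeros_peel_set[OF step.prems(1) this] obtain H' where
    H': "finite H'" "H' \<subseteq> carrier (mon_ring B) - {0}" and
    fin: "\<forall>\<rho>. (\<forall>v. \<rho> v \<noteq> 0) \<and> (\<forall>h\<in>H'. mon_eval id (lmon \<rho>) h \<noteq> 0) \<longrightarrow>
      finite {c. c \<noteq> 0 \<and> (\<exists>h\<in>H. mon_eval id (lmon (\<rho>({m, s} := c))) h = 0)}"
    by (elim exE conjE)
  obtain W t where Wt: "is_point S W t" "\<forall>h\<in>H'. eval_res W h \<noteq> 0" using step.IH[OF H'] by blast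
  note W = Wt(1)[unfolded is_point_def]
  have avW: "av (W v) = 1" for v using W by blast
  define a where "a k = acoord W k" for k
  have ava: "av (a k) = N {k, j}" for k by (simp add: a_def av_mult avW)
  have anz: "a k \<noteq> 0" if "k \<in> finite_pts" for k
    using ava[of k] finite_pts_props[OF that] by (metis av_zero less_irrefl)
  have rel: "sg k l * T {k, l} * W {k, l} = a k * a l * (t l - t k)" if "k \<in> S" "l \<in> S" "k \<noteq> l" for k l
    using W that unfolding a_def by blast
  have fin1: "finite {c. c \<noteq> 0 \<and> (\<exists>h\<in>H. mon_eval id (lmon ((\<lambda>v. res (W v))({m, s} := c))) h = 0)}"
  proof (rule mp[OF spec[OF fin]], intro conjI allI)
    show "res (W v) \<noteq> 0" for v using res_nonzero_iff[of "W v"] avW by simp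
  qed (rule Wt(2))
  \<comment> \<open>With \<open>C\<close> the correction at \<open>{m, s}\<close>, the equation for
    \<open>{m, l}\<close> forces the correction \<open>E1 l + E2 l * C\<close>: the first summand
    comes from the difference between \<open>l\<close> and \<open>s\<close>, the second from that
    between \<open>s\<close> and \<open>m\<close>.\<close>
  define E1 where "E1 l = sg m l * (a m * (sg s l * T {s, l} * W {s, l}) / (a s * T {m, l}))" for l
  define E2 where "E2 l = - sg m l * (a l * (sg s m * T {m, s}) / (a s * T {m, l}))" for l
  \<comment> \<open>Nearness of \<open>s\<close> makes both coefficients integral, and the third
    ultrametric inequality makes one of them a unit. So the reduced affine function is not zero and
    excludes only finitely many residues of \<open>C\<close>.\<close>
  have E: "av (E1 l) \<le> 1 \<and> av (E2 l) \<le> 1 \<and> (av (E1 l) = 1 \<or> av (E2 l) = 1)"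
    if l: "l \<in> S" "l \<noteq> s" "{m, l} \<notin> J" for l
  proof -
    note st = step_ineqs[OF SA step.hyps(2,3) l(1,2) step.hyps(4)[OF l(1)]]
    have pos: "0 < N {m, l} * N {s, j}" using l(3) finite_pts_props[OF sA(1)] T_eq_0_iff by simp
    have e1: "av (E1 l) = N {m, j} * N {l, s} / (N {m, l} * N {s, j})"
      by (simp only: E1_def av_mult av_divide av_sg avW ava) (simp add: insert_commute mult.commute)
    have e2: "av (E2 l) = N {m, s} * N {l, j} / (N {m, l} * N {s, j})"
      by (simp only: E2_def av_mult av_divide av_sg avW ava av_uminus) (simp add: mult.commute)
    show ?thesis unfolding e1 e2 using st(1,2) step.hyps(4)[OF l(1)] pos
      by (auto simp: divide_le_eq_1 divide_eq_1_iff max_def split: if_splits)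
  qed
  have fin2: "finite {c. res (E1 l) + res (E2 l) * c = 0}" if "l \<in> S" "l \<noteq> s" "{m, l} \<notin> J" for l
  proof -
    have "[:res (E1 l), res (E2 l):] \<noteq> 0" using E[OF that] res_nonzero_iff by auto
    from poly_roots_finite[OF this] show ?thesis by (simp add: mult.commute)
  qed
  have "finite ({0} \<union> {c. c \<noteq> 0 \<and> (\<exists>h\<in>H. mon_eval id (lmon ((\<lambda>v. res (W v))({m, s} := c))) h = 0)} \<union>
      (\<Union>l\<in>{l \<in> S. l \<noteq> s \<and> {m, l} \<notin> J}. {c. res (E1 l) + res (E2 l) * c = 0}))"
    using fin1 fin2 p by (intro finite_UnI finite_UN_I) auto
  from ex_new_if_finite[OF infinite_residue this] obtain c where
    "c \<notin> {0} \<union> {c. c \<noteq> 0 \<and> (\<exists>h\<in>H. mon_eval id (lmon ((\<lambda>v. res (W v))({m, s} := c))) h = 0)} \<union>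
      (\<Union>l\<in>{l \<in> S. l \<noteq> s \<and> {m, l} \<notin> J}. {c. res (E1 l) + res (E2 l) * c = 0})" ..
  then have c: "c \<noteq> 0"
    "\<And>h. h \<in> H \<Longrightarrow> mon_eval id (lmon ((\<lambda>v. res (W v))({m, s} := c))) h \<noteq> 0"
    "\<And>l. l \<in> S \<Longrightarrow> l \<noteq> s \<Longrightarrow> {m, l} \<notin> J \<Longrightarrow> res (E1 l) + res (E2 l) * c \<noteq> 0" by auto
  obtain C where C: "av C = 1" "res C = c" using res_lift[OF c(1)] .
  \<comment> \<open>The displacement from \<open>s\<close> to \<open>m\<close> for which the
    correction at \<open>{m, s}\<close> is exactly \<open>C\<close>.\<close>
  define z where "z = sg s m * T {m, s} * C / (a s * a m)"
  define t' where "t' = t(m := t s + z)"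
  define F where "F l = (if l = s then C else E1 l + E2 l * C)" for l
  \<comment> \<open>Removing \<open>m\<close> from the pair recovers the other endpoint. Corrections
    at coordinates in \<open>J\<close> stay as they are, since these get multiplied by zero.\<close>
  define W' where "W' v = (if \<exists>l\<in>S. v = {m, l} \<and> v \<notin> J then F (the_elem (v - {m})) else W v)" for v
  have W'm: "W' {m, l} = F l" if "l \<in> S" "{m, l} \<notin> J" for l
  proof -
    have "{m, l} - {m} = {l}" using that mA by auto
    then show ?thesis using that by (auto simp: W'_def)
  qed
  have W'other: "W' v = W v" if "\<And>l. l \<in> S \<Longrightarrow> v \<noteq> {m, l}" for v using that by (auto simp: W'_def)
  have "av (F l) = 1" if "l \<in> S" "{m, l} \<notin> J" for l
  proof (cases "l = s")
    case False
    note e = E[OF that(1) False that(2)]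
    have i: "av (E2 l * C) \<le> 1" using e C by (simp add: av_mult)
    have "res (F l) = res (E1 l) + res (E2 l) * c"
      using False e C i by (simp add: F_def res_add res_mult)
    then have "res (F l) \<noteq> 0" using c(3)[OF that(1) False that(2)] by simp
    moreover have "av (F l) \<le> 1" using False e i by (simp add: F_def av_add_le)
    ultimately show ?thesis using res_nonzero_iff by blast
  qed (simp add: F_def C)
  then have av': "av (W' v) = 1" for v using W'm W'other[of v] avW by (metis W'_def)
  \<comment> \<open>The column scalars must not change, since \<open>is_point\<close> refers to them
    through \<open>acoord\<close>.\<close>
  have Wj: "W' {k, j} = W {k, j}" for k
  proof (rule W'other)
    fix l assume "l \<in> S"
    then have "l \<in> finite_pts" using SA by blast
    then show "{k, j} \<noteq> {m, l}" using finite_pts_props[of l] finite_pts_props[OF mA(1)] by (auto simp: doubleton_eq_iff)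
  qed
  have main: "sg m l * T {m, l} * W' {m, l} = a m * a l * (t l - t' m)" if l: "l \<in> S" for l
  proof -
    have lA: "l \<in> finite_pts" using l SA by blast
    note nz = anz[OF lA] anz[OF mA(1)] anz[OF sA(1)]
    have z: "a m * a l * z = a l * (sg s m * T {m, s} * C) / a s"
      using nz by (simp add: z_def)
    show ?thesis
    proof (cases "l = s")
      case True
      have "{m, s} \<notin> J \<Longrightarrow> W' {m, s} = C" using W'm[OF step.hyps(3)] by (simp add: F_def)
      then have TC: "T {m, s} * W' {m, s} = T {m, s} * C"
        by (cases "{m, s} \<in> J") (simp_all add: T_eq_0_iff[THEN iffD2])
      have "sg m s * T {m, s} * W' {m, s} = - (sg s m * T {m, s} * C)"
        unfolding sg_swap[OF sA(2)] mult.assoc TC by simp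
      also have "\<dots> = - (a m * a s * z)" using nz by (simp add: z_def)
      also have "\<dots> = a m * a s * (t s - t' m)" by (simp add: t'_def)
      finally show ?thesis using True by simp
    next
      case ls: False
      have r: "a l * (t l - t s) = sg s l * T {s, l} * W {s, l} / a s"
        unfolding rel[OF step.hyps(3) l ls[symmetric]] using nz by simp
      show ?thesis
      proof (cases "{m, l} \<in> J")
        case True
        note st = step_ineqs[OF SA step.hyps(2,3) l ls step.hyps(4)[OF l]]
        \<comment> \<open>Here \<open>m\<close> is to coincide with \<open>l\<close>. As
          \<open>s\<close> is a nearest point, it coincides with both, so the displacement
          \<open>z\<close> is zero and both sides of the equation vanish.\<close>
        have 0: "N {m, l} = 0" using True T_eq_0_iff by simp
        then have "N {m, s} * N {l, j} \<le> 0" "N {m, j} * N {l, s} \<le> 0" using step.hyps(4)[OF l] st(1) by simp_all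
        then have "N {m, s} = 0" "N {l, s} = 0"
          using finite_pts_props[OF lA] finite_pts_props[OF mA(1)] by (simp_all add: mult_le_0_iff)
        then have "T {m, s} = 0" "T {s, l} = 0" by (simp_all add: insert_commute)
        then have "z = 0" "t l = t s" using r nz by (simp_all add: z_def)
        then show ?thesis using 0 by (simp add: t'_def)
      next
        case False
        have Tnz: "T {m, l} \<noteq> 0" using False T_eq_0_iff by simp
        have "sg m l * T {m, l} * W' {m, l} = sg m l * T {m, l} * (E1 l + E2 l * C)"
          using W'm[OF l False] ls by (simp add: F_def)
        also have "\<dots> = (sg m l * sg m l) * (a m * (sg s l * T {s, l} * W {s, l} / a s) -
            a l * (sg s m * T {m, s} * C) / a s)"
          using Tnz nz unfolding E1_def E2_def by (simp add: divide_simps) (simp add: algebra_simps)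
        also have "\<dots> = a m * (a l * (t l - t s)) - a m * a l * z"
          unfolding z r sg_square by simp
        also have "\<dots> = a m * a l * (t l - t' m)" by (simp add: t'_def algebra_simps)
        finally show ?thesis .
      qed
    qed
  qed
  have "is_point (insert m S) W' t'"
    unfolding is_point_def Wj a_def[symmetric]
  proof (intro conjI allI ballI impI)
    show "av (W' v) = 1" for v by (rule av')
    show "W {i, j} = 1" using W by blast
    fix k l assume kl: "k \<in> insert m S" "l \<in> insert m S" "k \<noteq> l"
    then consider "k = m" "l \<in> S" | "l = m" "k \<in> S" | "k \<in> S" "l \<in> S" by blast
    then show "sg k l * T {k, l} * W' {k, l} = a k * a l * (t' l - t' k)"
    proof cases
      case 1
      then have "t' l = t l" using mA by (auto simp: t'_def)
      then show ?thesis using main[OF 1(2)] 1 by simp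
    next
      case 2
      then have "t' k = t k" using mA by (auto simp: t'_def)
      moreover have "sg k l = (- sg m k :: 'l)" using sg_swap[of m k] 2 kl by simp
      moreover have "{k, l} = {m, k}" using 2 by auto
      ultimately show ?thesis using main[OF 2(2)] 2 by (simp add: algebra_simps)
    next
      case 3
      then have "t' k = t k" "t' l = t l" using mA by (auto simp: t'_def)
      moreover have "W' {k, l} = W {k, l}" by (rule W'other) (use 3 mA in \<open>auto simp: doubleton_eq_iff\<close>)
      ultimately show ?thesis using rel[OF 3 kl(3)] by simp
    qed
  qed
  moreover have "eval_res W' h \<noteq> 0" if h: "h \<in> H" for h
  proof -
    have hC: "h \<in> carrier (mon_ring (B \<union> ({{m, s}} - J)))" using step.prems(2) h by blast
    have "eval_res W' h = mon_eval id (lmon ((\<lambda>v. res (W v))({m, s} := c))) h"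
    proof (rule mon_eval_cong[OF hC])
      fix v assume v: "v \<in> B \<union> ({{m, s}} - J)"
      show "res (W' v) = ((\<lambda>v. res (W v))({m, s} := c)) v"
      proof (cases "v = {m, s}")
        case True
        then have "{m, s} \<notin> J" using v mS[OF step.hyps(3)] by blast
        then show ?thesis using True W'm[OF step.hyps(3)] C by (simp add: F_def)
      next
        case False
        then have "v \<in> B" using v by blast
        then have "W' v = W v" using mS by (intro W'other) blast
        then show ?thesis using False by simp
      qed
    qed
    then show ?thesis using c(2)[OF h] by simp
  qed
  ultimately show ?case by blast
qed

text \<open>The finite columns already form a point; the other columns bring no further free choice
  beyond their scalars, so the matrix can be completed without changing the values of the
  coordinates in \<open>B\<close>.\<close>

lemma exists_point_in_variety:
  assumes B: "attached finite_pts B" and H: "finite H" "H \<subseteq> carrier (mon_ring B) - {0}"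
  obtains W where "\<And>v. av (W v) = 1" "\<And>h. h \<in> H \<Longrightarrow> eval_res W h \<noteq> 0"
    "\<And>f. f \<in> extend_ideal \<iota> V (GrJ_ideal n {i, j} J) \<Longrightarrow> mon_eval id (lmon (\<lambda>v. \<tau> v * W v)) f = 0"
proof -
  obtain W t where Wt: "is_point finite_pts W t" "\<forall>h\<in>H. eval_res W h \<noteq> 0" using exists_point_avoiding[OF B H] by blast
  note W = Wt(1)[unfolded is_point_def]
  define a where "a k = acoord W k" for k
  define b where "b l = sg i l * T {i, l} * W {i, l}" for l
  have avW: "av (W v) = 1" for v using W by blast
  have ava: "av (a k) = N {k, j}" "av (b k) = N {i, k}" for k using W by (simp_all add: a_def b_def av_mult)
  \<comment> \<open>The correction forced by \<open>p\<^sub>k\<^sub>l = a\<^sub>k b\<^sub>l\<close>;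
    it is a unit by the product formula for absolute values.\<close>
  define F where "F k l = sg k l * (a k * b l) / T {k, l}" for k l
  \<comment> \<open>The two kinds of columns are disjoint, so intersecting the pair with each set
    recovers its endpoints.\<close>
  define W' where "W' v = (if \<exists>k\<in>finite_pts - {i}. \<exists>l\<in>infinite_pts. v = {k, l}
    then F (the_elem (v \<inter> finite_pts)) (the_elem (v \<inter> infinite_pts)) else W v)" for v
  have W'F: "W' {k, l} = F k l" if "k \<in> finite_pts - {i}" "l \<in> infinite_pts" for k l
  proof -
    have "{k, l} \<inter> finite_pts = {k}" "{k, l} \<inter> infinite_pts = {l}" using that infinite_pts_props by auto
    moreover have "\<exists>k'\<in>finite_pts - {i}. \<exists>l'\<in>infinite_pts. {k, l} = {k', l'}" using that by blast
    ultimately show ?thesis by (simp only: W'_def if_True the_elem_eq)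
  qed
  have W'W: "W' v = W v" if "\<And>k l. k \<in> finite_pts - {i} \<Longrightarrow> l \<in> infinite_pts \<Longrightarrow> v \<noteq> {k, l}" for v
  proof -
    have "\<not> (\<exists>k\<in>finite_pts - {i}. \<exists>l\<in>infinite_pts. v = {k, l})" using that by blast
    then show ?thesis by (simp only: W'_def if_False)
  qed
  have LSr: "N {k, l} = N {k, j} * N {i, l}" "T {k, l} \<noteq> 0" if "k \<in> finite_pts - {i}" "l \<in> infinite_pts" for k l
  proof -
    have l: "l \<in> {1..n}" "l \<noteq> j" "l \<notin> finite_pts" "{i, l} \<notin> J" using infinite_pts_props[OF that(2)] by auto
    show 1: "N {k, l} = N {k, j} * N {i, l}" using infinite_pts_rel(1)[OF _ _ l(1-3)] that(1) by blast
    have "N {k, j} > 0" "N {i, l} > 0" using finite_pts_props that l(4) T_eq_0_iff by auto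
    then have "N {k, l} > 0" unfolding 1 by (rule mult_pos_pos)
    then show "T {k, l} \<noteq> 0" by simp
  qed
  have av': "av (W' v) = 1" for v
  proof (cases "\<exists>k\<in>finite_pts - {i}. \<exists>l\<in>infinite_pts. v = {k, l}")
    case True
    then obtain k l where kl: "k \<in> finite_pts - {i}" "l \<in> infinite_pts" "v = {k, l}" by blast
    have "av (F k l) = N {k, l} / N {k, l}"
      unfolding LSr(1)[OF kl(1,2)] by (simp add: F_def av_divide av_mult ava LSr(1)[OF kl(1,2)])
    then show ?thesis using W'F[OF kl(1,2)] kl(3) LSr(2)[OF kl(1,2)] by simp
  next
    case False
    then have "W' v = W v" by (simp only: W'_def if_False)
    then show ?thesis using avW by simp
  qed
  have W'finite_pts: "W' {k, l} = W {k, l}" if "k \<in> finite_pts" "l \<in> finite_pts" for k l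
    by (rule W'W) (use that infinite_pts_props in \<open>auto simp: doubleton_eq_iff\<close>)
  have W'j: "W' {k, j} = W {k, j}" for k
    by (rule W'W) (use infinite_pts_props finite_pts_props in \<open>auto simp: doubleton_eq_iff\<close>)
  have W'i: "W' {i, l} = W {i, l}" for l
    by (rule W'W) (use infinite_pts_props in \<open>auto simp: doubleton_eq_iff\<close>)
  have W'ij: "W' {i, j} = 1" using W'j[of i] W by simp
  \<comment> \<open>The rows of the matrix: finite columns \<open>(a, a t)\<close>, infinite columns
    \<open>(0, b)\<close>, column \<open>j\<close> equal to \<open>(0, 1)\<close>, and all others
    zero.\<close>
  define p where "p k = (if k \<in> finite_pts then a k else 0)" for k
  define q where "q k = (if k \<in> finite_pts then a k * t k else if k \<in> infinite_pts then b k else if k = j then 1 else 0)" for k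
  have jA: "j \<notin> finite_pts" "j \<notin> infinite_pts" using finite_pts_props infinite_pts_props by blast+
  have minor1: "p k * q l - p l * q k = sg k l * T {k, l} * W' {k, l}"
    if k: "k \<in> finite_pts" and l: "l \<in> {1..n}" "k \<noteq> l" for k l
  proof -
    consider "l \<in> finite_pts" | "l = j" | "l \<in> infinite_pts" "k = i" | "l \<in> infinite_pts" "k \<in> finite_pts - {i}" |
      "l \<notin> finite_pts" "l \<noteq> j" "l \<notin> infinite_pts" using k by blast
    then show ?thesis
    proof cases
      case 1
      have "sg k l * T {k, l} * W {k, l} = a k * a l * (t l - t k)"
        using W k 1 l unfolding a_def by blast
      then show ?thesis using k 1 W'finite_pts[OF k 1] by (simp add: p_def q_def algebra_simps)
    next
      case 2
      then show ?thesis using k jA W'j[of k] by (simp add: p_def q_def a_def)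
    next
      case 3
      have "a i = 1" using W T_ij ij by (simp add: a_def sg_def)
      then show ?thesis using 3 k infinite_pts_props[OF 3(1)] W'i[of l] by (simp add: p_def q_def b_def)
    next
      case 4
      have "sg k l * T {k, l} * W' {k, l} = (sg k l * sg k l) * (a k * b l)"
        unfolding W'F[OF 4(2,1)] F_def using LSr(2)[OF 4(2,1)] by simp
      then show ?thesis using 4 infinite_pts_props[OF 4(1)] by (simp add: p_def q_def sg_square)
    next
      case 5
      \<comment> \<open>A zero column: its coordinates with \<open>j\<close> and with
        \<open>i\<close> vanish, and the product formula then gives vanishing with every finite
        column.\<close>
      have lj: "{l, j} \<in> J" using 5 l by (auto simp: finite_pts_def)
      then have il: "{i, l} \<in> J" using 5 l by (auto simp: infinite_pts_def)
      have "{k, l} \<in> J"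
      proof (cases "k = i")
        case False
        have "N {k, l} = 0" using infinite_pts_rel(1)[OF k False l(1) 5(2,1)] il T_eq_0_iff[of "{i, l}"] by simp
        then show ?thesis using T_eq_0_iff by simp
      qed (use il in simp)
      then show ?thesis using 5 T_eq_0_iff[of "{k, l}"] by (simp add: p_def q_def)
    qed
  qed
  have minor: "p k * q l - p l * q k = sg k l * T {k, l} * W' {k, l}"
    if kl: "k \<in> {1..n}" "l \<in> {1..n}" "k \<noteq> l" for k l
  proof -
    consider "k \<in> finite_pts" | "l \<in> finite_pts" | "k \<notin> finite_pts" "l \<notin> finite_pts" by blast
    then show ?thesis
    proof cases
      case 1 then show ?thesis using minor1 kl by blast
    next
      case 2
      have "p k * q l - p l * q k = - (p l * q k - p k * q l)" by simp
      also have "\<dots> = - (sg l k * T {l, k} * W' {l, k})" using minor1[OF 2 kl(1)] kl(3) by simp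
      also have "\<dots> = sg k l * T {k, l} * W' {k, l}"
        using sg_swap[OF kl(3)[symmetric], where 'a = 'l] by (simp add: insert_commute)
      finally show ?thesis .
    next
      case 3
      then show ?thesis using neither_finite_pts_in_J[OF kl 3] T_eq_0_iff[of "{k, l}"] by (simp add: p_def)
    qed
  qed
  have van: "mon_eval id (lmon (\<lambda>v. \<tau> v * W' v)) f = 0"
    if f: "f \<in> extend_ideal \<iota> V (GrJ_ideal n {i, j} J)" for f
  proof (rule eval_extended_GrJ_ideal[OF ring_map_\<iota> _ _ f])
    show "\<tau> v * W' v \<noteq> 0" for v using \<tau>0 av'[of v] by auto
    fix k l assume kl: "k \<in> {1..n}" "l \<in> {1..n}" "k < l"
    have "p k * q l - p l * q k = sg k l * T {k, l} * W' {k, l}" using kl by (intro minor) auto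
    also have "\<dots> = T {k, l} * W' {k, l}" using kl by (simp add: sg_def)
    also have "\<dots> = (if {k, l} \<in> J then 0 else if {k, l} = {i, j} then 1 else \<tau> {k, l} * W' {k, l})"
    proof (cases "{k, l} = {i, j}")
      case True
      show ?thesis unfolding True using W'ij by (simp add: torus_coord_def)
    next
      case False
      then show ?thesis by (simp only: torus_coord_def if_False split: if_split) simp
    qed
    finally show "p k * q l - p l * q k =
      (if {k, l} \<in> J then 0 else if {k, l} = {i, j} then 1 else \<tau> {k, l} * W' {k, l})" .
  qed
  have "eval_res W' h \<noteq> 0" if h: "h \<in> H" for h
  proof -
    have "eval_res W' h = eval_res W h"
    proof (rule mon_eval_cong)
      show "h \<in> carrier (mon_ring B)" using H h by blast
      fix v assume "v \<in> B"
      then consider "v \<in> base_coords" | k l where "k \<in> finite_pts" "l \<in> finite_pts" "v = {k, l}" using attached_props[OF B] by blast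
      then have "W' v = W v"
        by cases (use W'j W'i W'finite_pts in \<open>auto simp: base_coords_def\<close>)
      then show "res (W' v) = res (W v)" by simp
    qed
    then show ?thesis using Wt(2) h by simp
  qed
  then show ?thesis by (intro that[OF av' _ van])
qed

text \<open>Variables outside \<open>B\<close> reduce to Laurent polynomials in \<open>B\<close>,
  but their inverses need not. Multiplication by a monomial, which is a unit of \<open>RV\<close>,
  removes the negative exponents.\<close>

lemma unit_multiple_spanned:
  assumes B: "attached finite_pts B" and g: "g \<in> carrier RV"
  shows "\<exists>M M'. M \<in> spanned B \<and> M' \<in> carrier RV \<and> M * M' = 1 \<and> M * g \<in> spanned B"
proof -
  have BV: "B \<subseteq> V" using attached_props[OF B] by blast
  have one: "1 \<in> spanned B" by (rule spanned_base[OF BV mon_ring_one_closed])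
  \<comment> \<open>Elements with a denominator; the product of two denominators serves both for
    sums and for products.\<close>
  define Z where "Z g \<longleftrightarrow> (\<exists>M M'. M \<in> spanned B \<and> M' \<in> carrier RV \<and> M * M' = 1 \<and> M * g \<in> spanned B)" for g
  have Zmult: "Z (f * g)" and Zadd: "Z (f + g)" if fg: "Z f" "Z g" for f g
  proof -
    obtain M M' L L' where h: "M \<in> spanned B" "M' \<in> carrier RV" "M * M' = 1" "M * f \<in> spanned B"
      "L \<in> spanned B" "L' \<in> carrier RV" "L * L' = 1" "L * g \<in> spanned B"
      using fg unfolding Z_def by blast
    have "(M * L) * (M' * L') = (M * M') * (L * L')" by (simp only: mult_ac)
    then have 1: "M * L \<in> spanned B" "M' * L' \<in> carrier RV" "(M * L) * (M' * L') = 1"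
      using h by (simp_all add: spanned_mult[OF BV] mon_ring_mult_closed)
    have "(M * L) * (f * g) = (M * f) * (L * g)" by (simp only: mult_ac)
    then have "(M * L) * (f * g) \<in> spanned B" using spanned_mult[OF BV h(4,8)] by (simp only:)
    then show "Z (f * g)" unfolding Z_def using 1 by (intro exI[of _ "M * L"] exI[of _ "M' * L'"] conjI)
    have "(M * L) * (f + g) = L * (M * f) + M * (L * g)" by (simp add: algebra_simps)
    then have "(M * L) * (f + g) \<in> spanned B" using spanned_add[OF spanned_mult[OF BV h(5,4)] spanned_mult[OF BV h(1,8)]] by (simp only:)
    then show "Z (f + g)" unfolding Z_def using 1 by (intro exI[of _ "M * L"] exI[of _ "M' * L'"] conjI)
  qed
  have ZG: "Z g" if "g \<in> spanned B" for g
    unfolding Z_def using that one mon_ring_one_closed by (intro exI[of _ 1]) simp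
  have pow: "Poly_Mapping.single (Poly_Mapping.single v (int k)) 1 \<in> spanned B" if "v \<in> V" for v k
  proof (induction k)
    case 0
    then show ?case using one by simp
  next
    case (Suc k)
    have "Poly_Mapping.single (Poly_Mapping.single v (int (Suc k))) (1::'r) =
        var v * Poly_Mapping.single (Poly_Mapping.single v (int k)) 1"
      by (simp add: var_def mult_single flip: single_add)
    then show ?case using spanned_mult[OF BV var_spanned[OF B that] Suc] by simp
  qed
  have Zvar: "Z (Poly_Mapping.single (Poly_Mapping.single v e) 1)" if v: "v \<in> V" for v e
  proof (cases "e \<ge> 0")
    case True
    then show ?thesis using ZG[OF pow[OF v, of "nat e"]] by simp
  next
    case False
    let ?M = "\<lambda>e. Poly_Mapping.single (Poly_Mapping.single v e) 1 :: (nat set \<Rightarrow>\<^sub>0 int) \<Rightarrow>\<^sub>0 'r"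
    have "?M (- e) \<in> spanned B" using pow[OF v, of "nat (- e)"] False by simp
    moreover have "?M (- e) * ?M e = 1" by (simp add: mult_single flip: single_add)
    moreover have "?M e \<in> carrier RV" using v by (intro single_in_mon_ring) simp
    ultimately show ?thesis unfolding Z_def using one by (intro exI[of _ "?M (- e)"] exI[of _ "?M e"]) simp
  qed
  have Zmon: "Z (Poly_Mapping.single \<alpha> 1)" if \<alpha>: "Poly_Mapping.keys \<alpha> \<subseteq> V" for \<alpha>
  proof -
    have "Z (Poly_Mapping.single (\<Sum>v\<in>A. Poly_Mapping.single v (Poly_Mapping.lookup \<alpha> v)) 1)"
      if "finite A" "A \<subseteq> V" for A
      using that
    proof (induction A rule: finite_induct)
      case empty
      then show ?case using ZG[OF one] by simp
    next
      case (insert v A)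
      have "Poly_Mapping.single (\<Sum>v\<in>insert v A. Poly_Mapping.single v (Poly_Mapping.lookup \<alpha> v)) (1::'r) =
          Poly_Mapping.single (Poly_Mapping.single v (Poly_Mapping.lookup \<alpha> v)) 1 *
          Poly_Mapping.single (\<Sum>v\<in>A. Poly_Mapping.single v (Poly_Mapping.lookup \<alpha> v)) 1"
        using insert.hyps by (simp add: mult_single)
      then show ?case using Zmult[OF Zvar insert.IH] insert.prems by simp
    qed
    from this[OF finite_keys \<alpha>] show ?thesis unfolding poly_mapping_sum_single[of \<alpha>, symmetric] .
  qed
  show ?thesis using g unfolding Z_def[symmetric]
  proof (induction g rule: mon_ring_induct)
    case zero
    show ?case by (rule ZG[OF spanned_zero[OF BV]])
  next
    case (single \<alpha> c)
    have "Poly_Mapping.single \<alpha> c = cst c * Poly_Mapping.single \<alpha> 1" by (simp add: cst_def mult_single)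
    then show ?case using Zmult[OF ZG[OF spanned_cst[OF BV]] Zmon[OF single]] by simp
  qed (rule Zadd)
qed

lemma primeideal_Q: "primeideal Q RV"
proof -
  obtain B where B: "attached finite_pts B" using exists_attached by blast
  have BV: "B \<subseteq> V" using attached_props[OF B] by blast
  have rm: "ring_map (eval_res W)" if "\<And>v. av (W v) = 1" for W
  proof (intro ring_map_leval ring_map_id)
    show "res (W v) \<noteq> 0" for v using res_nonzero_iff[of "W v"] that[of v] by simp
  qed
  \<comment> \<open>A single point is chosen at which both factors are nonzero; every element of
    \<open>Q\<close> vanishes there.\<close>
  have key: "h1 * h2 \<notin> Q" if h: "h1 \<in> carrier (mon_ring B) - {0}" "h2 \<in> carrier (mon_ring B) - {0}" for h1 h2
  proof
    assume Q: "h1 * h2 \<in> Q"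
    obtain W where W: "\<And>v. av (W v) = 1" "\<And>h. h \<in> {h1, h2} \<Longrightarrow> eval_res W h \<noteq> 0"
      "\<And>f. f \<in> extend_ideal \<iota> V (GrJ_ideal n {i, j} J) \<Longrightarrow> mon_eval id (lmon (\<lambda>v. \<tau> v * W v)) f = 0"
      by (rule exists_point_in_variety[OF B, of "{h1, h2}"]) (use h in auto)
    have "eval_res W (h1 * h2) = 0" by (rule eval_Q[OF W(1,3) Q])
    then show False using ring_map_simps(3)[OF rm[OF W(1)]] W(2) by simp
  qed
  show ?thesis
  proof (rule primeidealI[OF ideal_Q cring_mon_ring])
    show "carrier RV \<noteq> Q"
    proof
      assume "carrier RV = Q"
      then have "1 * 1 \<in> Q" using mon_ring_one_closed by force
      then show False using key[of 1 1] mon_ring_one_closed by force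
    qed
    fix f g assume fg: "f \<in> carrier RV" "g \<in> carrier RV" "f \<otimes>\<^bsub>RV\<^esub> g \<in> Q"
    obtain M M' where M: "M \<in> spanned B" "M' \<in> carrier RV" "M * M' = 1" "M * f \<in> spanned B"
      using unit_multiple_spanned[OF B fg(1)] by blast
    obtain L L' where L: "L \<in> spanned B" "L' \<in> carrier RV" "L * L' = 1" "L * g \<in> spanned B"
      using unit_multiple_spanned[OF B fg(2)] by blast
    have MC: "M \<in> carrier RV" "L \<in> carrier RV" using M L by (auto simp: spanned_def)
    obtain h1 where h1: "h1 \<in> carrier (mon_ring B)" "M * f - h1 \<in> Q" using M(4) by (auto simp: spanned_def)
    obtain h2 where h2: "h2 \<in> carrier (mon_ring B)" "L * g - h2 \<in> Q" using L(4) by (auto simp: spanned_def)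
    have "(M * L) * (f * g) \<in> Q" using Q_mult[of "f * g" "M * L"] fg MC by (simp add: mon_ring_mult_closed)
    moreover have "h1 * (L * g - h2) \<in> Q" by (rule Q_mult[OF h2(2) mon_ring_mono[OF h1(1) BV]])
    moreover have "(L * g) * (M * f - h1) \<in> Q"
      by (rule Q_mult[OF h1(2) mon_ring_mult_closed[OF MC(2) fg(2)]])
    moreover have "h1 * h2 = (M * L) * (f * g) - (h1 * (L * g - h2) + (L * g) * (M * f - h1))"
      by (simp add: algebra_simps)
    ultimately have "h1 * h2 \<in> Q" using ideal_mon_ring_diff[OF ideal_Q] Q_add by metis
    then have "h1 = 0 \<or> h2 = 0" using key h1(1) h2(1) by blast
    \<comment> \<open>Then \<open>M * f\<close> lies in \<open>Q\<close>, and multiplying by the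
      inverse \<open>M'\<close> recovers \<open>f\<close>.\<close>
    moreover have "f \<in> Q" if "h1 = 0"
    proof -
      have "M' * (M * f) \<in> Q" using Q_mult[OF _ M(2), of "M * f"] h1(2) that by simp
      moreover have "M' * (M * f) = (M * M') * f" by (simp only: mult_ac)
      ultimately show ?thesis using M(3) by simp
    qed
    moreover have "g \<in> Q" if "h2 = 0"
    proof -
      have "L' * (L * g) \<in> Q" using Q_mult[OF _ L(2), of "L * g"] h2(2) that by simp
      moreover have "L' * (L * g) = (L * L') * g" by (simp only: mult_ac)
      ultimately show ?thesis using L(3) by simp
    qed
    ultimately show "f \<in> Q \<or> g \<in> Q" by blast
  qed
qed

lemma tropical_multiplicity_eq_1:
  "tropical_multiplicity \<nu> res V y \<tau> (extend_ideal \<iota> V (GrJ_ideal n {i, j} J)) = 1"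
  unfolding tropical_multiplicity_def initial_degeneration_def
  by (rule domain.components_with_multiplicity_domain[OF primeideal.quotient_is_domain[OF primeideal_Q]])

end

theorem corollary6p5:
  fixes \<nu>K :: "'k::field \<Rightarrow> real"
    and \<nu>L :: "'l::alg_closed_field \<Rightarrow> real"
    and \<iota> :: "'k \<Rightarrow> 'l"
    and res :: "'l \<Rightarrow> 'r::field"
    and n :: nat
    and X :: "(nat set \<Rightarrow> ereal) set"
    and x :: "nat set \<Rightarrow> ereal"
    and J :: "nat set set"
    and ij :: "nat set"
    and y :: "nat set \<Rightarrow> real"
    and \<tau> :: "nat set \<Rightarrow> 'l"
  assumes "complete_valuation \<nu>K"
    and "complete_valuation \<nu>L"
    and "\<forall>r. \<exists>a. a \<noteq> 0 \<and> \<nu>L a = r"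
    and "valued_extension \<nu>K \<nu>L \<iota>"
    and "residue_map \<nu>L res"
    and "X \<in> TGr \<nu>K n" and "x \<in> X"
    and "J = vanishing n x"
    and "ij \<in> pairs n - J"
    and "\<forall>kl\<in>torus_indices n ij J. ereal (y kl) = x kl - x ij"
    and "\<forall>kl\<in>torus_indices n ij J. \<tau> kl \<noteq> 0 \<and> ln (absv \<nu>L (\<tau> kl)) = y kl"
  shows "tropical_multiplicity \<nu>L res (torus_indices n ij J) y \<tau>
           (extend_ideal \<iota> (torus_indices n ij J) (GrJ_ideal n ij J)) = 1"
proof -
  interpret residue_field \<nu>L res
    by unfold_locales (use assms(2,5) in \<open>simp_all add: complete_valuation_def\<close>)
  let ?V = "torus_indices n ij J"
  obtain i j where ijD: "ij = {i, j}" "i < j" "i \<in> {1..n}" "j \<in> {1..n}" using assms(9) pairsE by blast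
  \<comment> \<open>Outside the torus coordinates \<open>\<tau>\<close> is arbitrary, possibly zero;
    the value 1 satisfies the locale's nonvanishing condition.\<close>
  define \<tau>' where "\<tau>' v = (if v \<in> ?V then \<tau> v else 1)" for v
  have "x kl \<noteq> \<infinity>" if "kl \<in> pairs n" for kl
    using assms(6,7) that by (auto simp: TGr_def trop_def PiE_def Pi_def)
  moreover have "x kl \<noteq> -\<infinity> \<longleftrightarrow> kl \<notin> J" if "kl \<in> pairs n" for kl
    using that assms(8) by (simp add: vanishing_def)
  ultimately have fin: "\<exists>r. x kl = ereal r" if "kl \<in> pairs n" "kl \<notin> J" for kl
    using that by (cases "x kl") auto
  \<comment> \<open>Absolute values in L agree with the exponentiated tropical coordinates up to
    normalisation at \<open>ij\<close>, which transfers the inequality from the tropical point to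
    \<open>\<tau>'\<close>.\<close>
  have av: "av (torus_coord ij J \<tau>' kl) = trop_exp x kl / trop_exp x ij" if kl: "kl \<in> pairs n" for kl
  proof -
    obtain r where r: "x ij = ereal r" using fin assms(9) by blast
    consider "kl \<in> J" | "kl = ij" "kl \<notin> J" | "kl \<in> ?V" using kl by (auto simp: torus_indices_def)
    then show ?thesis
    proof cases
      case 1
      then show ?thesis using assms(8) by (simp add: torus_coord_def trop_exp_def vanishing_def)
    next
      case 2
      then show ?thesis using r by (simp add: torus_coord_def trop_exp_def)
    next
      case 3
      then have J: "kl \<notin> J" "kl \<noteq> ij" by (auto simp: torus_indices_def)
      obtain q where q: "x kl = ereal q" using fin kl J by blast
      have "y kl = q - r" using assms(10) 3 q r by force
      moreover have "\<tau> kl \<noteq> 0" "ln (av (\<tau> kl)) = y kl" using assms(11) 3 by auto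
      ultimately have "av (\<tau> kl) = exp (q - r)" by (metis av_pos_iff exp_ln)
      then show ?thesis using q r 3 J by (simp add: torus_coord_def trop_exp_def \<tau>'_def exp_diff)
    qed
  qed
  interpret grassmann_degeneration \<nu>L res \<iota> n i j J y \<tau>'
  proof
    show "ring_map \<iota>" using assms(4) by (simp add: valued_extension_def ring_map_def)
    show "infinite (UNIV :: 'r set)" by (rule infinite_residue_field) unfold_locales
    show "i \<in> {1..n}" "j \<in> {1..n}" "i < j" "{i, j} \<notin> J" using ijD assms(9) by auto
    show "\<tau>' v \<noteq> 0" for v using assms(11) by (simp add: \<tau>'_def)
    show "ln (av (\<tau>' v)) = y v" if "v \<in> torus_indices n {i, j} J" for v
      using assms(11) that ijD(1) by (simp add: \<tau>'_def)
    fix a b c d assume abcd: "{a, b, c, d} \<subseteq> {1..n}" "distinct [a, b, c, d]"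
    let ?N = "\<lambda>kl. av (torus_coord {i, j} J \<tau>' kl)"
    have N: "?N {k, l} = trop_exp x {k, l} / trop_exp x ij"
      if "k \<in> {a, b, c, d}" "l \<in> {a, b, c, d}" "k \<noteq> l" for k l
      using av[of "{k, l}"] pair_in_pairs[of k n l] that abcd(1) ijD(1) by auto
    \<comment> \<open>Each side is quadratic in the coordinates, so normalising at \<open>ij\<close>
      divides by this square.\<close>
    let ?E = "trop_exp x ij * trop_exp x ij"
    have "trop_exp x {a, b} * trop_exp x {c, d} / ?E \<le>
        max (trop_exp x {a, c} * trop_exp x {b, d}) (trop_exp x {a, d} * trop_exp x {b, c}) / ?E"
      by (rule divide_right_mono[OF TGr_plucker[OF assms(1,6,7) abcd]]) simp
    also have "\<dots> = max (trop_exp x {a, c} * trop_exp x {b, d} / ?E) (trop_exp x {a, d} * trop_exp x {b, c} / ?E)"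
      by (rule max_divide_distrib_right[THEN trans]) simp
    finally show "?N {a, b} * ?N {c, d} \<le> max (?N {a, c} * ?N {b, d}) (?N {a, d} * ?N {b, c})"
      using abcd(2) by (simp add: N)
  qed
  have "initial_ideal \<nu>L res ?V y \<tau> (extend_ideal \<iota> ?V (GrJ_ideal n ij J)) =
      initial_ideal \<nu>L res ?V y \<tau>' (extend_ideal \<iota> ?V (GrJ_ideal n ij J))"
    by (rule initial_ideal_cong[OF extend_ideal_subset[OF GrJ_ideal_subset]]) (simp add: \<tau>'_def)
  then show ?thesis
    using tropical_multiplicity_eq_1 unfolding tropical_multiplicity_def initial_degeneration_def ijD(1)
    by simp
qed

end
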